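(* If there is a polynomial-time algorithm for the $(c,8c_0)$-LogBgt-TreeCov problem, then there is a polynomial-time algorithm for the $(3c,c_0)$-LogBgt-IntCov problem.
   Context: General convention: for an instance with ground set $\mathcal{U}$ of $n$ elements, feasible family $\mathcal{F}$ and pairwise disjoint groups $S_1,\dots,S_T\subseteq\mathcal{U}$, $T=\lceil\log_2 n\rceil$, a set $D$ is $c'$-valid if $D\in\mathcal{F}$ and $|D\cap S_i|\le c'2^i$ for all $i$; the $(c,c_0)$ problem ($c\ge c_0\ge1$) asks to output a $c$-valid solution or certify that no $c_0$-valid solution exists. LogBgt-IntCov: $\mathcal{U}$ is a finite set of intervals on the real line, $\Gamma$ a target interval, and $\mathcal{F}=\{D\subseteq\mathcal{U}:\Gamma\subseteq\bigcup_{I\in D}I\}$. LogBgt-TreeCov: $G=(V,E,r)$ is a rooted tree, $\mathcal{U}=V\setminus\{r\}$, $S_1,\dots,S_T$ partition $V\setminus\{r\}$, and for every node $u\in S_i$ and every child $v$ of $u$, $v\in S_j$ for some $j>i$. With $\mathrm{Des}(u)$ the set of descendants of $u$ (including $u$) and $\mathrm{Leaf}(G)$ the set of leaves, $\mathcal{F}=\{D\subseteq\mathcal{U}:\mathrm{Leaf}(G)\subseteq\bigcup_{u\in D}\mathrm{Des}(u)\}$. *)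

theory Defs
  imports
    Complex_Main
    "HOL-Library.Log_Nat"
    "HOL-Library.Disjoint_Sets"
    "HOL-Computational_Algebra.Polynomial"
begin

section \<open>Polynomial-time algorithms\<close>

text \<open>
  Algorithms are structured programs acting on binary trees with integer leaves, the
  integers being measured in binary.  Every primitive operation is computable in time
  polynomial in its input (given as a bit string) and is charged at least the sizes of its
  input and of its output; control constructs are charged for the data they copy or test.
  Hence everything a computation builds has size at most its cost, a run of cost
  \<open>t\<close> is simulated by a Turing machine in time polynomial in \<open>t\<close>,
  and conversely a Turing machine (its configuration being kept as two lists) is simulated
  with polynomial overhead.  So polynomial cost here is polynomial time in the usual sense.
\<close>

datatype val = Atom int | Cell val val

primrec val_size :: "val \<Rightarrow> nat" where
  "val_size (Atom n) = 1 + nat (bitlen \<bar>n\<bar>)"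
| "val_size (Cell a b) = 1 + val_size a + val_size b"

definition val_of_bool :: "bool \<Rightarrow> val" where
  "val_of_bool b = Atom (of_bool b)"

definition truthy :: "val \<Rightarrow> bool" where
  "truthy v \<longleftrightarrow> v \<noteq> Atom 0"

text \<open>Operations applied to data of the wrong shape return \<open>Atom 0\<close>.\<close>

datatype prim = Copy | Const val | First | Second | Is_Cell | Equal | Less | Add | Sub | Mult

fun on_cell :: "(val \<Rightarrow> val \<Rightarrow> val) \<Rightarrow> val \<Rightarrow> val" where
  "on_cell f (Cell a b) = f a b"
| "on_cell f (Atom n) = Atom 0"

fun on_ints :: "(int \<Rightarrow> int \<Rightarrow> val) \<Rightarrow> val \<Rightarrow> val" where
  "on_ints f (Cell (Atom a) (Atom b)) = f a b"
| "on_ints f _ = Atom 0"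

primrec prim_fun :: "prim \<Rightarrow> val \<Rightarrow> val" where
  "prim_fun Copy x = x"
| "prim_fun (Const v) x = v"
| "prim_fun First x = on_cell (\<lambda>a b. a) x"
| "prim_fun Second x = on_cell (\<lambda>a b. b) x"
| "prim_fun Is_Cell x = on_cell (\<lambda>a b. Atom 1) x"
| "prim_fun Equal x = on_cell (\<lambda>a b. val_of_bool (a = b)) x"
| "prim_fun Less x = on_ints (\<lambda>a b. val_of_bool (a < b)) x"
| "prim_fun Add x = on_ints (\<lambda>a b. Atom (a + b)) x"
| "prim_fun Sub x = on_ints (\<lambda>a b. Atom (a - b)) x"
| "prim_fun Mult x = on_ints (\<lambda>a b. Atom (a * b)) x"

datatype prog =
    Prim prim
  | Seq prog prog
  | Fork prog prog
  | Cond prog prog prog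
  | While prog prog

text \<open>\<open>run p x y t\<close>: program \<open>p\<close> on input \<open>x\<close> halts with output \<open>y\<close> at cost \<open>t\<close>.\<close>

inductive run :: "prog \<Rightarrow> val \<Rightarrow> val \<Rightarrow> nat \<Rightarrow> bool" where
  Prim: "run (Prim f) x (prim_fun f x) (val_size x + val_size (prim_fun f x))"
| Seq: "run p x y s \<Longrightarrow> run q y z t \<Longrightarrow> run (Seq p q) x z (1 + s + t)"
| Fork: "run p x y s \<Longrightarrow> run q x z t \<Longrightarrow>
    run (Fork p q) x (Cell y z) (s + t + val_size x + val_size (Cell y z))"
| Cond_True: "run p x b s \<Longrightarrow> truthy b \<Longrightarrow> run q x y t \<Longrightarrow>
    run (Cond p q r) x y (s + t + val_size x)"
| Cond_False: "run p x b s \<Longrightarrow> \<not> truthy b \<Longrightarrow> run r x y t \<Longrightarrow>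
    run (Cond p q r) x y (s + t + val_size x)"
| While_Stop: "run p x b s \<Longrightarrow> \<not> truthy b \<Longrightarrow> run (While p q) x x (s + val_size x)"
| While_Step: "run p x b s \<Longrightarrow> truthy b \<Longrightarrow> run q x y t \<Longrightarrow> run (While p q) y z u \<Longrightarrow>
    run (While p q) x z (s + t + u + val_size x)"

inductive_cases run_PrimE: "run (Prim f) x y t"
inductive_cases run_SeqE: "run (Seq p q) x y t"
inductive_cases run_ForkE: "run (Fork p q) x y t"
inductive_cases run_CondE: "run (Cond p q r) x y t"
inductive_cases run_WhileE: "run (While p q) x y t"

lemma run_deterministic:
  "run p x y t \<Longrightarrow> run p x y' t' \<Longrightarrow> y' = y \<and> t' = t"
proof (induction arbitrary: y' t' rule: run.induct)
  case Prim
  then show ?case by (auto elim: run_PrimE)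
next
  case Seq
  from Seq.prems show ?case
    by (cases rule: run_SeqE) (auto dest!: Seq.IH)
next
  case Fork
  from Fork.prems show ?case
    by (cases rule: run_ForkE) (auto dest!: Fork.IH)
next
  case Cond_True
  from Cond_True.prems show ?case
    by (cases rule: run_CondE) (auto dest!: Cond_True.IH simp: Cond_True.hyps)
next
  case Cond_False
  from Cond_False.prems show ?case
    by (cases rule: run_CondE) (auto dest!: Cond_False.IH simp: Cond_False.hyps)
next
  case While_Stop
  from While_Stop.prems show ?case
    by (cases rule: run_WhileE) (auto dest!: While_Stop.IH simp: While_Stop.hyps)
next
  case While_Step
  from While_Step.prems show ?case
    by (cases rule: run_WhileE) (auto dest!: While_Step.IH simp: While_Step.hyps)
qed

text \<open>
  A computational problem is given by the relation \<open>input i x\<close> (\<open>x\<close> is an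
  encoding of the instance \<open>i\<close>) and the relation \<open>correct i y\<close>
  (\<open>y\<close> encodes an admissible answer for \<open>i\<close>).
\<close>

definition poly_time_solvable :: "('i \<Rightarrow> val \<Rightarrow> bool) \<Rightarrow> ('i \<Rightarrow> val \<Rightarrow> bool) \<Rightarrow> bool" where
  "poly_time_solvable input correct \<longleftrightarrow>
     (\<exists>p. \<exists>q :: nat poly. \<forall>i x. input i x \<longrightarrow>
        (\<exists>y t. run p x y t \<and> t \<le> poly q (val_size x) \<and> correct i y))"


section \<open>Encodings\<close>

text \<open>A finite set is encoded by a repetition-free listing of its elements, in any order.\<close>

primrec list_code :: "val list \<Rightarrow> val" where
  "list_code [] = Atom 0"
| "list_code (v # vs) = Cell v (list_code vs)"

definition encodes_list :: "('a \<Rightarrow> val \<Rightarrow> bool) \<Rightarrow> 'a list \<Rightarrow> val \<Rightarrow> bool" where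
  "encodes_list R xs v \<longleftrightarrow> (\<exists>vs. list_all2 R xs vs \<and> v = list_code vs)"

definition encodes_set :: "('a \<Rightarrow> val \<Rightarrow> bool) \<Rightarrow> 'a set \<Rightarrow> val \<Rightarrow> bool" where
  "encodes_set R A v \<longleftrightarrow> (\<exists>xs. distinct xs \<and> set xs = A \<and> encodes_list R xs v)"

fun encodes_option :: "('a \<Rightarrow> val \<Rightarrow> bool) \<Rightarrow> 'a option \<Rightarrow> val \<Rightarrow> bool" where
  "encodes_option R None v \<longleftrightarrow> v = Atom 0"
| "encodes_option R (Some a) v \<longleftrightarrow> (\<exists>w. R a w \<and> v = Cell (Atom 1) w)"

definition nat_code :: "nat \<Rightarrow> val" where
  "nat_code n = Atom (int n)"

definition rat_code :: "rat \<Rightarrow> val" where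
  "rat_code q = (case quotient_of q of (a, b) \<Rightarrow> Cell (Atom a) (Atom b))"


section \<open>Logarithmic budgets\<close>

text \<open>
  Only the groups with indices in \<open>{1..T}\<close> are meaningful.  For \<open>n = 0\<close>,
  where the logarithm is undefined, \<open>T = 0\<close> (as \<open>log 2 0 = 0\<close> in HOL).
\<close>

definition num_groups :: "'a set \<Rightarrow> nat" where
  "num_groups U = nat \<lceil>log 2 (real (card U))\<rceil>"

definition valid_solution ::
  "'a set \<Rightarrow> 'a set set \<Rightarrow> (nat \<Rightarrow> 'a set) \<Rightarrow> real \<Rightarrow> 'a set \<Rightarrow> bool" where
  "valid_solution U F S c D \<longleftrightarrow>
     D \<in> F \<and> (\<forall>i\<in>{1..num_groups U}. real (card (D \<inter> S i)) \<le> c * 2 ^ i)"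

text \<open>\<open>None\<close> is the answer certifying that there is no \<open>c0\<close>-valid solution.\<close>

definition correct_answer ::
  "'a set \<Rightarrow> 'a set set \<Rightarrow> (nat \<Rightarrow> 'a set) \<Rightarrow> real \<Rightarrow> real \<Rightarrow> 'a set option \<Rightarrow> bool" where
  "correct_answer U F S c c0 ans \<longleftrightarrow>
     (case ans of
        Some D \<Rightarrow> valid_solution U F S c D
      | None \<Rightarrow> \<not> (\<exists>D. valid_solution U F S c0 D))"

definition encodes_groups ::
  "('a \<Rightarrow> val \<Rightarrow> bool) \<Rightarrow> 'a set \<Rightarrow> (nat \<Rightarrow> 'a set) \<Rightarrow> val \<Rightarrow> bool" where
  "encodes_groups R U S v \<longleftrightarrow>
     encodes_list (encodes_set R) (map S [1..<Suc (num_groups U)]) v"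


section \<open>Interval cover\<close>

text \<open>
  Intervals may be open, closed or half-open and bounded or unbounded.  So that they can be
  written down, their finite endpoints are rational.  For a nonempty interval the endpoint
  description is unique.
\<close>

datatype endpoint = Unbounded | Closed rat | Open rat

fun above :: "endpoint \<Rightarrow> real \<Rightarrow> bool" where
  "above Unbounded x \<longleftrightarrow> True"
| "above (Closed q) x \<longleftrightarrow> of_rat q \<le> x"
| "above (Open q) x \<longleftrightarrow> of_rat q < x"

fun below :: "endpoint \<Rightarrow> real \<Rightarrow> bool" where
  "below Unbounded x \<longleftrightarrow> True"
| "below (Closed q) x \<longleftrightarrow> x \<le> of_rat q"
| "below (Open q) x \<longleftrightarrow> x < of_rat q"

definition interval :: "endpoint \<Rightarrow> endpoint \<Rightarrow> real set" where
  "interval l u = {x. above l x \<and> below u x}"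

fun endpoint_code :: "endpoint \<Rightarrow> val" where
  "endpoint_code Unbounded = Atom 0"
| "endpoint_code (Closed q) = Cell (Atom 1) (rat_code q)"
| "endpoint_code (Open q) = Cell (Atom 2) (rat_code q)"

definition encodes_interval :: "real set \<Rightarrow> val \<Rightarrow> bool" where
  "encodes_interval I v \<longleftrightarrow>
     I \<noteq> {} \<and> (\<exists>l u. I = interval l u \<and> v = Cell (endpoint_code l) (endpoint_code u))"

record intcov =
  intervals :: "real set set"
  target :: "real set"
  int_group :: "nat \<Rightarrow> real set set"

definition intcov_feasible :: "intcov \<Rightarrow> real set set set" where
  "intcov_feasible P = {D. D \<subseteq> intervals P \<and> target P \<subseteq> \<Union>D}"

definition is_intcov :: "intcov \<Rightarrow> bool" where
  "is_intcov P \<longleftrightarrow>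
     finite (intervals P) \<and>
     (\<forall>i\<in>{1..num_groups (intervals P)}. int_group P i \<subseteq> intervals P) \<and>
     disjoint_family_on (int_group P) {1..num_groups (intervals P)}"

definition intcov_input :: "intcov \<Rightarrow> val \<Rightarrow> bool" where
  "intcov_input P x \<longleftrightarrow> is_intcov P \<and>
     (\<exists>u g s. encodes_set encodes_interval (intervals P) u \<and>
        encodes_interval (target P) g \<and>
        encodes_groups encodes_interval (intervals P) (int_group P) s \<and>
        x = Cell u (Cell g s))"

definition intcov_correct :: "real \<Rightarrow> real \<Rightarrow> intcov \<Rightarrow> val \<Rightarrow> bool" where
  "intcov_correct c c0 P y \<longleftrightarrow>
     (\<exists>ans. encodes_option (encodes_set encodes_interval) ans y \<and>
        correct_answer (intervals P) (intcov_feasible P) (int_group P) c c0 ans)"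

definition poly_time_LogBgt_IntCov :: "real \<Rightarrow> real \<Rightarrow> bool" where
  "poly_time_LogBgt_IntCov c c0 \<longleftrightarrow> poly_time_solvable intcov_input (intcov_correct c c0)"


section \<open>Tree cover\<close>

text \<open>Edges are directed from parent to child.\<close>

record treecov =
  verts :: "nat set"
  edges :: "(nat \<times> nat) set"
  root :: nat
  tree_group :: "nat \<Rightarrow> nat set"

definition rooted_tree :: "nat set \<Rightarrow> (nat \<times> nat) set \<Rightarrow> nat \<Rightarrow> bool" where
  "rooted_tree V E r \<longleftrightarrow>
     finite V \<and> r \<in> V \<and> E \<subseteq> V \<times> V \<and>
     (\<forall>v\<in>V. (r, v) \<in> E\<^sup>*) \<and>
     (\<forall>u. (u, r) \<notin> E) \<and>
     (\<forall>u u' v. (u, v) \<in> E \<longrightarrow> (u', v) \<in> E \<longrightarrow> u = u')"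

definition Des :: "treecov \<Rightarrow> nat \<Rightarrow> nat set" where
  "Des G u = {v. (u, v) \<in> (edges G)\<^sup>*}"

definition Leaf :: "treecov \<Rightarrow> nat set" where
  "Leaf G = {v \<in> verts G. \<forall>w. (v, w) \<notin> edges G}"

definition tree_ground :: "treecov \<Rightarrow> nat set" where
  "tree_ground G = verts G - {root G}"

definition treecov_feasible :: "treecov \<Rightarrow> nat set set" where
  "treecov_feasible G = {D. D \<subseteq> tree_ground G \<and> Leaf G \<subseteq> (\<Union>u\<in>D. Des G u)}"

text \<open>Groups of the partition may be empty.\<close>

definition is_treecov :: "treecov \<Rightarrow> bool" where
  "is_treecov G \<longleftrightarrow>
     rooted_tree (verts G) (edges G) (root G) \<and>
     (\<Union>i\<in>{1..num_groups (tree_ground G)}. tree_group G i) = tree_ground G \<and>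
     disjoint_family_on (tree_group G) {1..num_groups (tree_ground G)} \<and>
     (\<forall>i\<in>{1..num_groups (tree_ground G)}. \<forall>u\<in>tree_group G i. \<forall>v. (u, v) \<in> edges G \<longrightarrow>
        (\<exists>j\<in>{1..num_groups (tree_ground G)}. j > i \<and> v \<in> tree_group G j))"

definition encodes_nat :: "nat \<Rightarrow> val \<Rightarrow> bool" where
  "encodes_nat n v \<longleftrightarrow> v = nat_code n"

definition encodes_edge :: "nat \<times> nat \<Rightarrow> val \<Rightarrow> bool" where
  "encodes_edge e v \<longleftrightarrow> v = Cell (nat_code (fst e)) (nat_code (snd e))"

definition treecov_input :: "treecov \<Rightarrow> val \<Rightarrow> bool" where
  "treecov_input G x \<longleftrightarrow> is_treecov G \<and>
     (\<exists>vs es s. encodes_set encodes_nat (verts G) vs \<and>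
        encodes_set encodes_edge (edges G) es \<and>
        encodes_groups encodes_nat (tree_ground G) (tree_group G) s \<and>
        x = Cell vs (Cell es (Cell (nat_code (root G)) s)))"

definition treecov_correct :: "real \<Rightarrow> real \<Rightarrow> treecov \<Rightarrow> val \<Rightarrow> bool" where
  "treecov_correct c c0 G y \<longleftrightarrow>
     (\<exists>ans. encodes_option (encodes_set encodes_nat) ans y \<and>
        correct_answer (tree_ground G) (treecov_feasible G) (tree_group G) c c0 ans)"

definition poly_time_LogBgt_TreeCov :: "real \<Rightarrow> real \<Rightarrow> bool" where
  "poly_time_LogBgt_TreeCov c c0 \<longleftrightarrow> poly_time_solvable treecov_input (treecov_correct c c0)"

end

theory Submission
  imports Defs "HOL-Library.Product_Lexorder"
begin

text \<open>
  All intervals are clipped to the target and their endpoints replaced by ranks, so that an interval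
  becomes a half-open range of natural numbers whose level is its group, or one more than the number
  of groups if it has none.  Within each level a greedy left-to-right scan selects pieces: from the
  first uncovered point, jump to the farthest right end of an interval containing it.  The pieces of
  a level are disjoint, and every interval of the level is covered by at most two of them.

  To make the pieces of different levels laminar, every boundary of a piece is pushed successively
  through the higher levels: if it lies strictly inside a piece of that level, it moves to the right
  end of that piece.  Pushing is monotone and leaves no boundary strictly inside a piece of a higher
  level, so the resulting regions form a tree.

  A region exceeds its interval only on the right, and there it is covered by one crossing interval
  per higher level.  A tree solution with at most \<open>c * 2 ^ i\<close> nodes of each level \<open>i\<close> therefore
  yields at most \<open>c * 2 ^ j + (\<Sum>i<j. c * 2 ^ i) \<le> 3 * c * 2 ^ j\<close> intervals of level \<open>j\<close>.
  Conversely a point \<open>x\<close> of a piece starting at \<open>s\<close> lies in the region of one of the pieces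
  of its own or a higher level that contain \<open>s\<close>, and there is at most one of these per level.
  So \<open>c0 * 2 ^ i\<close> intervals of each level \<open>i\<close> need at most
  \<open>(\<Sum>i\<le>j. 2 * c0 * 2 ^ i) \<le> 8 * c0 * 2 ^ j\<close> nodes of level \<open>j\<close>.

  That the reduction runs in polynomial time is shown by closing the class of polynomial-time
  functions between encoded types under the constructions used to write it down.
\<close>

section \<open>Polynomial-time functions on encoded data\<close>

text \<open>Pieces of different levels overlap arbitrarily, whereas a tree needs nesting with the
  larger group index below. Hence a boundary moves only because of pieces of larger index, and
  always in the same direction, so that the moves are monotone and pieces of one level stay
  disjoint. The number of groups of a tree instance is dictated by its size, so the tree must be
  padded to exactly \<open>2 * n\<close> non-root vertices. Every padding leaf hangs from the root,
  which cannot be chosen, so every solution contains all of them. They sit in the last group, which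
  has no counterpart among the interval budgets and whose budget exceeds \<open>2 * n\<close>
  because \<open>n \<le> 2 ^ T\<close>; they therefore cost nothing. A tree instance always has a
  feasible solution (all non-root vertices), so a target that the intervals cannot cover has to be
  recognised separately, before the tree algorithm is called. Time bounds need care in two places:
  iterating a polynomial-time step can blow up the data, and the given tree algorithm promises
  nothing on inputs that do not encode a tree instance.\<close>

class code =
  fixes enc :: "'a \<Rightarrow> val"
  assumes enc_inject: "enc x = enc y \<longleftrightarrow> x = y"

instantiation val :: code
begin
definition enc_val :: "val \<Rightarrow> val" where "enc_val v = v"
instance by standard (simp add: enc_val_def)
end

instantiation bool :: code
begin
definition enc_bool :: "bool \<Rightarrow> val" where "enc_bool = val_of_bool"
instance by standard (auto simp: enc_bool_def val_of_bool_def)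
end

instantiation nat :: code
begin
definition enc_nat :: "nat \<Rightarrow> val" where "enc_nat = nat_code"
instance by standard (auto simp: enc_nat_def nat_code_def)
end

instantiation rat :: code
begin
definition enc_rat :: "rat \<Rightarrow> val" where "enc_rat = rat_code"
instance
  by standard (auto simp: enc_rat_def rat_code_def quotient_of_inject split: prod.splits dest: quotient_of_inject)
end

instantiation endpoint :: code
begin
definition enc_endpoint :: "endpoint \<Rightarrow> val" where "enc_endpoint = endpoint_code"
instance
proof
  fix x y :: endpoint
  show "enc x = enc y \<longleftrightarrow> x = y"
    by (cases x; cases y) (auto simp: enc_endpoint_def enc_inject[where 'a = rat, unfolded enc_rat_def])
qed
end

instantiation prod :: (code, code) code
begin
fun enc_prod :: "'a \<times> 'b \<Rightarrow> val" where "enc_prod (a, b) = Cell (enc a) (enc b)"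
instance by standard (auto simp: enc_inject)
end

instantiation option :: (code) code
begin
fun enc_option :: "'a option \<Rightarrow> val" where
  "enc_option None = Atom 0"
| "enc_option (Some a) = Cell (Atom 1) (enc a)"
instance
proof
  fix x y :: "'a option"
  show "enc x = enc y \<longleftrightarrow> x = y"
    by (cases x; cases y) (auto simp: enc_inject)
qed
end

instantiation list :: (code) code
begin
definition enc_list :: "'a list \<Rightarrow> val" where "enc_list xs = list_code (map enc xs)"
instance
proof
  fix x y :: "'a list"
  show "enc x = enc y \<longleftrightarrow> x = y"
    unfolding enc_list_def
  proof (induction x arbitrary: y)
    case Nil
    then show ?case by (cases y) auto
  next
    case (Cons a x)
    then show ?case by (cases y) (auto simp: enc_inject)
  qed
qed
end

lemma enc_list_simps [simp]:
  "enc [] = Atom 0"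
  "enc (x # xs) = Cell (enc x) (enc xs)"
  by (simp_all add: enc_list_def)

section \<open>Sizes of codes and polynomial bounds in them\<close>

definition sz :: "'a::code \<Rightarrow> nat" where
  "sz a = val_size (enc a)"

lemma val_size_pos: "Suc 0 \<le> val_size v"
  by (cases v) auto

lemma sz_pos: "Suc 0 \<le> sz a"
  by (simp add: sz_def val_size_pos)

lemma sz_simps [simp]:
  "sz (a, b) = 1 + sz a + sz b"
  "sz ([] :: 'c::code list) = 1"
  "sz (c # cs) = 1 + sz c + sz cs"
  "sz (None :: 'c option) = 1"
  "sz (Some c) = 3 + sz c"
  by (simp_all add: sz_def bitlen_alt_def)

lemma sz_bool_le: "sz (b::bool) \<le> 2"
  by (simp add: sz_def enc_bool_def val_of_bool_def bitlen_alt_def)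

lemma val_size_Atom_le_iff: "val_size (Atom i) \<le> Suc w \<longleftrightarrow> \<bar>i\<bar> < 2 ^ w"
  using bitlen_le_iff_power[of "\<bar>i\<bar>" "int w"] by (simp add: nat_le_iff)

lemma val_size_Atom_0: "val_size (Atom 0) = Suc 0"
  by (simp add: bitlen_alt_def)

lemma val_size_Atom_mult: "val_size (Atom (a * b)) \<le> val_size (Atom a) + val_size (Atom b)"
proof -
  obtain p q where p: "val_size (Atom a) = Suc p" and q: "val_size (Atom b) = Suc q" by simp
  then have "\<bar>a\<bar> < 2 ^ p" "\<bar>b\<bar> < 2 ^ q"
    using val_size_Atom_le_iff by (metis order_refl)+
  then have "\<bar>a * b\<bar> < 2 ^ (p + q)"
    unfolding abs_mult power_add by (intro mult_strict_mono') auto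
  then have "val_size (Atom (a * b)) \<le> Suc (p + q)"
    using val_size_Atom_le_iff by blast
  then show ?thesis using p q by simp
qed

lemma val_size_Atom_add: "val_size (Atom (a + b)) \<le> val_size (Atom a) + val_size (Atom b)"
proof -
  obtain p q where p: "val_size (Atom a) = Suc p" and q: "val_size (Atom b) = Suc q" by simp
  then have ab: "\<bar>a\<bar> < 2 ^ p" "\<bar>b\<bar> < 2 ^ q"
    using val_size_Atom_le_iff by (metis order_refl)+
  have "\<bar>a + b\<bar> < 2 ^ Suc (p + q)"
  proof -
    have "(2::int) ^ p \<le> 2 ^ (p + q)" "(2::int) ^ q \<le> 2 ^ (p + q)"
      by (intro power_increasing; simp)+
    with ab abs_triangle_ineq[of a b] show ?thesis unfolding power_Suc by linarith
  qed
  then have "val_size (Atom (a + b)) \<le> Suc (Suc (p + q))"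
    using val_size_Atom_le_iff by blast
  then show ?thesis using p q by simp
qed

lemma sz_nat_le_iff: "sz (n::nat) \<le> Suc w \<longleftrightarrow> n < 2 ^ w"
  using val_size_Atom_le_iff[of "int n" w]
  by (simp add: sz_def enc_nat_def nat_code_def del: val_size.simps)

lemma sz_nat_le: "sz (n::nat) \<le> Suc n"
  by (simp add: sz_nat_le_iff)

lemma sz_elem_le: "x \<in> set xs \<Longrightarrow> sz x \<le> sz xs"
  by (induction xs) auto

lemma length_le_sz: "length xs \<le> sz xs"
  by (induction xs) auto

lemma sz_list: "sz xs = 1 + (\<Sum>x\<leftarrow>xs. 1 + sz x)"
  by (induction xs) auto

lemma run_output_size: "run p x y t \<Longrightarrow> val_size y \<le> t"
  by (induction rule: run.induct) auto

text \<open>One constant serves as coefficient and as exponent. Sizes are at least 1, so enlarging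
  the constant only weakens the bound, and the closure proofs can always pass to a common larger
  constant.\<close>

definition polybounded :: "('a::code \<Rightarrow> nat) \<Rightarrow> bool" where
  "polybounded g \<longleftrightarrow> (\<exists>C. \<forall>a. g a \<le> C * sz a ^ C)"

lemma polybounded_mono: "polybounded g \<Longrightarrow> (\<And>a. f a \<le> g a) \<Longrightarrow> polybounded f"
  unfolding polybounded_def using order_trans by meson

lemma polybounded_const: "polybounded (\<lambda>_. k)"
  unfolding polybounded_def
  by (rule exI[of _ k]) (metis One_nat_def mult.right_neutral mult_le_mono2 one_le_power sz_pos)

lemma polybounded_sz: "polybounded sz"
  unfolding polybounded_def by (rule exI[of _ 1]) simp

lemma polybounded_add:
  assumes "polybounded f" "polybounded g" shows "polybounded (\<lambda>x. f x + g x)"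
proof -
  obtain C D where C: "\<And>a. f a \<le> C * sz a ^ C" and D: "\<And>a. g a \<le> D * sz a ^ D"
    using assms unfolding polybounded_def by blast
  have "f a + g a \<le> (C + D) * sz a ^ (C + D)" for a
  proof -
    have "f a \<le> C * sz a ^ (C + D)"
      using C[of a] by (rule order_trans) (intro mult_left_mono power_increasing, auto simp: sz_pos)
    moreover have "g a \<le> D * sz a ^ (C + D)"
      using D[of a] by (rule order_trans) (intro mult_left_mono power_increasing, auto simp: sz_pos)
    ultimately show ?thesis by (simp add: algebra_simps)
  qed
  then show ?thesis unfolding polybounded_def by blast
qed

lemma polybounded_mult:
  assumes "polybounded f" "polybounded g" shows "polybounded (\<lambda>x. f x * g x)"
proof -
  obtain C D where C: "\<And>a. f a \<le> C * sz a ^ C" and D: "\<And>a. g a \<le> D * sz a ^ D"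
    using assms unfolding polybounded_def by blast
  have "f a * g a \<le> (C * D + C + D) * sz a ^ (C * D + C + D)" for a
  proof -
    have "f a * g a \<le> (C * sz a ^ C) * (D * sz a ^ D)"
      using C D by (intro mult_mono) auto
    also have "\<dots> = (C * D) * sz a ^ (C + D)"
      by (simp add: power_add)
    also have "\<dots> \<le> (C * D + C + D) * sz a ^ (C * D + C + D)"
      by (intro mult_mono power_increasing) (auto simp: sz_pos)
    finally show ?thesis .
  qed
  then show ?thesis unfolding polybounded_def by blast
qed

lemma polybounded_comp_sz:
  assumes g: "polybounded g" and f: "polybounded (\<lambda>x. sz (f x))" shows "polybounded (\<lambda>x. g (f x))"
proof -
  obtain C D where C: "\<And>a. g a \<le> C * sz a ^ C" and D: "\<And>a. sz (f a) \<le> D * sz a ^ D"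
    using assms unfolding polybounded_def by blast
  define K where "K = C * D ^ C + D * C"
  have "g (f a) \<le> K * sz a ^ K" for a
  proof -
    have "g (f a) \<le> C * (D * sz a ^ D) ^ C"
      using C[of "f a"] by (rule order_trans) (intro mult_left_mono power_mono D, auto)
    also have "\<dots> = (C * D ^ C) * sz a ^ (D * C)"
      by (simp add: power_mult_distrib power_mult)
    also have "\<dots> \<le> K * sz a ^ K"
      unfolding K_def by (intro mult_mono power_increasing) (auto simp: sz_pos)
    finally show ?thesis .
  qed
  then show ?thesis unfolding polybounded_def by blast
qed

section \<open>Polynomial-time functions: basic operations, branching and case distinction\<close>

definition polytime :: "('a::code \<Rightarrow> 'b::code) \<Rightarrow> bool" where
  "polytime f \<longleftrightarrow> (\<exists>p c. polybounded c \<and> (\<forall>a. \<exists>t. run p (enc a) (enc (f a)) t \<and> t \<le> c a))"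

lemma polytimeI_bound:
  assumes "polybounded c" "\<And>a. \<exists>t. run p (enc a) (enc (f a)) t \<and> t \<le> c a"
  shows "polytime f"
  using assms unfolding polytime_def by blast

lemma polytimeI:
  assumes "\<And>a. run p (enc a) (enc (f a)) (c a)" "polybounded c"
  shows "polytime f"
  using assms unfolding polytime_def by blast

text \<open>Fixing the exact cost as a function of the argument lets the costs of compound programs
  be read off the rules of \<open>run\<close> directly.\<close>

lemma polytimeE:
  assumes "polytime f"
  obtains p c where "\<And>a. run p (enc a) (enc (f a)) (c a)" "polybounded c"
proof -
  obtain p d where d: "polybounded d" and "\<forall>a. \<exists>t. run p (enc a) (enc (f a)) t \<and> t \<le> d a"
    using assms unfolding polytime_def by blast
  then obtain c where "\<forall>a. run p (enc a) (enc (f a)) (c a) \<and> c a \<le> d a" by metis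
  then show ?thesis using that polybounded_mono[OF d] by blast
qed

text \<open>For arguments whose size is only known through an upper bound \<open>s\<close>, such as
  loop states or the answer of another program.\<close>

lemma polytimeE_mono:
  assumes "polytime f"
  obtains p C where "\<And>a s. sz a \<le> s \<Longrightarrow> \<exists>t\<le>C * s ^ C. run p (enc a) (enc (f a)) t"
proof -
  obtain p c where p: "\<And>a. run p (enc a) (enc (f a)) (c a)" and "polybounded c" using polytimeE assms by blast
  then obtain C where C: "\<And>a. c a \<le> C * sz a ^ C" unfolding polybounded_def by blast
  have "\<exists>t\<le>C * s ^ C. run p (enc a) (enc (f a)) t" if "sz a \<le> s" for a s
    using p[of a] order_trans[OF C[of a] mult_left_mono[OF power_mono[OF that]]] by blast
  then show ?thesis using that by blast
qed

text \<open>Every run is charged for its output, so the sizes of intermediate results need no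
  separate estimate.\<close>

lemma polytime_PB_sz: "polytime f \<Longrightarrow> polybounded (\<lambda>x. sz (f x))"
  by (erule polytimeE, erule polybounded_mono) (auto simp: sz_def intro: run_output_size)

lemma polybounded_power: "polybounded f \<Longrightarrow> polybounded (\<lambda>x. f x ^ n)"
  by (induction n) (auto intro: polybounded_const polybounded_mult simp del: One_nat_def)

lemmas polybounded_intros = polybounded_const polybounded_sz polybounded_add polybounded_mult polybounded_power polytime_PB_sz

lemma polybounded_comp: "polybounded g \<Longrightarrow> polytime f \<Longrightarrow> polybounded (\<lambda>x. g (f x))"
  by (rule polybounded_comp_sz[OF _ polytime_PB_sz])

lemma polytime_prim:
  assumes "\<And>a. prim_fun q (enc a) = enc (f a)" "polybounded (\<lambda>a. sz (f a))"
  shows "polytime f"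
proof (rule polytimeI)
  fix a show "run (Prim q) (enc a) (enc (f a)) (sz a + sz (f a))"
    using run.Prim[of q "enc a"] by (simp add: assms sz_def)
qed (intro polybounded_intros assms)

lemma polytime_id: "polytime (\<lambda>x. x)"
  by (rule polytime_prim[of Copy]) (auto intro: polybounded_intros)

lemma polytime_const: "polytime (\<lambda>x. k)"
  by (rule polytime_prim[of "Const (enc k)"]) (auto intro: polybounded_intros)

lemma polytime_fst0: "polytime fst"
  by (rule polytime_prim[of First]) (auto intro!: polybounded_mono[OF polybounded_sz])

lemma polytime_snd0: "polytime snd"
  by (rule polytime_prim[of Second]) (auto intro!: polybounded_mono[OF polybounded_sz])

lemma polytime_comp:
  assumes "polytime g" "polytime f" shows "polytime (\<lambda>x. g (f x))"
proof -
  obtain p c where p: "\<And>a. run p (enc a) (enc (f a)) (c a)" "polybounded c" using polytimeE assms(2) by blast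
  obtain q d where q: "\<And>a. run q (enc a) (enc (g a)) (d a)" "polybounded d" using polytimeE assms(1) by blast
  show ?thesis
    by (rule polytimeI, rule run.Seq[OF p(1) q(1)]) (intro polybounded_intros p(2) polybounded_comp[OF q(2) assms(2)])
qed

lemma polytime_pair:
  assumes "polytime f" "polytime g" shows "polytime (\<lambda>x. (f x, g x))"
proof -
  obtain p c where p: "\<And>a. run p (enc a) (enc (f a)) (c a)" "polybounded c" using polytimeE assms(1) by blast
  obtain q d where q: "\<And>a. run q (enc a) (enc (g a)) (d a)" "polybounded d" using polytimeE assms(2) by blast
  show ?thesis
  proof (rule polytimeI)
    fix a show "run (Fork p q) (enc a) (enc (f a, g a)) (c a + d a + sz a + (1 + sz (f a) + sz (g a)))"
      using run.Fork[OF p(1) q(1), of a] by (simp add: sz_def)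
  qed (intro polybounded_intros p(2) q(2) assms)
qed

lemma truthy_enc_bool: "truthy (enc b) \<longleftrightarrow> b"
  by (simp add: truthy_def enc_bool_def val_of_bool_def)

lemma polytime_if:
  assumes "polytime b" "polytime f" "polytime g" shows "polytime (\<lambda>x. if b x then f x else g x)"
proof -
  obtain r e where r: "\<And>a. run r (enc a) (enc (b a)) (e a)" "polybounded e" using polytimeE assms(1) by blast
  obtain p c where p: "\<And>a. run p (enc a) (enc (f a)) (c a)" "polybounded c" using polytimeE assms(2) by blast
  obtain q d where q: "\<And>a. run q (enc a) (enc (g a)) (d a)" "polybounded d" using polytimeE assms(3) by blast
  show ?thesis
  proof (rule polytimeI)
    fix a show "run (Cond r p q) (enc a) (enc (if b a then f a else g a)) (e a + (if b a then c a else d a) + sz a)"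
      using run.Cond_True[OF r(1)[of a] _ p(1)] run.Cond_False[OF r(1)[of a] _ q(1)]
      by (auto simp: truthy_enc_bool sz_def)
  next
    show "polybounded (\<lambda>a. e a + (if b a then c a else d a) + sz a)"
      by (rule polybounded_mono[of "\<lambda>a. e a + (c a + d a) + sz a"], intro polybounded_intros r p q) simp
  qed
qed

lemma polytime_fst: "polytime f \<Longrightarrow> polytime (\<lambda>x. fst (f x))"
  by (rule polytime_comp[OF polytime_fst0])

lemma polytime_snd: "polytime f \<Longrightarrow> polytime (\<lambda>x. snd (f x))"
  by (rule polytime_comp[OF polytime_snd0])

lemma polytime_eq: assumes "polytime f" "polytime g" shows "polytime (\<lambda>x. f x = g x)"
proof -
  have "polytime (\<lambda>(a::'b, b). a = b)"
    by (rule polytime_prim[of Equal]) (auto simp: enc_bool_def enc_inject intro!: polybounded_mono[OF polybounded_const] sz_bool_le split: prod.splits)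
  from polytime_comp[OF this polytime_pair[OF assms]] show ?thesis by simp
qed

lemma polytime_cong: "polytime f \<Longrightarrow> (\<And>x. f x = g x) \<Longrightarrow> polytime g"
  by (metis ext)

lemma polytime_not: "polytime b \<Longrightarrow> polytime (\<lambda>x. \<not> b x)"
  by (rule polytime_cong[OF polytime_if[of b "\<lambda>_. False" "\<lambda>_. True"]]) (auto intro: polytime_const)

lemma polytime_conj: "polytime a \<Longrightarrow> polytime b \<Longrightarrow> polytime (\<lambda>x. a x \<and> b x)"
  by (rule polytime_cong[OF polytime_if[of a b "\<lambda>_. False"]]) (auto intro: polytime_const)

lemma polytime_disj: "polytime a \<Longrightarrow> polytime b \<Longrightarrow> polytime (\<lambda>x. a x \<or> b x)"
  by (rule polytime_cong[OF polytime_if[of a "\<lambda>_. True" b]]) (auto intro: polytime_const)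

lemma polytime_imp: "polytime a \<Longrightarrow> polytime b \<Longrightarrow> polytime (\<lambda>x. a x \<longrightarrow> b x)"
  by (rule polytime_cong[OF polytime_if[of a b "\<lambda>_. True"]]) (auto intro: polytime_const)

lemma polytime_less: assumes "polytime f" "polytime (g :: 'a::code \<Rightarrow> nat)" shows "polytime (\<lambda>x. f x < g x)"
proof -
  have "polytime (\<lambda>(a::nat, b). a < b)"
    by (rule polytime_prim[of Less])
       (auto simp: enc_bool_def enc_nat_def nat_code_def intro!: polybounded_mono[OF polybounded_const] sz_bool_le split: prod.splits)
  from polytime_comp[OF this polytime_pair[OF assms]] show ?thesis by simp
qed

lemma polytime_le: assumes "polytime f" "polytime (g :: 'a::code \<Rightarrow> nat)" shows "polytime (\<lambda>x. f x \<le> g x)"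
  using polytime_not[OF polytime_less[OF assms(2,1)]] by (simp add: not_less)

lemma sz_add_le: "sz (a + b :: nat) \<le> sz a + sz b"
  using val_size_Atom_add[of "int a" "int b"]
  by (simp add: sz_def enc_nat_def nat_code_def del: val_size.simps)

lemma polytime_plus: assumes "polytime f" "polytime (g :: 'a::code \<Rightarrow> nat)" shows "polytime (\<lambda>x. f x + g x)"
proof -
  have "polybounded (\<lambda>x. sz (fst x + snd x :: nat))"
    by (rule polybounded_mono[OF polybounded_sz]) (auto intro: order_trans[OF sz_add_le])
  then have "polytime (\<lambda>(a::nat, b). a + b)"
    by (intro polytime_prim[of Add]) (auto simp: enc_nat_def nat_code_def case_prod_beta)
  from polytime_comp[OF this polytime_pair[OF assms]] show ?thesis by simp
qed

lemma polytime_Suc: "polytime f \<Longrightarrow> polytime (\<lambda>x. Suc (f x))"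
  using polytime_plus[of f "\<lambda>_. 1"] by (simp add: polytime_const)

lemma polytime_max: "polytime f \<Longrightarrow> polytime (g :: 'a::code \<Rightarrow> nat) \<Longrightarrow> polytime (\<lambda>x. max (f x) (g x))"
  unfolding max_def by (intro polytime_if polytime_le)

lemma polytime_min: "polytime f \<Longrightarrow> polytime (g :: 'a::code \<Rightarrow> nat) \<Longrightarrow> polytime (\<lambda>x. min (f x) (g x))"
  unfolding min_def by (intro polytime_if polytime_le)

text \<open>A \<open>val\<close> is its own code. Functions can thus be assembled from primitives on
  raw codes, even when the intermediate values belong to no encoded type.\<close>

lemma polytime_enc_iff: "polytime (\<lambda>x. enc (f x)) \<longleftrightarrow> polytime f"
  by (simp add: polytime_def enc_val_def)

lemma polytime_Cell: "polytime f \<Longrightarrow> polytime g \<Longrightarrow> polytime (\<lambda>x. Cell (f x) (g x))"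
  using polytime_enc_iff[of "\<lambda>x. (f x, g x)"] polytime_pair[of f g] by (simp add: enc_val_def)

lemma polytime_First: "polytime f \<Longrightarrow> polytime (\<lambda>x. prim_fun First (f x))"
  apply (rule polytime_comp[of "prim_fun First"], rule polytime_prim[of First], simp add: enc_val_def)
  subgoal
    apply (rule polybounded_mono[OF polybounded_sz])
    subgoal for a by (cases a) (simp_all add: sz_def enc_val_def bitlen_alt_def)
    done
  apply assumption
  done

lemma polytime_Second: "polytime f \<Longrightarrow> polytime (\<lambda>x. prim_fun Second (f x))"
  apply (rule polytime_comp[of "prim_fun Second"], rule polytime_prim[of Second], simp add: enc_val_def)
  subgoal
    apply (rule polybounded_mono[OF polybounded_sz])
    subgoal for a by (cases a) (simp_all add: sz_def enc_val_def bitlen_alt_def)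
    done
  apply assumption
  done

lemma on_ints_cases: "(\<exists>i j. a = Cell (Atom i) (Atom j)) \<or> on_ints f a = Atom 0"
  by (cases "(f, a)" rule: on_ints.cases) auto

lemma polytime_Mult: "polytime f \<Longrightarrow> polytime (\<lambda>x. prim_fun Mult (f x))"
  apply (rule polytime_comp[of "prim_fun Mult"], rule polytime_prim[of Mult], simp add: enc_val_def)
  subgoal
    apply (rule polybounded_mono[OF polybounded_sz])
    subgoal for a
      using on_ints_cases[of a "\<lambda>i j. Atom (i * j)"] sz_pos[of a] le_SucI[OF val_size_Atom_mult]
      by (auto simp: sz_def enc_val_def val_size_Atom_0 simp del: val_size.simps(1))
    done
  apply assumption
  done

lemma polytime_Less: "polytime f \<Longrightarrow> polytime (\<lambda>x. prim_fun Less (f x))"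
  apply (rule polytime_comp[of "prim_fun Less"], rule polytime_prim[of Less], simp add: enc_val_def)
  subgoal
    apply (rule polybounded_mono[OF polybounded_const[of 2]])
    subgoal for a
      using on_ints_cases[of a "\<lambda>i j. val_of_bool (i < j)"]
      by (auto simp: sz_def enc_val_def val_of_bool_def bitlen_alt_def)
    done
  apply assumption
  done

text \<open>Cross-multiplication, valid because \<open>quotient_of\<close> yields positive
  denominators. It is carried out on raw codes since numerators are integers, for which there is no
  \<open>code\<close> instance.\<close>

lemma polytime_rat_less: assumes "polytime f" "polytime (g :: 'a::code \<Rightarrow> rat)" shows "polytime (\<lambda>x. f x < g x)"
proof -
  let ?m1 = "\<lambda>x. prim_fun Mult (Cell (prim_fun First (enc (f x))) (prim_fun Second (enc (g x))))"
  let ?m2 = "\<lambda>x. prim_fun Mult (Cell (prim_fun First (enc (g x))) (prim_fun Second (enc (f x))))"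
  have "polytime (\<lambda>x. prim_fun Less (Cell (?m1 x) (?m2 x)))"
    by (intro polytime_Less polytime_Cell polytime_Mult polytime_First polytime_Second) (simp_all add: polytime_enc_iff assms)
  moreover have "prim_fun Less (Cell (?m1 x) (?m2 x)) = enc (f x < g x)" for x
    by (simp add: enc_rat_def rat_code_def rat_less_code enc_bool_def mult.commute split: prod.splits)
  ultimately show ?thesis by (simp add: polytime_enc_iff)
qed

lemma polytime_Some: assumes "polytime f" shows "polytime (\<lambda>x. Some (f x))"
proof -
  have "polytime (\<lambda>x. Cell (Atom 1) (enc (f x)))"
    by (intro polytime_Cell polytime_const) (simp add: polytime_enc_iff assms)
  then have "polytime (\<lambda>x. enc (Some (f x)))" by simp
  then show ?thesis by (simp only: polytime_enc_iff)
qed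

lemma polytime_Cons: assumes "polytime f" "polytime g" shows "polytime (\<lambda>x. f x # g x)"
proof -
  obtain p c where p: "\<And>a. run p (enc a) (enc (f a, g a)) (c a)" "polybounded c" using polytimeE polytime_pair[OF assms] by blast
  show ?thesis
    by (rule polytimeI[of p]) (use p in auto)
qed

text \<open>The test is whether the code is a cell: codes of lists and options are cells exactly when nonempty.\<close>

lemma polytime_case_list:
  assumes l: "polytime l" and f: "polytime f" and g: "polytime (\<lambda>z. g (fst z) (fst (snd z)) (snd (snd z)))"
  shows "polytime (\<lambda>x. case l x of [] \<Rightarrow> f x | y # ys \<Rightarrow> g y ys x)"
proof -
  obtain p c where p: "\<And>a. run p (enc a) (enc (l a)) (c a)" "polybounded c" using polytimeE l by blast
  obtain q d where q: "\<And>a. run q (enc a) (enc (f a)) (d a)" "polybounded d" using polytimeE f by blast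
  obtain r C where r: "\<And>z s. sz z \<le> s \<Longrightarrow>
      \<exists>t\<le>C * s ^ C. run r (enc z) (enc (g (fst z) (fst (snd z)) (snd (snd z)))) t"
    by (rule polytimeE_mono[OF g]) (rule that)
  let ?P = "Cond (Seq p (Prim Is_Cell)) (Seq (Fork (Seq p (Prim First)) (Fork (Seq p (Prim Second)) (Prim Copy))) r) q"
  let ?s = "\<lambda>x. 2 + sz (l x) + sz x"
  define e where "e x = C * ?s x ^ C" for x
  let ?c =  "\<lambda>x. 3 * c x + d x + e x + 20 * ?s x"
  show ?thesis
  proof (rule polytimeI_bound)
    show "polybounded ?c" unfolding e_def by (intro polybounded_intros p q l)
    fix x
    let ?g = "\<lambda>x. case l x of [] \<Rightarrow> f x | y # ys \<Rightarrow> g y ys x"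
    show "\<exists>t. run ?P (enc x) (enc (?g x)) t \<and> t \<le> ?c x"
    proof (cases "l x")
      case Nil
      have "run (Seq p (Prim Is_Cell)) (enc x) (Atom 0) (1 + c x + 2)"
        using run.Seq[OF p(1)[of x] run.Prim[of Is_Cell]] by (simp add: Nil bitlen_alt_def)
      from run.Cond_False[OF this _ q(1)] have "run ?P (enc x) (enc (f x)) (1 + c x + 2 + d x + sz x)"
        by (simp add: truthy_def sz_def)
      then have "run ?P (enc x) (enc (?g x)) (1 + c x + 2 + d x + sz x)" by (simp add: Nil)
      moreover have "1 + c x + 2 + d x + sz x \<le> ?c x"
        using le_add1[of "1 + c x + 2 + d x + sz x" "2 * c x + e x + 37 + 20 * sz (l x) + 19 * sz x"]
        by (simp add: algebra_simps)
      ultimately show ?thesis by blast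
    next
      case (Cons y ys)
      let ?l = "Cell (enc y) (enc ys)"
      have p': "run p (enc x) ?l (c x)" using p(1)[of x] by (simp add: Cons)
      have 1: "run (Seq p (Prim Is_Cell)) (enc x) (Atom 1) (1 + c x + (sz (l x) + 2))"
        using run.Seq[OF p' run.Prim[of Is_Cell]] by (simp add: Cons bitlen_alt_def sz_def)
      obtain t where t: "run r (Cell (enc y) (Cell (enc ys) (enc x))) (enc (g y ys x)) t" "t \<le> e x"
        using r[of "(y, ys, x)" "?s x"] by (auto simp: Cons e_def)
      note 2 = run.Cond_True[OF 1 _ run.Seq[OF run.Fork[OF run.Seq[OF p' run.Prim[of First]]
          run.Fork[OF run.Seq[OF p' run.Prim[of Second]] run.Prim[of Copy]]]]]
      show ?thesis
        apply (intro exI conjI)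
         apply (simp only: Cons list.case)
         apply (rule 2)
          apply (simp add: truthy_def)
         apply (simp del: val_size.simps)
         apply (rule t(1))
        using t(2) apply (simp add: Cons sz_def)
        done
    qed
  qed
qed

lemma polytime_case_option:
  assumes l: "polytime l" and f: "polytime f" and g: "polytime (\<lambda>z. g (fst z) (snd z))"
  shows "polytime (\<lambda>x. case l x of None \<Rightarrow> f x | Some y \<Rightarrow> g y x)"
proof -
  obtain p c where p: "\<And>a. run p (enc a) (enc (l a)) (c a)" "polybounded c" using polytimeE l by blast
  obtain q d where q: "\<And>a. run q (enc a) (enc (f a)) (d a)" "polybounded d" using polytimeE f by blast
  obtain r C where r: "\<And>z s. sz z \<le> s \<Longrightarrow> \<exists>t\<le>C * s ^ C. run r (enc z) (enc (g (fst z) (snd z))) t"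
    by (rule polytimeE_mono[OF g]) (rule that)
  let ?P = "Cond (Seq p (Prim Is_Cell)) (Seq (Fork (Seq p (Prim Second)) (Prim Copy)) r) q"
  let ?s = "\<lambda>x. 2 + sz (l x) + sz x"
  define e where "e x = C * ?s x ^ C" for x
  let ?c =  "\<lambda>x. 3 * c x + d x + e x + 20 * ?s x"
  show ?thesis
  proof (rule polytimeI_bound)
    show "polybounded ?c" unfolding e_def by (intro polybounded_intros p q l)
    fix x
    let ?g = "\<lambda>x. case l x of None \<Rightarrow> f x | Some y \<Rightarrow> g y x"
    show "\<exists>t. run ?P (enc x) (enc (?g x)) t \<and> t \<le> ?c x"
    proof (cases "l x")
      case None
      have "run (Seq p (Prim Is_Cell)) (enc x) (Atom 0) (1 + c x + 2)"
        using run.Seq[OF p(1)[of x] run.Prim[of Is_Cell]] by (simp add: None bitlen_alt_def)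
      from run.Cond_False[OF this _ q(1)] have "run ?P (enc x) (enc (f x)) (1 + c x + 2 + d x + sz x)"
        by (simp add: truthy_def sz_def)
      then have "run ?P (enc x) (enc (?g x)) (1 + c x + 2 + d x + sz x)" by (simp add: None)
      moreover have "1 + c x + 2 + d x + sz x \<le> ?c x"
        using le_add1[of "1 + c x + 2 + d x + sz x" "2 * c x + e x + 37 + 20 * sz (l x) + 19 * sz x"]
        by (simp add: algebra_simps)
      ultimately show ?thesis by blast
    next
      case (Some y)
      let ?l = "Cell (Atom 1) (enc y)"
      have p': "run p (enc x) ?l (c x)" using p(1)[of x] by (simp add: Some)
      have 1: "run (Seq p (Prim Is_Cell)) (enc x) (Atom 1) (1 + c x + (sz (l x) + 2))"
        using run.Seq[OF p' run.Prim[of Is_Cell]] by (simp add: Some bitlen_alt_def sz_def)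
      obtain t where t: "run r (Cell (enc y) (enc x)) (enc (g y x)) t" "t \<le> e x"
        using r[of "(y, x)" "?s x"] by (auto simp: Some e_def)
      note 2 = run.Cond_True[OF 1 _ run.Seq[OF run.Fork[OF
          run.Seq[OF p' run.Prim[of Second]] run.Prim[of Copy]]]]
      show ?thesis
        apply (intro exI conjI)
         apply (simp only: Some option.case)
         apply (rule 2)
          apply (simp add: truthy_def)
         apply (simp del: val_size.simps)
         apply (rule t(1))
        using t(2) apply (simp add: Some sz_def)
        done
    qed
  qed
qed

section \<open>Loops and list functions\<close>

lemma polytime_while:
  fixes init :: "'a::code \<Rightarrow> 's::code" and body :: "'s \<Rightarrow> 's"
  assumes test: "polytime test" and body: "polytime body" and init: "polytime init"
    and N: "polybounded N" and B: "polybounded B"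
    and size: "\<And>x i. i \<le> N x \<Longrightarrow> sz ((body ^^ i) (init x)) \<le> B x"
    and go: "\<And>x i. i < N x \<Longrightarrow> test ((body ^^ i) (init x))"
    and stop: "\<And>x. \<not> test ((body ^^ N x) (init x))"
  shows "polytime (\<lambda>x. (body ^^ N x) (init x))"
proof -
  obtain p C where p: "\<And>z s. sz z \<le> s \<Longrightarrow> \<exists>t\<le>C * s ^ C. run p (enc z) (enc (test z)) t"
    by (rule polytimeE_mono[OF test]) (rule that)
  obtain q D where q: "\<And>z s. sz z \<le> s \<Longrightarrow> \<exists>t\<le>D * s ^ D. run q (enc z) (enc (body z)) t"
    by (rule polytimeE_mono[OF body]) (rule that)
  obtain r c where r: "\<And>a. run r (enc a) (enc (init a)) (c a)" "polybounded c" using polytimeE init by blast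
  \<comment> \<open>Cost of one round: the test, the body and the copying charge, each on a state of
    size at most \<open>B x\<close>.\<close>
  define K where "K x = C * B x ^ C + D * B x ^ D + B x" for x
  define S where "S x i = (body ^^ i) (init x)" for x i
  \<comment> \<open>Induction on the number of rounds still to go, because \<open>While_Step\<close>
    extends a run of the remaining loop by one round in front.\<close>
  have "\<exists>t. run (While p q) (enc (S x (N x - i))) (enc (S x (N x))) t \<and> t \<le> (i + 1) * K x"
    if "i \<le> N x" for x i using that
  proof (induction i)
    case 0
    obtain t where t: "run p (enc (S x (N x))) (enc (test (S x (N x)))) t" "t \<le> C * B x ^ C"
      using p[of "S x (N x)" "B x"] size[of "N x" x] by (auto simp: S_def)
    from run.While_Stop[OF t(1), of q] t(2) size[of "N x" x] stop[of x]
    show ?case by (intro exI conjI) (auto simp: truthy_enc_bool K_def S_def[symmetric] sz_def[symmetric])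
  next
    case (Suc i)
    let ?j = "N x - Suc i"
    have j: "N x - i = Suc ?j" "?j < N x" "?j \<le> N x" using Suc.prems by auto
    obtain t where t: "run p (enc (S x ?j)) (enc (test (S x ?j))) t" "t \<le> C * B x ^ C"
      using p[of "S x ?j" "B x"] size[OF j(3)] by (auto simp: S_def)
    obtain u where u: "run q (enc (S x ?j)) (enc (S x (N x - i))) u" "u \<le> D * B x ^ D"
      using q[of "S x ?j" "B x"] size[OF j(3)] unfolding j(1) by (auto simp: S_def)
    obtain v where v: "run (While p q) (enc (S x (N x - i))) (enc (S x (N x))) v" "v \<le> (i + 1) * K x"
      using Suc by auto
    from run.While_Step[OF t(1) _ u(1) v(1)] go[OF j(2)]
    have "run (While p q) (enc (S x ?j)) (enc (S x (N x))) (t + u + v + sz (S x ?j))"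
      by (simp add: truthy_enc_bool S_def sz_def)
    moreover have "t + u + v + sz (S x ?j) \<le> (Suc i + 1) * K x"
      using t(2) u(2) v(2) size[OF j(3)] by (simp add: K_def S_def)
    ultimately show ?case by blast
  qed
  from this[of "N x" x for x]
  have W: "\<exists>t. run (While p q) (enc (init x)) (enc (S x (N x))) t \<and> t \<le> (N x + 1) * K x" for x
    by (auto simp: S_def)
  show ?thesis
  proof (rule polytimeI_bound)
    show "polybounded (\<lambda>x. 1 + c x + (N x + 1) * K x)"
      unfolding K_def by (intro polybounded_intros N B r)
    show "\<exists>t. run (Seq r (While p q)) (enc x) (enc ((body ^^ N x) (init x))) t \<and> t \<le> 1 + c x + (N x + 1) * K x" for x
      using W[of x] run.Seq[OF r(1)[of x]] unfolding S_def by (metis add_left_mono)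
  qed
qed

lemmas polytime_basic = polytime_id polytime_const polytime_pair polytime_fst polytime_snd polytime_if polytime_eq polytime_not polytime_conj polytime_disj polytime_imp
  polytime_less polytime_le polytime_plus polytime_Suc polytime_max polytime_min polytime_rat_less polytime_Some polytime_Cons polytime_case_list polytime_case_option

text \<open>The size hypothesis on all prefixes is indispensable in this form: a polynomial-time
  step may double its accumulator each time. Programs have no variables, so the loop state is the
  accumulator, the rest of the list and the context \<open>x\<close>, which is carried along
  unchanged.\<close>

lemma polytime_fold:
  fixes l :: "'x::code \<Rightarrow> 'e::code list" and init :: "'x \<Rightarrow> 'c::code"
  assumes step: "polytime (\<lambda>z. f (fst z) (fst (snd z)) (snd (snd z)))"
    and l: "polytime l" and init: "polytime init" and B: "polybounded B"
    and size: "\<And>x ys zs. l x = ys @ zs \<Longrightarrow> sz (fold (\<lambda>e a. f e a x) ys (init x)) \<le> B x"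
  shows "polytime (\<lambda>x. fold (\<lambda>e a. f e a x) (l x) (init x))"
proof -
  let ?test = "\<lambda>z :: 'c \<times> 'e list \<times> 'x. fst (snd z) \<noteq> []"
  let ?body = "\<lambda>z :: 'c \<times> 'e list \<times> 'x. case fst (snd z) of [] \<Rightarrow> z
    | y # ys \<Rightarrow> (f y (fst z) (snd (snd z)), ys, snd (snd z))"
  have f: "polytime (\<lambda>z. f (e z) (a z) (x z))" if "polytime e" "polytime a" "polytime x" for e a and x :: "'q::code \<Rightarrow> 'x"
    using polytime_comp[OF step polytime_pair[OF that(1) polytime_pair[OF that(2,3)]]] by simp
  have iter: "(?body ^^ i) (init x, l x, x) = (fold (\<lambda>e a. f e a x) (take i (l x)) (init x), drop i (l x), x)"
    if "i \<le> length (l x)" for i x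
    using that
  proof (induction i)
    case (Suc i)
    then have "take (Suc i) (l x) = take i (l x) @ [l x ! i]" "drop i (l x) = l x ! i # drop (Suc i) (l x)"
      by (simp_all add: take_Suc_conv_app_nth Cons_nth_drop_Suc)
    with Suc show ?case by simp
  qed simp
  have "polytime (\<lambda>x. (?body ^^ length (l x)) (init x, l x, x))"
  proof (rule polytime_while)
    show "polytime ?test" "polytime ?body" by (intro polytime_basic f)+
    show "polytime (\<lambda>x. (init x, l x, x))" by (intro polytime_basic l init)
    show "polybounded (\<lambda>x. length (l x))" by (rule polybounded_mono[OF polytime_PB_sz[OF l] length_le_sz])
    show "polybounded (\<lambda>x. 2 + B x + sz (l x) + sz x)" by (intro polybounded_intros B l)
    show "sz ((?body ^^ i) (init x, l x, x)) \<le> 2 + B x + sz (l x) + sz x" if "i \<le> length (l x)" for i x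
    proof -
      have "sz (drop i (l x)) \<le> sz (l x)" for i
      proof (induction i)
        case (Suc i)
        then show ?case
          by (cases "drop i (l x)") (auto simp: drop_Suc tl_drop[symmetric] simp del: tl_drop)
      qed simp
      moreover have "sz (fold (\<lambda>e a. f e a x) (take i (l x)) (init x)) \<le> B x"
        by (rule size[of x _ "drop i (l x)"]) simp
      ultimately show ?thesis using that by (simp add: iter add_mono)
    qed
    show "?test ((?body ^^ i) (init x, l x, x))" if "i < length (l x)" for i x
      using that by (simp add: iter)
    show "\<not> ?test ((?body ^^ length (l x)) (init x, l x, x))" for x
      by (simp add: iter)
  qed
  from polytime_fst[OF this] show ?thesis by (simp add: iter)
qed

text \<open>In the list rules below the accumulator is a part of the input, a sublist or a number bounded
  by a length, which provides the size bound.\<close>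

lemma polytime_rev: assumes "polytime l" shows "polytime (\<lambda>x. rev (l x))"
proof -
  have "polytime (\<lambda>x. fold (\<lambda>e a. e # a) (l x) [])"
  proof (rule polytime_fold)
    show "polybounded (\<lambda>x. sz (l x))" by (intro polybounded_intros assms)
    show "sz (fold (\<lambda>e a. e # a) ys []) \<le> sz (l x)" if "l x = ys @ zs" for x ys zs
      unfolding that fold_Cons_rev by (simp add: sz_list rev_map[symmetric] sum_list_rev)
  qed (intro polytime_basic assms)+
  then show ?thesis by (simp add: fold_Cons_rev)
qed

lemma polytime_append: assumes "polytime k" "polytime l" shows "polytime (\<lambda>x. k x @ l x)"
proof -
  have "polytime (\<lambda>x. fold (\<lambda>e a. e # a) (rev (k x)) (l x))"
  proof (rule polytime_fold)
    show "polybounded (\<lambda>x. sz (k x) + sz (l x))" by (intro polybounded_intros assms)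
    show "sz (fold (\<lambda>e a. e # a) ys (l x)) \<le> sz (k x) + sz (l x)" if "rev (k x) = ys @ zs" for x ys zs
    proof -
      have "k x = rev zs @ rev ys" using that by (metis rev_append rev_rev_ident)
      then show ?thesis by (simp add: fold_Cons_rev sz_list)
    qed
  qed (intro polytime_basic polytime_rev assms)+
  then show ?thesis by (simp add: fold_Cons_rev)
qed

lemma sz_map_le:
  assumes "\<And>y. y \<in> set ys \<Longrightarrow> sz (f y) \<le> b"
  shows "sz (map f ys) \<le> 1 + length ys * (1 + b)"
  using assms
proof (induction ys)
  case (Cons y ys)
  then have "sz (map f ys) \<le> 1 + length ys * (1 + b)" "sz (f y) \<le> b" by auto
  then show ?case by simp
qed simp

lemma polytime_map:
  assumes f: "polytime (\<lambda>z. f (fst z) (snd z))" and l: "polytime l"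
  shows "polytime (\<lambda>x. map (\<lambda>e. f e x) (l x))"
proof -
  obtain C where C: "\<And>z. sz (f (fst z) (snd z)) \<le> C * sz z ^ C"
    using polytime_PB_sz[OF f] unfolding polybounded_def by blast
  have fold_eq: "fold (\<lambda>e a. f e x # a) ys as = rev (map (\<lambda>e. f e x) ys) @ as" for ys x as
    by (induction ys arbitrary: as) auto
  let ?b = "\<lambda>x. C * (1 + sz (l x) + sz x) ^ C"
  have "polytime (\<lambda>x. fold (\<lambda>e a. f e x # a) (l x) [])"
  proof (rule polytime_fold)
    show "polytime (\<lambda>z. f (fst z) (snd (snd z)) # fst (snd z))"
      using polytime_comp[OF f polytime_pair[OF polytime_fst polytime_snd[OF polytime_snd], OF polytime_id polytime_id]] by (intro polytime_basic) auto
    show "polybounded (\<lambda>x. 1 + sz (l x) * (1 + ?b x))" by (intro polybounded_intros l)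
    show "sz (fold (\<lambda>e a. f e x # a) ys []) \<le> 1 + sz (l x) * (1 + ?b x)" if lx: "l x = ys @ zs" for x ys zs
    proof -
      have "sz (f y x) \<le> ?b x" if "y \<in> set ys" for y
      proof -
        have "sz y \<le> sz (l x)" using that lx sz_elem_le[of y "l x"] by auto
        with C[of "(y, x)"] show ?thesis
          by (simp) (erule order_trans, intro mult_left_mono power_mono, auto)
      qed
      from sz_map_le[of ys "\<lambda>y. f y x", OF this]
      have "sz (map (\<lambda>e. f e x) ys) \<le> 1 + length ys * (1 + ?b x)" by simp
      also have "\<dots> \<le> 1 + sz (l x) * (1 + ?b x)"
        using length_le_sz[of "l x"] lx by (intro add_left_mono mult_right_mono) auto
      finally show ?thesis unfolding fold_eq by (simp add: sz_list rev_map[symmetric] sum_list_rev)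
    qed
  qed (intro polytime_basic l)+
  then have "polytime (\<lambda>x. rev (map (\<lambda>e. f e x) (l x)))"
    by (simp add: fold_eq)
  from polytime_rev[OF this] show ?thesis by (simp only: rev_rev_ident)
qed

lemma sz_fold_select_le:
  "sz (fold (\<lambda>e a. if P e a then e # a else a) ys as) \<le> sz ys + sz as"
proof (induction ys arbitrary: as)
  case (Cons y ys)
  show ?case using Cons.IH[of "y # as"] Cons.IH[of as] by auto
qed simp

text \<open>The predicate may inspect the elements selected so far, as the greedy scan in
  \<open>starts\<close> does; the accumulator still consists of list elements and cannot outgrow the
  list.\<close>

lemma polytime_select:
  assumes P: "polytime (\<lambda>z. P (fst z) (fst (snd z)) (snd (snd z)))" and l: "polytime l"
  shows "polytime (\<lambda>x. fold (\<lambda>e a. if P e a x then e # a else a) (l x) [])"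
proof (rule polytime_fold)
  show "polytime (\<lambda>z. if P (fst z) (fst (snd z)) (snd (snd z)) then fst z # fst (snd z) else fst (snd z))"
    by (intro polytime_basic P)
  show "polybounded (\<lambda>x. sz (l x) + 1)" by (intro polybounded_intros l)
  show "sz (fold (\<lambda>e a. if P e a x then e # a else a) ys []) \<le> sz (l x) + 1" if "l x = ys @ zs" for x ys zs
    using sz_fold_select_le[of "\<lambda>e a. P e a x" ys "[]"] by (simp add: that sz_list)
qed (intro polytime_basic l)+

lemma polytime_filter:
  assumes P: "polytime (\<lambda>z. P (fst z) (snd z))" and l: "polytime l"
  shows "polytime (\<lambda>x. filter (\<lambda>e. P e x) (l x))"
proof -
  have eq: "fold (\<lambda>e a. if P e x then e # a else a) ys as = rev (filter (\<lambda>e. P e x) ys) @ as" for ys x as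
    by (induction ys arbitrary: as) auto
  have "polytime (\<lambda>z. P (fst z) (snd (snd z)))"
    using polytime_comp[OF P polytime_pair[OF polytime_fst polytime_snd[OF polytime_snd], OF polytime_id polytime_id]] by simp
  from polytime_rev[OF polytime_select[where P = "\<lambda>e a x. P e x", OF this l]] show ?thesis
    by (simp add: eq)
qed

lemma polytime_find:
  assumes P: "polytime (\<lambda>z. P (fst z) (snd z))" and l: "polytime l"
  shows "polytime (\<lambda>x. find (\<lambda>e. P e x) (l x))"
proof -
  have eq: "find Q ys = (case filter Q ys of [] \<Rightarrow> None | y # _ \<Rightarrow> Some y)" for Q and ys :: "'z list"
    by (induction ys) auto
  show ?thesis unfolding eq
    by (rule polytime_case_list[where f = "\<lambda>_. None" and g = "\<lambda>y _ _. Some y"]) (intro polytime_basic polytime_filter P l)+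
qed

lemma polytime_ex:
  assumes "polytime (\<lambda>z. P (fst z) (snd z))" and "polytime l"
  shows "polytime (\<lambda>x. \<exists>e\<in>set (l x). P e x)"
proof -
  have "polytime (\<lambda>x. filter (\<lambda>e. P e x) (l x) \<noteq> [])"
    by (intro polytime_basic polytime_filter assms)
  then show ?thesis by (simp add: filter_empty_conv)
qed

lemma polytime_all:
  assumes "polytime (\<lambda>z. P (fst z) (snd z))" and "polytime l"
  shows "polytime (\<lambda>x. \<forall>e\<in>set (l x). P e x)"
proof -
  have "polytime (\<lambda>x. \<not> (\<exists>e\<in>set (l x). \<not> P e x))"
    by (intro polytime_basic polytime_ex assms)
  then show ?thesis by simp
qed

lemma polytime_member: "polytime f \<Longrightarrow> polytime l \<Longrightarrow> polytime (\<lambda>x. f x \<in> set (l x))"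
  by (rule polytime_cong[OF polytime_ex[where P = "\<lambda>e x. e = f x"]]) (auto intro: polytime_eq[OF polytime_fst[OF polytime_id] polytime_comp[OF _ polytime_snd0]])

lemma polytime_length:
  assumes l: "polytime l" shows "polytime (\<lambda>x. length (l x))"
proof -
  have eq: "fold (\<lambda>e. Suc) ys k = length ys + k" for ys :: "'b list" and k
    by (induction ys arbitrary: k) auto
  have "polytime (\<lambda>x. fold (\<lambda>e a. Suc a) (l x) 0)"
  proof (rule polytime_fold)
    show "polybounded (\<lambda>x. Suc 0 + sz (l x))" by (intro polybounded_intros l)
    show "sz (fold (\<lambda>e a. Suc a) ys 0) \<le> Suc 0 + sz (l x)" if "l x = ys @ zs" for x ys zs
      using sz_nat_le[of "length ys"] length_le_sz[of "l x"] by (simp add: eq that)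
  qed (intro polytime_basic l)+
  then show ?thesis by (simp add: eq)
qed

text \<open>Numbers are stored in binary, so \<open>[0..<k]\<close> is exponentially long in the
  size of \<open>k\<close>. The upper bound must come as the length of a list.\<close>

lemma polytime_upt_length:
  assumes l: "polytime l" shows "polytime (\<lambda>x. [0..<length (l x)])"
proof -
  have eq: "fold (\<lambda>e a. length a # a) ys [] = rev [0..<length ys]" for ys :: "'b list"
    by (induction ys rule: rev_induct) auto
  have "polytime (\<lambda>x. fold (\<lambda>e a. length a # a) (l x) [])"
  proof (rule polytime_fold)
    show "polybounded (\<lambda>x. 1 + sz (l x) * (1 + (1 + sz (l x))))" by (intro polybounded_intros l)
    fix x ys zs assume lx: "l x = ys @ zs"
    have "sz (map id (rev [0..<length ys])) \<le> 1 + length (rev [0..<length ys]) * (1 + (1 + length ys))"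
      using order_trans[OF sz_nat_le] by (intro sz_map_le) auto
    also have "\<dots> \<le> 1 + sz (l x) * (1 + (1 + sz (l x)))"
      using length_le_sz[of "l x"] lx by (intro add_left_mono mult_mono) auto
    finally show "sz (fold (\<lambda>e a. length a # a) ys []) \<le> 1 + sz (l x) * (1 + (1 + sz (l x)))"
      unfolding eq by simp
  qed (intro polytime_basic polytime_length l)+
  from polytime_rev[OF this] show ?thesis by (simp only: eq rev_rev_ident)
qed

lemma polytime_concat:
  assumes l: "polytime l" shows "polytime (\<lambda>x. concat (l x))"
proof -
  have eq: "fold (\<lambda>e a. a @ e) ys as = as @ concat ys" for ys and as :: "'b list"
    by (induction ys arbitrary: as) auto
  have "sz (concat ys) \<le> sz (ys :: 'b list list)" for ys
    by (induction ys) (auto simp: sz_list)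
  moreover have "sz ys \<le> sz (ys @ zs :: 'b list list)" for ys zs
    by (simp add: sz_list)
  ultimately have sz_le: "sz (concat ys) \<le> sz (ys @ zs :: 'b list list)" for ys zs
    using order_trans by blast
  have "polytime (\<lambda>x. fold (\<lambda>e a. a @ e) (l x) [])"
    by (rule polytime_fold[where B = "\<lambda>x. sz (l x)"]) (intro polytime_basic polytime_append l polybounded_intros | simp add: eq sz_le)+
  then show ?thesis by (simp add: eq)
qed

lemma polytime_product:
  assumes k: "polytime k" and l: "polytime l" shows "polytime (\<lambda>x. List.product (k x) (l x))"
proof -
  have "polytime (\<lambda>x. concat (map (\<lambda>e. map (\<lambda>y. (e, y)) (l x)) (k x)))"
    by (intro polytime_concat polytime_map polytime_basic k polytime_comp[OF l])
  then show ?thesis by (simp add: product_concat_map)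
qed

lemmas polytime_lists = polytime_rev polytime_append polytime_map polytime_filter polytime_find polytime_ex polytime_all polytime_member polytime_length
  polytime_upt_length polytime_concat polytime_product

section \<open>From intervals to a laminar family\<close>

text \<open>An item is a tuple of left end, right end, level and identifier; it stands for the half-open
  integer interval between its ends.\<close>

type_synonym item = "nat \<times> nat \<times> nat \<times> nat"

abbreviation il :: "item \<Rightarrow> nat" where "il e \<equiv> fst e"
abbreviation ir :: "item \<Rightarrow> nat" where "ir e \<equiv> fst (snd e)"
abbreviation ilev :: "item \<Rightarrow> nat" where "ilev e \<equiv> fst (snd (snd e))"
abbreviation iid :: "item \<Rightarrow> nat" where "iid e \<equiv> snd (snd (snd e))"

definition contains :: "nat \<Rightarrow> nat \<Rightarrow> item \<Rightarrow> bool" where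
  "contains k x e \<longleftrightarrow> ilev e = k \<and> il e \<le> x \<and> x < ir e"

text \<open>\<open>find\<close> breaks ties by list order, so a point determines a single item and a
  piece can be named by it.\<close>

definition best :: "item list \<Rightarrow> nat \<Rightarrow> nat \<Rightarrow> item option" where
  "best xs k x = find (\<lambda>e. contains k x e \<and> (\<forall>e'\<in>set xs. contains k x e' \<longrightarrow> ir e' \<le> ir e)) xs"

text \<open>With the default \<open>x\<close>, the test \<open>x < reach xs k x\<close> expresses
  that some item of level \<open>k\<close> contains \<open>x\<close>.\<close>

definition reach :: "item list \<Rightarrow> nat \<Rightarrow> nat \<Rightarrow> nat" where
  "reach xs k x = (case best xs k x of None \<Rightarrow> x | Some e \<Rightarrow> ir e)"

definition starts :: "item list \<Rightarrow> nat list \<Rightarrow> nat \<Rightarrow> nat list" where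
  "starts xs pts k = fold (\<lambda>x acc. if x < reach xs k x \<and> (\<forall>s\<in>set acc. reach xs k s \<le> x)
     then x # acc else acc) pts []"

definition push :: "item list \<Rightarrow> nat list \<Rightarrow> nat \<Rightarrow> nat \<Rightarrow> nat" where
  "push xs pts k p = (case find (\<lambda>s. s < p \<and> p < reach xs k s) (starts xs pts k) of
     None \<Rightarrow> p | Some s \<Rightarrow> reach xs k s)"

text \<open>Both bounds are exclusive: the boundary of an item of level \<open>i\<close> is
  unaffected by level \<open>i\<close>, and \<open>j\<close> is the first level not yet applied.
  Taking \<open>j = length lv\<close> applies all higher levels.\<close>

definition pushes :: "item list \<Rightarrow> nat list \<Rightarrow> nat list \<Rightarrow> nat \<Rightarrow> nat \<Rightarrow> nat \<Rightarrow> nat" where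
  "pushes xs pts lv i j p = fold (\<lambda>k p. if i < k \<and> k < j then push xs pts k p else p) lv p"

definition start_of :: "item list \<Rightarrow> nat list \<Rightarrow> item \<Rightarrow> nat option" where
  "start_of xs pts e = find (\<lambda>s. best xs (ilev e) s = Some e) (starts xs pts (ilev e))"

text \<open>Items that the scan does not select receive the empty region
  \<open>(0, 0)\<close>.\<close>

definition region :: "item list \<Rightarrow> nat list \<Rightarrow> nat list \<Rightarrow> item \<Rightarrow> nat \<times> nat" where
  "region xs pts lv e = (case start_of xs pts e of None \<Rightarrow> (0, 0) | Some s \<Rightarrow>
     (pushes xs pts lv (ilev e) (length lv) s, pushes xs pts lv (ilev e) (length lv) (ir e)))"

text \<open>The right boundary of \<open>e\<close>, on arriving at the level of \<open>e'\<close>,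
  lies strictly inside the piece of \<open>e'\<close>: this piece is what carries the boundary
  further.\<close>

definition crosses :: "item list \<Rightarrow> nat list \<Rightarrow> nat list \<Rightarrow> item \<Rightarrow> item \<Rightarrow> bool" where
  "crosses xs pts lv e e' \<longleftrightarrow> ilev e < ilev e' \<and> (case start_of xs pts e' of None \<Rightarrow> False | Some s \<Rightarrow>
     s < pushes xs pts lv (ilev e) (ilev e') (ir e) \<and> pushes xs pts lv (ilev e) (ilev e') (ir e) < ir e')"

lemma find_SomeD: "find P xs = Some y \<Longrightarrow> y \<in> set xs \<and> P y"
  by (induction xs) (auto split: if_splits)

lemma fold_if_filter: "fold (\<lambda>k p. if P k then f k p else p) ks = fold f (filter P ks)"
  by (induction ks) auto

lemma filter_between_upt: "filter (\<lambda>k. i < k \<and> k < j) [0..<n] = [Suc i..<min j n]"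
proof (induction n)
  case (Suc n)
  then show ?case by (cases "i < n"; cases "n < j") (auto simp: min_def le_Suc_eq)
qed simp

declare upt_Suc [simp del]

locale grid =
  fixes xs :: "item list" and m K :: nat
  assumes right_le: "e \<in> set xs \<Longrightarrow> ir e \<le> m"
    and level: "e \<in> set xs \<Longrightarrow> 1 \<le> ilev e \<and> ilev e \<le> K"
begin

abbreviation "B \<equiv> best xs"
abbreviation "\<rho> \<equiv> reach xs"
abbreviation "St k \<equiv> set (starts xs [0..<m] k)"
abbreviation "\<phi> \<equiv> push xs [0..<m]"
abbreviation "Q \<equiv> pushes xs [0..<m] [0..<Suc K]"
abbreviation "f k \<equiv> Q k (Suc K)"
abbreviation "start \<equiv> start_of xs [0..<m]"
abbreviation "reg \<equiv> region xs [0..<m] [0..<Suc K]"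
abbreviation "cross \<equiv> crosses xs [0..<m] [0..<Suc K]"

section \<open>Greedy pieces of a single level\<close>

lemma best_SomeD:
  assumes "B k x = Some e"
  shows "e \<in> set xs" "ilev e = k" "il e \<le> x" "x < ir e"
    "\<And>e'. e' \<in> set xs \<Longrightarrow> contains k x e' \<Longrightarrow> ir e' \<le> ir e"
  using find_SomeD[OF assms[unfolded best_def]] by (auto simp: contains_def)

lemma best_exists:
  assumes "e \<in> set xs" "contains k x e"
  obtains e' where "B k x = Some e'" "ir e \<le> ir e'"
proof -
  let ?A = "{e \<in> set xs. contains k x e}"
  have A: "finite ?A" "e \<in> ?A" using assms by simp_all
  then have "Max (ir ` ?A) \<in> ir ` ?A" by (intro Max_in) blast+
  then obtain a where a: "Max (ir ` ?A) = ir a" "a \<in> ?A" by (rule imageE)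
  then have "contains k x a \<and> (\<forall>e'\<in>set xs. contains k x e' \<longrightarrow> ir e' \<le> ir a)"
    using Max_ge[of "ir ` ?A"] A(1) by auto
  then have "B k x \<noteq> None"
    unfolding best_def find_None_iff using a by blast
  then obtain e' where e': "B k x = Some e'" by blast
  with best_SomeD(5)[OF e' assms] that show ?thesis by blast
qed

lemma reach_le: "x < \<rho> k x \<Longrightarrow> \<rho> k x \<le> m"
  using best_SomeD(1)[of k x] right_le by (auto simp: reach_def split: option.splits)

lemma reach_best: "x < \<rho> k x \<Longrightarrow> \<exists>e. B k x = Some e \<and> ir e = \<rho> k x"
  by (auto simp: reach_def split: option.splits)

lemma best_reach: "B k x = Some e \<Longrightarrow> ir e = \<rho> k x"
  by (auto simp: reach_def)

lemma reach_contains: "e \<in> set xs \<Longrightarrow> contains k x e \<Longrightarrow> ir e \<le> \<rho> k x"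
  by (metis best_exists best_reach)

text \<open>Invariants of the scan, proved together: disjointness and covering both use that the
  starts found so far precede the current point. A covered point that is not taken as a start lies
  in the piece whose end prevented it.\<close>

lemma starts_upt:
  fixes k defines "A \<equiv> \<lambda>n. set (starts xs [0..<n] k)"
  shows "A n \<subseteq> {..<n} \<and> (\<forall>s\<in>A n. s < \<rho> k s) \<and> (\<forall>s\<in>A n. \<forall>s'\<in>A n. s < s' \<longrightarrow> \<rho> k s \<le> s') \<and>
    (\<forall>x<n. x < \<rho> k x \<longrightarrow> (\<exists>s\<in>A n. s \<le> x \<and> x < \<rho> k s))"
proof (induction n)
  case 0
  show ?case by (simp add: A_def starts_def)
next
  case (Suc n)
  have A: "A (Suc n) = (if n < \<rho> k n \<and> (\<forall>s\<in>A n. \<rho> k s \<le> n) then insert n (A n) else A n)"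
    by (simp add: A_def starts_def upt_Suc)
  show ?case
  proof (cases "n < \<rho> k n \<and> (\<forall>s\<in>A n. \<rho> k s \<le> n)")
    case True
    then have "A (Suc n) = insert n (A n)" using A by simp
    with Suc True show ?thesis by (auto simp: less_Suc_eq)
  next
    case False
    then have "A (Suc n) = A n" using A by (simp only: if_False)
    with Suc False show ?thesis
      by (auto simp: less_Suc_eq not_le subset_iff) (meson less_imp_le)
  qed
qed

lemma start_less: "s \<in> St k \<Longrightarrow> s < \<rho> k s"
  using starts_upt[of m k] by blast

lemma starts_disjoint: "s \<in> St k \<Longrightarrow> s' \<in> St k \<Longrightarrow> s < s' \<Longrightarrow> \<rho> k s \<le> s'"
  using starts_upt[of m k] by blast

lemma starts_cover:
  assumes "e \<in> set xs" "contains k x e"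
  obtains s where "s \<in> St k" "s \<le> x" "x < \<rho> k s"
proof -
  have "x < \<rho> k x" using reach_contains[OF assms] assms(2) by (auto simp: contains_def)
  then have "x < m" using reach_le by fastforce
  with \<open>x < \<rho> k x\<close> show ?thesis using starts_upt[of m k] that by blast
qed

lemma starts_unique:
  "s \<in> St k \<Longrightarrow> s' \<in> St k \<Longrightarrow> s \<le> x \<Longrightarrow> x < \<rho> k s \<Longrightarrow> s' \<le> x \<Longrightarrow> x < \<rho> k s' \<Longrightarrow> s = s'"
  using starts_disjoint[of s k s'] starts_disjoint[of s' k s] by (cases s s' rule: linorder_cases) auto

section \<open>Pushing boundaries through higher levels\<close>

lemma push_inside: "s \<in> St k \<Longrightarrow> s < p \<Longrightarrow> p < \<rho> k s \<Longrightarrow> \<phi> k p = \<rho> k s"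
proof -
  assume s: "s \<in> St k" "s < p" "p < \<rho> k s"
  then have "find (\<lambda>s. s < p \<and> p < \<rho> k s) (starts xs [0..<m] k) \<noteq> None"
    unfolding find_None_iff by blast
  then obtain s' where s': "find (\<lambda>s. s < p \<and> p < \<rho> k s) (starts xs [0..<m] k) = Some s'" by blast
  with find_SomeD[OF s'] s have "s' = s" using starts_unique[of s' k s p] by simp
  with s' show ?thesis by (simp add: push_def)
qed

lemma push_outside: "\<not> (\<exists>s\<in>St k. s < p \<and> p < \<rho> k s) \<Longrightarrow> \<phi> k p = p"
  using find_None_iff[of "\<lambda>s. s < p \<and> p < \<rho> k s" "starts xs [0..<m] k"] by (auto simp: push_def)

lemma push_ge: "p \<le> \<phi> k p"
  by (cases "\<exists>s\<in>St k. s < p \<and> p < \<rho> k s") (auto simp: push_inside push_outside)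

lemma push_mono: assumes "p \<le> q" shows "\<phi> k p \<le> \<phi> k q"
proof (cases "\<exists>s\<in>St k. s < p \<and> p < \<rho> k s")
  case True
  then obtain s where s: "s \<in> St k" "s < p" "p < \<rho> k s" by blast
  show ?thesis
  proof (cases "q < \<rho> k s")
    case True
    with s assms show ?thesis by (simp add: push_inside[of s])
  next
    case False
    with s push_ge[of q k] show ?thesis by (simp add: push_inside[of s])
  qed
next
  case False
  with assms push_ge[of q k] show ?thesis by (simp add: push_outside)
qed

text \<open>A boundary that moves lands on the end of a piece, and disjointness keeps this end out
  of the interior of every other piece of the level. This is the source of laminarity.\<close>

lemma push_not_inside: "s \<in> St k \<Longrightarrow> \<phi> k p \<le> s \<or> \<rho> k s \<le> \<phi> k p"
proof (cases "\<exists>s\<in>St k. s < p \<and> p < \<rho> k s")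
  case True
  assume s: "s \<in> St k"
  obtain t where t: "t \<in> St k" "t < p" "p < \<rho> k t" using True by blast
  with s show ?thesis using starts_disjoint[of t k s] starts_disjoint[of s k t] start_less[of s k]
    by (cases s t rule: linorder_cases) (auto simp: push_inside[OF t])
next
  case False
  assume s: "s \<in> St k"
  with False show ?thesis by (auto simp: push_outside not_less)
qed

lemma pushes_fold: "j \<le> Suc K \<Longrightarrow> Q i j p = fold \<phi> [Suc i..<j] p"
  unfolding pushes_def fold_if_filter filter_between_upt by (simp add: min_absorb1)

lemma pushes_Suc: "i < j \<Longrightarrow> j \<le> K \<Longrightarrow> Q i (Suc j) p = \<phi> j (Q i j p)"
  using pushes_fold[of "Suc j" i p] pushes_fold[of j i p] upt_Suc_append[of "Suc i" j] by simp

lemma pushes_Nil: "j \<le> Suc i \<Longrightarrow> j \<le> Suc K \<Longrightarrow> Q i j p = p"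
  by (simp add: pushes_fold)

lemma pushes_split: "i < k \<Longrightarrow> k \<le> K \<Longrightarrow> f i p = f k (Q i (Suc k) p)"
proof -
  assume "i < k" "k \<le> K"
  then have "[Suc i..<Suc K] = [Suc i..<Suc k] @ [Suc k..<Suc K]"
    using upt_add_eq_append[of "Suc i" "Suc k" "K - k"] by simp
  with \<open>k \<le> K\<close> show ?thesis by (simp add: pushes_fold)
qed

lemma fold_push_ge: "p \<le> fold \<phi> ks p"
  by (induction ks arbitrary: p) (auto intro: order_trans push_ge)

lemma fold_push_mono: "p \<le> q \<Longrightarrow> fold \<phi> ks p \<le> fold \<phi> ks q"
  by (induction ks arbitrary: p q) (auto intro: push_mono)

lemma f_ge: "p \<le> f k p"
  by (simp add: pushes_fold fold_push_ge)

lemma f_mono: "p \<le> q \<Longrightarrow> f k p \<le> f k q"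
  by (simp add: pushes_fold fold_push_mono)

text \<open>A boundary that ends up to the right of a point has been carried over that point by a piece
  of some higher level.\<close>

lemma f_crossing:
  assumes "p \<le> y" "y < f i p"
  obtains j t where "i < j" "j \<le> K" "t \<in> St j" "t < Q i j p" "Q i j p < \<rho> j t" "Q i j p \<le> y"
    "y < \<rho> j t" "f i p = f j (\<rho> j t)"
proof -
  let ?P = "\<lambda>j. i \<le> j \<and> j \<le> K \<and> y < Q i (Suc j) p"
  have "i \<le> K"
    using assms pushes_Nil[of "Suc K" i p] by (cases "i \<le> K") auto
  with assms have "?P K" by simp
  \<comment> \<open>The first level whose push carries the boundary beyond \<open>y\<close>; up to
    that level the boundary is still at or before \<open>y\<close>.\<close>
  define j where "j = (LEAST j. ?P j)"
  have j: "?P j" unfolding j_def by (rule LeastI[of ?P, OF \<open>?P K\<close>])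
  have "i \<noteq> j" using j assms pushes_Nil[of "Suc i" i p] by auto
  then have "i < j" using j by simp
  have "\<not> ?P (j - 1)" using \<open>i < j\<close> not_less_Least[of "j - 1" ?P] by (auto simp: j_def)
  with j \<open>i < j\<close> have le: "Q i j p \<le> y" by (cases j) (auto simp: less_Suc_eq_le)
  have Suc: "Q i (Suc j) p = \<phi> j (Q i j p)" using \<open>i < j\<close> j pushes_Suc by blast
  then have "\<phi> j (Q i j p) \<noteq> Q i j p" using le j by auto
  then obtain t where t: "t \<in> St j" "t < Q i j p" "Q i j p < \<rho> j t" using push_outside by blast
  then have "Q i (Suc j) p = \<rho> j t" by (simp add: Suc push_inside)
  with j t le \<open>i < j\<close> pushes_split[of i j p] that show ?thesis by metis
qed

section \<open>Regions and their nesting\<close>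

lemma start_of_SomeD:
  assumes "start e = Some s"
  shows "s \<in> St (ilev e)" "B (ilev e) s = Some e" "ir e = \<rho> (ilev e) s" "e \<in> set xs" "il e \<le> s" "s < ir e"
  using find_SomeD[OF assms[unfolded start_of_def]] best_SomeD[of "ilev e" s e] best_reach[of "ilev e" s e]
  by auto

text \<open>\<open>start_of\<close> searches for any start with this best item. It finds
  \<open>s\<close> itself because pieces of one level with a common right end coincide.\<close>

lemma start_of_best:
  assumes "s \<in> St k" "B k s = Some e" shows "start e = Some s"
proof -
  have k: "ilev e = k" using best_SomeD assms by blast
  have "find (\<lambda>s. B (ilev e) s = Some e) (starts xs [0..<m] (ilev e)) \<noteq> None"
    unfolding find_None_iff using assms k by blast
  then obtain s' where s': "start e = Some s'" unfolding start_of_def by blast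
  note d = start_of_SomeD[OF s']
  have "\<rho> k s = \<rho> k s'" using d best_reach[OF assms(2)] k by simp
  then have "s = s'" using starts_disjoint[of s k s'] starts_disjoint[of s' k s] start_less[of _ k] assms(1) d(1) k
    by (metis linorder_neqE_nat not_less)
  with s' show ?thesis by simp
qed

lemma region_start:
  "start e = Some s \<Longrightarrow> reg e = (f (ilev e) s, f (ilev e) (\<rho> (ilev e) s))"
  using start_of_SomeD(3)[of e s] by (simp add: region_def)

lemma region_nonempty:
  assumes "fst (reg e) \<le> x" "x < snd (reg e)"
  obtains s where "start e = Some s"
  using assms by (auto simp: region_def split: option.splits)

text \<open>Right after the push at the level of \<open>v\<close>, neither boundary of
  \<open>u\<close> is strictly inside the piece of \<open>v\<close>. The pushes that remain are the
  same ones that \<open>v\<close> undergoes and are monotone, so the final boundaries of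
  \<open>u\<close> are outside the region of \<open>v\<close> as well.\<close>

lemma region_laminar:
  assumes "ilev u < ilev v" "fst (reg u) \<le> x" "x < snd (reg u)" "fst (reg v) \<le> x" "x < snd (reg v)"
  shows "fst (reg u) \<le> fst (reg v) \<and> snd (reg v) \<le> snd (reg u)"
proof -
  obtain s where s: "start u = Some s" using region_nonempty assms by blast
  obtain t where t: "start v = Some t" using region_nonempty assms by blast
  let ?k = "ilev v"
  have k: "ilev u < ?k" "?k \<le> K" using assms start_of_SomeD(4)[OF t] level by auto
  have "f (ilev u) p \<le> f ?k t \<or> f ?k (\<rho> ?k t) \<le> f (ilev u) p" for p
    using push_not_inside[OF start_of_SomeD(1)[OF t], of "Q (ilev u) ?k p"] f_mono
    unfolding pushes_split[OF k] pushes_Suc[OF k] by blast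
  from this[of s] this[of "\<rho> (ilev u) s"] show ?thesis
    using assms by (auto simp: region_start[OF s] region_start[OF t])
qed

lemma region_same_level:
  assumes "ilev u = ilev v" "fst (reg u) \<le> x" "x < snd (reg u)" "fst (reg v) \<le> x" "x < snd (reg v)"
  shows "u = v"
proof -
  obtain s where s: "start u = Some s" using region_nonempty assms by blast
  obtain t where t: "start v = Some t" using region_nonempty assms by blast
  have st: "s \<in> St (ilev u)" "t \<in> St (ilev u)"
    using start_of_SomeD(1)[OF s] start_of_SomeD(1)[OF t] assms(1) by simp_all
  have reg: "f (ilev u) s \<le> x" "x < f (ilev u) (\<rho> (ilev u) s)" "f (ilev u) t \<le> x" "x < f (ilev u) (\<rho> (ilev u) t)"
    using assms by (simp_all add: region_start[OF s] region_start[OF t])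
  have "\<not> s < t"
    using f_mono[OF starts_disjoint[OF st], of "ilev u"] reg by linarith
  moreover have "\<not> t < s"
    using f_mono[OF starts_disjoint[OF st(2,1)], of "ilev u"] reg by linarith
  ultimately have "s = t" by simp
  with start_of_SomeD(2)[OF s] start_of_SomeD(2)[OF t] assms(1) show ?thesis
    by (metis option.inject)
qed

section \<open>Charging intervals to regions and regions to intervals\<close>

definition touching :: "item \<Rightarrow> nat set" where
  "touching e = {s \<in> St (ilev e). s < ir e \<and> il e < \<rho> (ilev e) s}"

text \<open>Membership of \<open>s\<close> is tested in the original pieces, of which at most one
  per level contains \<open>s\<close>. Only the covering argument looks at the pushed
  regions.\<close>

definition assigned :: "item \<Rightarrow> item set" where
  "assigned e = {v \<in> set xs. ilev e \<le> ilev v \<and>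
     (\<exists>s\<in>touching e. \<exists>t. start v = Some t \<and> t \<le> s \<and> s < \<rho> (ilev v) t)}"

text \<open>Suppose three pieces meet \<open>e\<close>. The second starts inside \<open>e\<close>,
  so its greedy choice reaches at least the right end of \<open>e\<close> and leaves nothing for the
  third.\<close>

lemma card_touching: assumes e: "e \<in> set xs" shows "finite (touching e)" "card (touching e) \<le> 2"
proof -
  show fin: "finite (touching e)" by (simp add: touching_def)
  show "card (touching e) \<le> 2"
  proof (cases "touching e = {}")
    case False
    define a where "a = Min (touching e)"
    have a: "a \<in> touching e" "\<And>s. s \<in> touching e \<Longrightarrow> a \<le> s"
      using fin False by (simp_all add: a_def)
    have no: False if s: "s \<in> touching e" "a < s" and s': "s' \<in> touching e" "s < s'" for s s'
    proof -
      have "contains (ilev e) s e"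
        using starts_disjoint[of a "ilev e" s] s a by (auto simp: touching_def contains_def)
      then have "ir e \<le> \<rho> (ilev e) s" by (rule reach_contains[OF e])
      with s s' starts_disjoint[of s "ilev e" s'] show False by (auto simp: touching_def)
    qed
    let ?R = "touching e - {a}"
    have "s = s'" if "s \<in> ?R" "s' \<in> ?R" for s s'
      using that a(2)[of s] a(2)[of s'] no[of s s'] no[of s' s] by (cases s s' rule: linorder_cases) auto
    then have "card ?R \<le> Suc 0"
      using fin by (subst card_le_Suc0_iff_eq) auto
    then show ?thesis using fin a(1) by (simp add: card_Diff_singleton)
  qed simp
qed

lemma card_assigned:
  assumes e: "e \<in> set xs"
  shows "card {v \<in> assigned e. ilev v = j} \<le> 2"
proof -
  let ?P = "\<lambda>s v. ilev v = j \<and> (\<exists>t. start v = Some t \<and> t \<le> s \<and> s < \<rho> (ilev v) t)"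
  have unique: "u = v" if uv: "?P s u" "?P s v" for s u v
  proof -
    obtain t where t: "ilev u = j" "start u = Some t" "t \<le> s" "s < \<rho> j t" using uv(1) by metis
    obtain t' where t': "ilev v = j" "start v = Some t'" "t' \<le> s" "s < \<rho> j t'" using uv(2) by metis
    have "t = t'"
      using starts_unique[of t j t' s] start_of_SomeD(1)[OF t(2)] start_of_SomeD(1)[OF t'(2)] t t' by simp
    with start_of_SomeD(2)[OF t(2)] start_of_SomeD(2)[OF t'(2)] t t' show ?thesis by simp
  qed
  have "{v \<in> assigned e. ilev v = j} \<subseteq> (\<lambda>s. THE v. ?P s v) ` touching e"
  proof
    fix v assume v: "v \<in> {v \<in> assigned e. ilev v = j}"
    then obtain s where s: "s \<in> touching e" "?P s v" by (auto simp: assigned_def)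
    then have "(THE v. ?P s v) = v" by (intro the_equality) (auto intro: unique)
    with s show "v \<in> (\<lambda>s. THE v. ?P s v) ` touching e" by force
  qed
  from surj_card_le[OF card_touching(1)[OF e] this] card_touching(2)[OF e] show ?thesis by simp
qed

lemma assigned_level: "v \<in> assigned e \<Longrightarrow> ilev e \<le> ilev v"
  by (simp add: assigned_def)

lemma assigned_cover:
  assumes e: "e \<in> set xs" and x: "il e \<le> x" "x < ir e"
  obtains v where "v \<in> assigned e" "fst (reg v) \<le> x" "x < snd (reg v)"
proof -
  let ?i = "ilev e"
  obtain s where s: "s \<in> St ?i" "s \<le> x" "x < \<rho> ?i s"
    using starts_cover[OF e, of ?i x] x by (auto simp: contains_def)
  then have touch: "s \<in> touching e" using x by (auto simp: touching_def)
  \<comment> \<open>Candidate levels: those with a piece around \<open>s\<close> whose pushed right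
    end is beyond \<open>x\<close>. In the greatest such level the pushed left end turns out to be
    at or before \<open>x\<close>.\<close>
  let ?G = "\<lambda>k. ?i \<le> k \<and> k \<le> K \<and> (\<exists>t\<in>St k. t \<le> s \<and> s < \<rho> k t \<and> x < f k (\<rho> k t))"
  have "?G ?i"
    using s level[OF e] f_ge[of "\<rho> ?i s" ?i] start_less[OF s(1)] by (auto intro!: bexI[of _ s])
  define k where "k = (GREATEST k. ?G k)"
  have k: "?G k"
    unfolding k_def by (rule GreatestI_nat[of ?G ?i K]) (use \<open>?G ?i\<close> in auto)
  have max: "l \<le> k" if "?G l" for l
    unfolding k_def by (rule Greatest_le_nat[of ?G l K]) (use that in auto)
  obtain t where t: "t \<in> St k" "t \<le> s" "s < \<rho> k t" "x < f k (\<rho> k t)" using k by blast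
  obtain v where v: "B k t = Some v" using reach_best[OF start_less[OF t(1)]] by blast
  note sv = start_of_best[OF t(1) v]
  have kv: "ilev v = k" using best_SomeD(2)[OF v] .
  have "f k t \<le> x"
  proof (rule ccontr)
    assume "\<not> f k t \<le> x"
    \<comment> \<open>A left boundary pushed beyond \<open>s\<close> was carried over
      \<open>s\<close> by a piece of a higher level \<open>j\<close>. That piece contains
      \<open>s\<close>, and its pushed right end equals \<open>f k t\<close>, hence exceeds
      \<open>x\<close>: a contradiction to the choice of \<open>k\<close>.\<close>
    then have "s < f k t" using s by simp
    from f_crossing[OF t(2) this] obtain j u where j: "k < j" "j \<le> K" "u \<in> St j" "u < Q k j t"
      "Q k j t \<le> s" "s < \<rho> j u" "f k t = f j (\<rho> j u)" by metis
    with k \<open>\<not> f k t \<le> x\<close> have "?G j" by (auto intro!: bexI[of _ u])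
    with max j show False by fastforce
  qed
  with t sv kv that[of v] touch k best_SomeD(1)[OF v] show ?thesis
    by (auto simp: assigned_def region_start[OF sv])
qed

text \<open>Left boundaries only move to the right, so the region exceeds the piece of
  \<open>e\<close> only beyond \<open>ir e\<close>. Such an excess point was passed by the right
  boundary, and the piece responsible belongs to an item that crosses \<open>e\<close>.\<close>

lemma region_cover:
  assumes "fst (reg e) \<le> x" "x < snd (reg e)"
  shows "\<exists>v\<in>set xs. (v = e \<or> cross e v) \<and> il v \<le> x \<and> x < ir v"
proof -
  obtain s where s: "start e = Some s" using region_nonempty assms by blast
  note d = start_of_SomeD[OF s]
  have "s \<le> x" using assms f_ge[of s "ilev e"] by (simp add: region_start[OF s])
  show ?thesis
  proof (cases "x < ir e")
    case True
    with d \<open>s \<le> x\<close> show ?thesis by auto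
  next
    case False
    have "x < f (ilev e) (ir e)" using assms d(3) by (simp add: region_start[OF s])
    with False obtain j t where j: "ilev e < j" "t \<in> St j" "t < Q (ilev e) j (ir e)"
        "Q (ilev e) j (ir e) < \<rho> j t" "Q (ilev e) j (ir e) \<le> x" "x < \<rho> j t"
      by (metis f_crossing not_less)
    obtain v where v: "B j t = Some v" using reach_best[OF start_less[OF j(2)]] by blast
    note sv = start_of_best[OF j(2) v]
    from j best_SomeD[OF v] best_reach[OF v] show ?thesis
      by (intro bexI[of _ v]) (auto simp: crosses_def sv)
  qed
qed

lemma cross_unique:
  assumes "cross e u" "cross e v" "ilev u = ilev v" shows "u = v"
proof -
  obtain s where s: "start u = Some s" "s < Q (ilev e) (ilev u) (ir e)" "Q (ilev e) (ilev u) (ir e) < ir u"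
    using assms(1) by (auto simp: crosses_def split: option.splits)
  obtain t where t: "start v = Some t" "t < Q (ilev e) (ilev v) (ir e)" "Q (ilev e) (ilev v) (ir e) < ir v"
    using assms(2) by (auto simp: crosses_def split: option.splits)
  have "s = t"
    using starts_unique[of s "ilev u" t "Q (ilev e) (ilev u) (ir e)"] s t assms(3)
      start_of_SomeD(1,3)[OF s(1)] start_of_SomeD(1,3)[OF t(1)] by simp
  with start_of_SomeD(2)[OF s(1)] start_of_SomeD(2)[OF t(1)] assms(3) show ?thesis
    by (metis option.inject)
qed

lemma cross_level: "cross e v \<Longrightarrow> ilev e < ilev v"
  by (simp add: crosses_def)

end

section \<open>From a laminar family to a tree cover instance\<close>

type_synonym node = "nat \<times> nat \<times> nat \<times> nat"

abbreviation nid :: "node \<Rightarrow> nat" where "nid v \<equiv> fst v"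
abbreviation nlev :: "node \<Rightarrow> nat" where "nlev v \<equiv> fst (snd v)"
abbreviation na :: "node \<Rightarrow> nat" where "na v \<equiv> fst (snd (snd v))"
abbreviation nb :: "node \<Rightarrow> nat" where "nb v \<equiv> snd (snd (snd v))"

definition inside :: "nat \<Rightarrow> node \<Rightarrow> bool" where
  "inside x v \<longleftrightarrow> na v \<le> x \<and> x < nb v"

text \<open>The strict comparison of levels orders regions of different levels that happen to be
  equal.\<close>

definition anc :: "node \<Rightarrow> node \<Rightarrow> bool" where
  "anc u v \<longleftrightarrow> nlev u < nlev v \<and> na u \<le> na v \<and> nb v \<le> nb u"

definition refined :: "node list \<Rightarrow> nat list \<Rightarrow> node \<Rightarrow> bool" where
  "refined ns pts w \<longleftrightarrow> (\<forall>x\<in>set pts. inside x w \<longrightarrow> (\<exists>v\<in>set ns. anc w v \<and> inside x v))"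

text \<open>A region that its proper descendants do not cover must be covered by itself or an ancestor;
  the descendants of such a region are useless, and dropping them makes it a leaf.\<close>

definition goods :: "node list \<Rightarrow> nat list \<Rightarrow> node list" where
  "goods ns pts = filter (\<lambda>v. na v < nb v \<and> (\<forall>w\<in>set ns. anc w v \<longrightarrow> refined ns pts w)) ns"

text \<open>The identifiers below the root \<open>r\<close> that belong to no node of \<open>gs\<close> become
  leaves attached to the root; they only pad the instance to a prescribed size.\<close>

definition tree_edge :: "node list \<Rightarrow> nat \<Rightarrow> nat \<Rightarrow> nat \<Rightarrow> bool" where
  "tree_edge gs r u v \<longleftrightarrow>
     (\<exists>b\<in>set gs. nid b = v \<and> (u = r \<and> (\<forall>a\<in>set gs. \<not> anc a b) \<or>
        (\<exists>a\<in>set gs. nid a = u \<and> anc a b \<and> (\<forall>c\<in>set gs. \<not> (anc a c \<and> anc c b))))) \<or>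
     u = r \<and> v < r \<and> (\<forall>b\<in>set gs. nid b \<noteq> v)"

definition in_group :: "node list \<Rightarrow> nat \<Rightarrow> nat \<Rightarrow> nat \<Rightarrow> bool" where
  "in_group gs K k v \<longleftrightarrow>
     (\<exists>b\<in>set gs. nid b = v \<and> nlev b = k) \<or> k = K \<and> (\<forall>b\<in>set gs. nid b \<noteq> v)"

definition node_tree :: "node list \<Rightarrow> nat \<Rightarrow> nat \<Rightarrow> treecov" where
  "node_tree gs r K = \<lparr>verts = {..<Suc r}, edges = {(u, v). tree_edge gs r u v}, root = r,
     tree_group = (\<lambda>k. {v. v < r \<and> in_group gs K k v})\<rparr>"

lemma obtain_greatest:
  fixes f :: "'a \<Rightarrow> nat"
  assumes "P k" "\<forall>y. P y \<longrightarrow> f y \<le> b"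
  obtains x where "P x" "\<And>y. P y \<Longrightarrow> f y \<le> f x"
proof -
  have "\<exists>x. P x \<and> (\<forall>y. P y \<longrightarrow> f y \<le> f x)"
    using ex_has_greatest_nat[of P k f "Suc b"] assms by (simp add: less_Suc_eq_le)
  then show ?thesis using that by (elim exE conjE) simp
qed

lemma obtain_least:
  fixes f :: "'a \<Rightarrow> nat"
  assumes "P k"
  obtains x where "P x" "\<And>y. P y \<Longrightarrow> f x \<le> f y"
proof -
  have "\<exists>x. P x \<and> (\<forall>y. P y \<longrightarrow> f x \<le> f y)"
    using ex_has_least_nat[of P k f] assms by simp
  then show ?thesis using that by (elim exE conjE) simp
qed

locale laminar =
  fixes ns :: "node list" and m K r :: nat
  assumes nested: "u \<in> set ns \<Longrightarrow> v \<in> set ns \<Longrightarrow> nlev u < nlev v \<Longrightarrow> inside x u \<Longrightarrow> inside x v \<Longrightarrow> anc u v"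
    and same_level: "u \<in> set ns \<Longrightarrow> v \<in> set ns \<Longrightarrow> nlev u = nlev v \<Longrightarrow> inside x u \<Longrightarrow> inside x v \<Longrightarrow> u = v"
    and inside_less: "v \<in> set ns \<Longrightarrow> inside x v \<Longrightarrow> x < m"
    and level: "v \<in> set ns \<Longrightarrow> 1 \<le> nlev v \<and> nlev v \<le> K"
    and ids: "inj_on nid (set ns)" "v \<in> set ns \<Longrightarrow> nid v < r"
    and r: "0 < r" "num_groups {..<r} = K" "0 < K"
begin

abbreviation "gs \<equiv> goods ns [0..<m]"
abbreviation "G \<equiv> node_tree gs r K"
abbreviation "E \<equiv> edges G"

section \<open>The good nodes and the padding leaves form a rooted tree\<close>

lemma good_iff:
  "v \<in> set gs \<longleftrightarrow> v \<in> set ns \<and> na v < nb v \<and> (\<forall>w\<in>set ns. anc w v \<longrightarrow> refined ns [0..<m] w)"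
  by (simp add: goods_def)

lemma goodD: "v \<in> set gs \<Longrightarrow> v \<in> set ns" "v \<in> set gs \<Longrightarrow> inside (na v) v"
  by (auto simp: good_iff inside_def)

lemma nid_inject: "u \<in> set gs \<Longrightarrow> v \<in> set gs \<Longrightarrow> nid u = nid v \<Longrightarrow> u = v"
  using ids(1) goodD(1) by (meson inj_onD)

lemma anc_trans: "anc u v \<Longrightarrow> anc v w \<Longrightarrow> anc u w"
  by (auto simp: anc_def)

lemma anc_inside: "anc u v \<Longrightarrow> inside x v \<Longrightarrow> inside x u"
  by (auto simp: anc_def inside_def)

lemma anc_level: "anc u v \<Longrightarrow> nlev u < nlev v"
  by (auto simp: anc_def)

lemma edge_iff: "(u, v) \<in> E \<longleftrightarrow> tree_edge gs r u v"
  by (simp add: node_tree_def)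

lemma tree_ground_eq: "tree_ground G = {..<r}"
  by (auto simp: tree_ground_def node_tree_def)

lemma edge_good:
  assumes "a \<in> set gs" "(nid a, v) \<in> E"
  obtains b where "b \<in> set gs" "nid b = v" "anc a b"
  using assms ids(2)[OF goodD(1)] nid_inject unfolding edge_iff tree_edge_def
  by (metis less_irrefl)

lemma nid_less: "v \<in> set gs \<Longrightarrow> nid v < r"
  using ids(2) goodD(1) by blast

lemma no_edge_to_root: "(u, r) \<notin> E"
  unfolding edge_iff tree_edge_def using nid_less by (metis less_irrefl)

lemma no_edge_from_pad:
  assumes "u < r" "\<forall>b\<in>set gs. nid b \<noteq> u" shows "(u, v) \<notin> E"
  using assms by (auto simp: edge_iff tree_edge_def)

lemma path_good:
  assumes "a \<in> set gs" "(nid a, v) \<in> E\<^sup>*"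
  obtains b where "b \<in> set gs" "nid b = v" "b = a \<or> anc a b"
  using assms(2)
proof (induction arbitrary: thesis rule: rtrancl_induct)
  case base
  then show ?case using assms by blast
next
  case (step y z)
  then obtain b where b: "b \<in> set gs" "nid b = y" "b = a \<or> anc a b" by blast
  with step edge_good[of b z] anc_trans show ?case by metis
qed

lemma path_pad:
  assumes "u < r" "\<forall>b\<in>set gs. nid b \<noteq> u" "(u, v) \<in> E\<^sup>*" shows "v = u"
  using assms(3) no_edge_from_pad[OF assms(1,2)] by (metis converse_rtranclE)

lemma anc_path: "a \<in> set gs \<Longrightarrow> b \<in> set gs \<Longrightarrow> anc a b \<Longrightarrow> (nid a, nid b) \<in> E\<^sup>*"
proof (induction "nlev b" arbitrary: b rule: less_induct)
  case less
  \<comment> \<open>The deepest ancestor of \<open>b\<close> at or below \<open>a\<close> is the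
    parent of \<open>b\<close>.\<close>
  let ?P = "\<lambda>c. c \<in> set gs \<and> (c = a \<or> anc a c) \<and> anc c b"
  have "?P a" using less by simp
  moreover have "\<forall>c. ?P c \<longrightarrow> nlev c \<le> nlev b" using anc_level less_imp_le by blast
  ultimately obtain c where c: "?P c" "\<And>d. ?P d \<Longrightarrow> nlev d \<le> nlev c"
    by (rule obtain_greatest[of ?P a nlev "nlev b"]) (rule that)
  have "\<not> (anc c d \<and> anc d b)" if d: "d \<in> set gs" for d
    using c(1) c(2)[of d] anc_trans[of a c d] anc_level[of c d] d by auto
  then have "(nid c, nid b) \<in> E"
    using c(1) less.prems unfolding edge_iff tree_edge_def by blast
  moreover have "(nid a, nid c) \<in> E\<^sup>*"
    using less.hyps[of c] c(1) less.prems anc_level[of c b] by auto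
  ultimately show ?case by (rule rtrancl_into_rtrancl[rotated])
qed

lemma root_path: assumes "v \<le> r" shows "(r, v) \<in> E\<^sup>*"
proof (cases "v = r")
  case False
  show ?thesis
  proof (cases "\<exists>b\<in>set gs. nid b = v")
    case True
    then obtain b where b: "b \<in> set gs" "nid b = v" by blast
    \<comment> \<open>The topmost good ancestor of \<open>b\<close> has no good ancestor and is
      therefore attached to the root.\<close>
    let ?P = "\<lambda>a. a \<in> set gs \<and> (a = b \<or> anc a b)"
    have "?P b" using b by simp
    then obtain a where a: "?P a" "\<And>d. ?P d \<Longrightarrow> nlev a \<le> nlev d"
      by (rule obtain_least[of ?P b nlev]) (rule that)
    have "\<forall>d\<in>set gs. \<not> anc d a"
      using a anc_trans[of _ a b] anc_level by (metis leD)
    then have "(r, nid a) \<in> E" using a(1) unfolding edge_iff tree_edge_def by blast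
    moreover have "(nid a, v) \<in> E\<^sup>*" using a(1) anc_path[of a b] b by auto
    ultimately show ?thesis by (rule converse_rtrancl_into_rtrancl)
  next
    case False
    with \<open>v \<noteq> r\<close> assms have "(r, v) \<in> E" by (auto simp: edge_iff tree_edge_def)
    then show ?thesis by blast
  qed
qed simp

text \<open>Ancestors of \<open>b\<close> all contain the point \<open>na b\<close>, so laminarity
  makes any two of them comparable or equal; two immediate ones must be equal.\<close>

lemma parent_unique: assumes "(u, v) \<in> E" "(u', v) \<in> E" shows "u = u'"
proof (cases "\<exists>b\<in>set gs. nid b = v")
  case True
  then obtain b where b: "b \<in> set gs" "nid b = v" by blast
  have *: "w = r \<and> (\<forall>a\<in>set gs. \<not> anc a b) \<or>
        (\<exists>a\<in>set gs. nid a = w \<and> anc a b \<and> (\<forall>c\<in>set gs. \<not> (anc a c \<and> anc c b)))"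
    if "(w, v) \<in> E" for w
    using that b nid_inject unfolding edge_iff tree_edge_def by metis
  have uniq: "a = a'" if a: "a \<in> set gs" "anc a b" "\<forall>c\<in>set gs. \<not> (anc a c \<and> anc c b)"
    and a': "a' \<in> set gs" "anc a' b" "\<forall>c\<in>set gs. \<not> (anc a' c \<and> anc c b)" for a a'
  proof -
    have "inside (na b) a" "inside (na b) a'"
      using a a' goodD(2)[OF b(1)] anc_inside by blast+
    then show ?thesis
      using nested[of a a'] nested[of a' a] same_level[of a a'] a a' goodD(1)
      by (metis linorder_neqE_nat)
  qed
  show ?thesis
    using *[OF assms(1)] *[OF assms(2)]
  proof (elim disjE)
    assume "\<exists>a\<in>set gs. nid a = u \<and> anc a b \<and> (\<forall>c\<in>set gs. \<not> (anc a c \<and> anc c b))"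
      "\<exists>a\<in>set gs. nid a = u' \<and> anc a b \<and> (\<forall>c\<in>set gs. \<not> (anc a c \<and> anc c b))"
    then obtain a a' where "a \<in> set gs" "nid a = u" "anc a b" "\<forall>c\<in>set gs. \<not> (anc a c \<and> anc c b)"
      "a' \<in> set gs" "nid a' = u'" "anc a' b" "\<forall>c\<in>set gs. \<not> (anc a' c \<and> anc c b)" by (elim bexE conjE)
    with uniq[of a a'] show ?thesis by blast
  qed blast+
next
  case False
  with assms show ?thesis by (auto simp: edge_iff tree_edge_def)
qed

lemma is_treecov_node_tree: "is_treecov G"
proof -
  have "E \<subseteq> {..<Suc r} \<times> {..<Suc r}"
    using nid_less by (fastforce simp: edge_iff tree_edge_def)
  then have tree: "rooted_tree (verts G) E (root G)"
    using root_path no_edge_to_root parent_unique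
    by (auto simp: rooted_tree_def node_tree_def less_Suc_eq_le)
  have groups: "(\<Union>i\<in>{1..K}. tree_group G i) = {..<r}"
  proof (intro equalityI subsetI)
    fix v assume "v \<in> {..<r}"
    show "v \<in> (\<Union>i\<in>{1..K}. tree_group G i)"
    proof (cases "\<exists>b\<in>set gs. nid b = v")
      case True
      then obtain b where "b \<in> set gs" "nid b = v" by blast
      then have "nlev b \<in> {1..K}" "v \<in> tree_group G (nlev b)"
        using level[OF goodD(1), of b] \<open>v \<in> {..<r}\<close> by (auto simp: node_tree_def in_group_def)
      then show ?thesis by blast
    next
      case False
      then show ?thesis using \<open>v \<in> {..<r}\<close> r(3)
        by (auto simp: node_tree_def in_group_def intro!: bexI[of _ K])
    qed
  qed (auto simp: node_tree_def)
  have disj: "disjoint_family_on (tree_group G) {1..K}"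
    unfolding disjoint_family_on_def
  proof (intro ballI impI)
    fix i j :: nat assume "i \<noteq> j"
    then have "\<not> (in_group gs K i v \<and> in_group gs K j v)" for v
      using nid_inject unfolding in_group_def by metis
    then show "tree_group G i \<inter> tree_group G j = {}"
      by (auto simp: node_tree_def)
  qed
  have order: "\<exists>j\<in>{1..K}. i < j \<and> v \<in> tree_group G j"
    if u: "u \<in> tree_group G i" and e: "(u, v) \<in> E" for i u v
  proof -
    have "u < r" using u by (simp add: node_tree_def)
    then obtain a where a: "a \<in> set gs" "nid a = u" using e no_edge_from_pad by blast
    then obtain b where b: "b \<in> set gs" "nid b = v" "anc a b" using e edge_good by blast
    have "in_group gs K i u" using u by (simp add: node_tree_def)
    then have "nlev a = i" using a nid_inject unfolding in_group_def by metis
    with b have "nlev b \<in> {1..K}" "i < nlev b" "v \<in> tree_group G (nlev b)"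
      using level[OF goodD(1), of b] nid_less[of b] anc_level[of a b] by (auto simp: node_tree_def in_group_def)
    then show ?thesis by blast
  qed
  show ?thesis
    unfolding is_treecov_def tree_ground_eq r(2) using tree groups disj order by blast
qed

section \<open>Leaves, and feasible solutions as covers of points\<close>

lemma nid_leaf: assumes "u \<in> set gs" "\<forall>v\<in>set gs. \<not> anc u v" shows "nid u \<in> Leaf G"
proof -
  have "nid u \<in> verts G" using nid_less[OF assms(1)] by (simp add: node_tree_def)
  moreover have "(nid u, w) \<notin> E" for w using edge_good[OF assms(1)] assms(2) by blast
  ultimately show ?thesis by (simp add: Leaf_def)
qed

lemma leaf_cases:
  assumes "l \<in> Leaf G"
  obtains "l < r" "\<forall>b\<in>set gs. nid b \<noteq> l" | u where "u \<in> set gs" "nid u = l" "\<forall>v\<in>set gs. \<not> anc u v"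
proof -
  \<comment> \<open>The root is no leaf: since \<open>0 < r\<close>, vertex 0 differs from it and is
    reachable from it.\<close>
  have "l \<noteq> r"
    using root_path[of 0] r(1) assms by (metis (no_types, lifting) Leaf_def converse_rtranclE less_irrefl mem_Collect_eq zero_le)
  then have "l < r" using assms by (auto simp: Leaf_def node_tree_def)
  moreover have "\<forall>v\<in>set gs. \<not> anc u v" if "u \<in> set gs" "nid u = l" for u
  proof (intro ballI notI)
    fix v assume "v \<in> set gs" "anc u v"
    with that have "(l, nid v) \<in> E\<^sup>*" "l \<noteq> nid v"
      using anc_path[of u v] nid_inject[of u v] anc_level[of u v] by auto
    with assms show False by (metis (no_types, lifting) Leaf_def converse_rtranclE mem_Collect_eq)
  qed
  ultimately show ?thesis using that by blast
qed

text \<open>A topmost node around \<open>x\<close> has no ancestors, so the condition on ancestors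
  is vacuous.\<close>

lemma good_exists:
  assumes "v \<in> set ns" "inside x v"
  obtains d where "d \<in> set gs" "inside x d"
proof -
  let ?P = "\<lambda>v. v \<in> set ns \<and> inside x v"
  have "?P v" using assms by simp
  then obtain d where d: "?P d" "\<And>w. ?P w \<Longrightarrow> nlev d \<le> nlev w"
    by (rule obtain_least[of ?P v nlev]) (rule that)
  have "\<not> anc w d" if "w \<in> set ns" for w
    using d that anc_inside anc_level by (metis leD)
  then have "d \<in> set gs" using d(1) unfolding good_iff inside_def by (meson le_less_trans)
  then show ?thesis using that d(1) by blast
qed

text \<open>The deepest good node \<open>u\<close> around \<open>x\<close> is a leaf, so a chosen
  vertex lies on the path to it. That vertex is not padding, hence is \<open>u\<close> or an
  ancestor of \<open>u\<close> and contains \<open>x\<close>.\<close>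

lemma feasible_covers:
  assumes D: "D \<in> treecov_feasible G" and v: "v \<in> set ns" "inside x v"
  obtains d where "d \<in> set gs" "nid d \<in> D" "inside x d"
proof -
  let ?P = "\<lambda>u. u \<in> set gs \<and> inside x u"
  obtain u0 where "?P u0" using good_exists v by blast
  moreover have "\<forall>u. ?P u \<longrightarrow> nlev u \<le> K" using level goodD(1) by blast
  ultimately obtain u where u: "?P u" "\<And>w. ?P w \<Longrightarrow> nlev w \<le> nlev u"
    by (rule obtain_greatest[of ?P u0 nlev K]) (rule that)
  note uns = goodD(1)[OF conjunct1[OF u(1)]]
  have ux: "x \<in> set [0..<m]" using u(1) inside_less[OF uns] by simp
  have "\<forall>v\<in>set gs. \<not> anc u v"
  proof (intro ballI notI)
    fix v assume "v \<in> set gs" "anc u v"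
    then have ref: "refined ns [0..<m] u" using uns by (simp add: good_iff)
    \<comment> \<open>If \<open>u\<close> had a good descendant it would be refined, so some proper
      descendant contains \<open>x\<close>. The topmost such \<open>w\<close> is good: its ancestors
      are ancestors of the good \<open>u\<close>, or \<open>u\<close> itself, or would lie between
      \<open>u\<close> and \<open>w\<close>. This contradicts the depth of \<open>u\<close>.\<close>
    let ?R = "\<lambda>w. w \<in> set ns \<and> anc u w \<and> inside x w"
    obtain w0 where "?R w0" using ref u(1) ux unfolding refined_def by blast
    then obtain w where w: "?R w" "\<And>w'. ?R w' \<Longrightarrow> nlev w \<le> nlev w'"
      by (rule obtain_least[of ?R w0 nlev]) (rule that)
    have "refined ns [0..<m] y" if y: "y \<in> set ns" "anc y w" for y
    proof -
      have yx: "inside x y" using y(2) w(1) anc_inside by blast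
      consider "nlev y < nlev u" | "nlev y = nlev u" | "nlev u < nlev y" by linarith
      then show ?thesis
      proof cases
        case 1
        then have "anc y u" using nested y(1) uns yx u(1) by blast
        then show ?thesis using u(1) y(1) by (simp add: good_iff)
      next
        case 2
        then show ?thesis using same_level y(1) uns yx u(1) ref by blast
      next
        case 3
        then have "anc u y" using nested y(1) uns yx u(1) by blast
        then show ?thesis using w(2)[of y] y yx anc_level[of y w] by simp
      qed
    qed
    then have "w \<in> set gs" using w(1) by (auto simp: good_iff inside_def)
    then show False using u(2)[of w] w(1) anc_level[of u w] by simp
  qed
  then have "nid u \<in> Leaf G" using nid_leaf u(1) by blast
  then obtain d where d: "d \<in> D" "(d, nid u) \<in> E\<^sup>*"
    using D by (auto simp: treecov_feasible_def Des_def)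
  have "d < r" using D d(1) by (auto simp: treecov_feasible_def tree_ground_eq)
  then obtain a where a: "a \<in> set gs" "nid a = d"
    using path_pad[of d "nid u"] d(2) u(1) by metis
  then obtain b where "b \<in> set gs" "nid b = nid u" "b = a \<or> anc a b"
    using path_good[of a "nid u"] d(2) by blast
  then have "inside x a" using nid_inject u(1) anc_inside by metis
  with a d(1) that show ?thesis by blast
qed

lemma covers_feasible:
  assumes N: "N \<subseteq> set ns" and cov: "\<And>x v. v \<in> set ns \<Longrightarrow> inside x v \<Longrightarrow> \<exists>w\<in>N. inside x w"
  shows "nid ` (N \<inter> set gs) \<union> {p. p < r \<and> (\<forall>b\<in>set gs. nid b \<noteq> p)} \<in> treecov_feasible G" (is "?D \<in> _")
proof -
  have "\<exists>d\<in>?D. (d, l) \<in> E\<^sup>*" if "l \<in> Leaf G" for l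
    using that
  proof (cases rule: leaf_cases)
    case 1
    then show ?thesis by blast
  next
    case (2 u)
    define x where "x = na u"
    have ux: "u \<in> set ns" "inside x u" using goodD[OF 2(1)] by (simp_all add: x_def)
    \<comment> \<open>The topmost member of \<open>N\<close> around a point of the leaf will be
      shown to be good. It then cannot lie below the leaf \<open>u\<close>, so it covers
      \<open>u\<close>.\<close>
    let ?P = "\<lambda>v. v \<in> N \<and> inside x v"
    obtain v0 where "?P v0" using cov ux by blast
    then obtain v where v: "?P v" "\<And>w. ?P w \<Longrightarrow> nlev v \<le> nlev w"
      by (rule obtain_least[of ?P v0 nlev]) (rule that)
    then have vns: "v \<in> set ns" using N by blast
    have "refined ns [0..<m] w" if w: "w \<in> set ns" "anc w v" for w
    proof (rule ccontr)
      assume "\<not> ?thesis"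
      then obtain z where z: "inside z w" "\<And>y. y \<in> set ns \<Longrightarrow> anc w y \<Longrightarrow> \<not> inside z y"
        unfolding refined_def by blast
      \<comment> \<open>An unrefined ancestor \<open>w\<close> of \<open>v\<close> has a point
        \<open>z\<close> outside all its proper descendants. The member of \<open>N\<close> covering
        \<open>z\<close> is thus \<open>w\<close> or above it, contains \<open>x\<close> too, and is
        higher than the topmost choice \<open>v\<close>.\<close>
      obtain y where y: "y \<in> N" "inside z y" using cov w(1) z(1) by blast
      then have yns: "y \<in> set ns" using N by blast
      have "\<not> nlev w < nlev y" using nested[OF w(1) yns _ z(1) y(2)] z(2) yns y(2) by blast
      then have "y = w \<or> anc y w"
        using nested[OF yns w(1) _ y(2) z(1)] same_level[OF yns w(1) _ y(2) z(1)] by linarith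
      then have "inside x y" "nlev y < nlev v"
        using w(2) v(1) anc_inside anc_level anc_trans by blast+
      with v(2)[of y] y(1) show False by simp
    qed
    then have "v \<in> set gs" using vns v(1) by (auto simp: good_iff inside_def)
    moreover have "v = u \<or> anc v u"
      using nested[of v u x] nested[of u v x] same_level[of v u x] vns ux v(1) 2 calculation
      by (metis linorder_neqE_nat)
    ultimately show ?thesis using anc_path[of v u] 2 v(1) by blast
  qed
  then show ?thesis
    using nid_less unfolding treecov_feasible_def tree_ground_eq Des_def by fast
qed

end

section \<open>The reduction\<close>

type_synonym iv = "endpoint \<times> endpoint"

text \<open>A cut \<open>(k, q, s)\<close> splits the real line just before (\<open>s = 0\<close>) or just after
  (\<open>s = 1\<close>) the rational \<open>q\<close> if \<open>k = 1\<close>; \<open>k = 0\<close> and \<open>k = 2\<close> are the two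
  infinite cuts.  The order on cuts is lexicographic.\<close>

type_synonym cut = "nat \<times> rat \<times> nat"

primrec lcut :: "endpoint \<Rightarrow> cut" where
  "lcut Unbounded = (0, 0, 0)"
| "lcut (Closed q) = (1, q, 0)"
| "lcut (Open q) = (1, q, 1)"

primrec rcut :: "endpoint \<Rightarrow> cut" where
  "rcut Unbounded = (2, 0, 0)"
| "rcut (Closed q) = (1, q, 1)"
| "rcut (Open q) = (1, q, 0)"

definition cuts :: "iv list \<Rightarrow> iv \<Rightarrow> cut list" where
  "cuts us g = map (\<lambda>v. lcut (fst v)) (g # us) @ map (\<lambda>v. rcut (snd v)) (g # us)"

definition rank :: "cut list \<Rightarrow> cut \<Rightarrow> nat" where
  "rank cs c = length (filter (\<lambda>d. d < c) cs)"

text \<open>An interval in no group exhausts \<open>ss\<close> and gets the level one above the last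
  group. An interval disjoint from the target becomes an item without points. Positions in
  \<open>us\<close> serve as identifiers.\<close>

definition mk_item :: "iv list \<Rightarrow> iv \<Rightarrow> iv list list \<Rightarrow> iv \<Rightarrow> item" where
  "mk_item us g ss v =
     (max (rank (cuts us g) (lcut (fst g))) (rank (cuts us g) (lcut (fst v))),
      min (rank (cuts us g) (rcut (snd g))) (rank (cuts us g) (rcut (snd v))),
      Suc (length (takeWhile (\<lambda>G. v \<notin> set G) ss)),
      length (takeWhile (\<lambda>w. w \<noteq> v) us))"

definition items :: "iv list \<Rightarrow> iv \<Rightarrow> iv list list \<Rightarrow> item list" where
  "items us g ss = map (\<lambda>v. mk_item us g ss v) us"

definition points :: "iv list \<Rightarrow> iv \<Rightarrow> nat list" where
  "points us g = [0..<length (cuts us g)]"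

definition levels :: "iv list list \<Rightarrow> nat list" where
  "levels ss = [0..<Suc (Suc (length ss))]"

definition nodes :: "iv list \<Rightarrow> iv \<Rightarrow> iv list list \<Rightarrow> node list" where
  "nodes us g ss = map (\<lambda>e. (iid e, ilev e, region (items us g ss) (points us g) (levels ss) e)) (items us g ss)"

definition good_nodes :: "iv list \<Rightarrow> iv \<Rightarrow> iv list list \<Rightarrow> node list" where
  "good_nodes us g ss = goods (nodes us g ss) (points us g)"

text \<open>The test that is made before the tree algorithm is called. It is phrased with regions
  because the way back starts from a region around each point of the target.\<close>

definition coverable :: "iv list \<Rightarrow> iv \<Rightarrow> iv list list \<Rightarrow> bool" where
  "coverable us g ss \<longleftrightarrow> (\<forall>x\<in>set (points us g).
     rank (cuts us g) (lcut (fst g)) \<le> x \<and> x < rank (cuts us g) (rcut (snd g)) \<longrightarrow>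
     (\<exists>v\<in>set (nodes us g ss). inside x v))"

text \<open>Doubling the number of intervals makes the number of groups of the tree exceed that of the
  interval instance by one; the additional group holds the intervals without a group.\<close>

definition tree_of :: "iv list \<Rightarrow> iv \<Rightarrow> iv list list \<Rightarrow> nat list \<times> (nat \<times> nat) list \<times> nat \<times> nat list list" where
  "tree_of us g ss =
     ([0..<Suc (length (us @ us))],
      filter (\<lambda>e. tree_edge (good_nodes us g ss) (length (us @ us)) (fst e) (snd e))
        (List.product [0..<Suc (length (us @ us))] [0..<Suc (length (us @ us))]),
      length (us @ us),
      map (\<lambda>k. filter (\<lambda>v. in_group (good_nodes us g ss) (Suc (length ss)) (Suc k) v) [0..<length (us @ us)])
        [0..<Suc (length ss)])"

text \<open>Asking for a good node with the identifier filters out chosen padding leaves, whose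
  identifiers may be those of intervals whose nodes were dropped.\<close>

definition translate :: "iv list \<Rightarrow> iv \<Rightarrow> iv list list \<Rightarrow> nat list \<Rightarrow> iv list" where
  "translate us g ss sol = filter (\<lambda>v. \<exists>d\<in>set (items us g ss). iid d \<in> set sol \<and>
     (\<exists>b\<in>set (good_nodes us g ss). nid b = iid d) \<and>
     (mk_item us g ss v = d \<or> crosses (items us g ss) (points us g) (levels ss) d (mk_item us g ss v))) us"


subsection \<open>The reduction runs in polynomial time\<close>

text \<open>An endpoint is neither a pair nor an option, so the cut is computed from the raw code by
  inspecting its tag.\<close>

lemma polytime_lcut: assumes "polytime f" shows "polytime (\<lambda>x. lcut (f x))"
proof -
  let ?r = "\<lambda>x. prim_fun Second (enc (f x))"
  let ?h = "\<lambda>x. if enc (f x) = Atom 0 then enc (0::nat, 0::rat, 0::nat)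
    else Cell (enc (1::nat)) (Cell (?r x) (enc (if prim_fun First (enc (f x)) = Atom 1 then 0 else 1 :: nat)))"
  have f: "polytime (\<lambda>x. enc (f x))" using assms by (simp add: polytime_enc_iff)
  have "polytime (\<lambda>x. enc (if prim_fun First (enc (f x)) = Atom 1 then 0 else 1 :: nat))"
    unfolding polytime_enc_iff by (intro polytime_if polytime_eq polytime_First polytime_const f)
  then have "polytime ?h"
    by (intro polytime_if polytime_eq polytime_Cell polytime_Second polytime_const f)
  moreover have "?h x = enc (lcut (f x))" for x
    by (cases "f x") (simp_all add: enc_endpoint_def enc_rat_def enc_nat_def nat_code_def)
  ultimately show ?thesis by (simp add: polytime_enc_iff)
qed

lemma polytime_rcut: assumes "polytime f" shows "polytime (\<lambda>x. rcut (f x))"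
proof -
  have eq: "rcut e = (if fst (lcut e) = 0 then (2, 0, 0)
      else (1, fst (snd (lcut e)), if snd (snd (lcut e)) = 0 then 1 else 0))" for e
    by (cases e) auto
  show ?thesis unfolding eq by (intro polytime_basic polytime_lcut assms)
qed

lemma polytime_cut_less:
  assumes "polytime f" "polytime (g :: 'a::code \<Rightarrow> cut)" shows "polytime (\<lambda>x. f x < g x)"
proof -
  have eq: "c < d \<longleftrightarrow> fst c < fst d \<or> fst c = fst d \<and>
      (fst (snd c) < fst (snd d) \<or> fst (snd c) = fst (snd d) \<and> snd (snd c) < snd (snd d))" for c d :: cut
    by (auto simp: less_prod_def)
  show ?thesis unfolding eq by (intro polytime_basic assms)
qed

lemma polytime_upt_Suc: assumes "polytime l" shows "polytime (\<lambda>x. [0..<Suc (length (l x))])"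
proof -
  have "polytime (\<lambda>x. [0..<length (0 # map (\<lambda>_. 0::nat) (l x))])"
    by (intro polytime_basic polytime_lists assms)
  then show ?thesis by (simp only: list.size length_map add_Suc_right add_0_right)
qed

lemma polytime_length_takeWhile:
  assumes P: "polytime (\<lambda>z. P (fst z) (snd z))" and l: "polytime l"
  shows "polytime (\<lambda>x. length (takeWhile (\<lambda>e. P e x) (l x)))"
proof -
  let ?f = "\<lambda>x e a. if fst a \<and> P e x then (True, Suc (snd a)) else (False, snd a)"
  have *: "fold (?f x) ys (False, k) = (False, k)" for x ys k
    by (induction ys) auto
  have eq: "fold (?f x) ys (True, k) = (\<forall>y\<in>set ys. P y x, k + length (takeWhile (\<lambda>e. P e x) ys))" for x ys k
    by (induction ys arbitrary: k) (auto simp: *)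
  have P': "polytime (\<lambda>z. P (fst z) (snd (snd z)))"
    using polytime_comp[OF P polytime_pair[OF polytime_fst polytime_snd[OF polytime_snd], OF polytime_id polytime_id]] by simp
  have "polytime (\<lambda>x. fold (\<lambda>e a. ?f x e a) (l x) (True, 0))"
  proof (rule polytime_fold)
    show "polybounded (\<lambda>x. 4 + sz (l x))" by (intro polybounded_intros l)
    fix x ys zs assume lx: "l x = ys @ zs"
    have "length (takeWhile (\<lambda>e. P e x) ys) \<le> sz (l x)"
      using length_takeWhile_le[of "\<lambda>e. P e x" ys] length_le_sz[of "l x"] lx by simp
    then show "sz (fold (?f x) ys (True, 0)) \<le> 4 + sz (l x)"
      unfolding eq using sz_bool_le[of "\<forall>y\<in>set ys. P y x"] sz_nat_le[of "length (takeWhile (\<lambda>e. P e x) ys)"]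
      by simp
  qed (intro polytime_basic P' l)+
  from polytime_snd[OF this] show ?thesis by (simp add: eq)
qed

lemmas polytime_intros = polytime_basic polytime_lists polytime_lcut polytime_rcut polytime_cut_less polytime_upt_Suc polytime_length_takeWhile

lemma polytime_cuts: "polytime us \<Longrightarrow> polytime g \<Longrightarrow> polytime (\<lambda>x. cuts (us x) (g x))"
  unfolding cuts_def by (intro polytime_intros)

text \<open>Under a binder the context becomes a component of a pair.
  \<open>assms[THEN polytime_comp]\<close> supplies the assumptions precomposed with the
  corresponding projection; the proofs below follow this pattern.\<close>

lemma polytime_rank: assumes "polytime cs" "polytime c" shows "polytime (\<lambda>x. rank (cs x) (c x))"
  unfolding rank_def by (intro polytime_intros assms[THEN polytime_comp])

lemma polytime_points: "polytime us \<Longrightarrow> polytime g \<Longrightarrow> polytime (\<lambda>x. points (us x) (g x))"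
  unfolding points_def by (intro polytime_intros polytime_cuts)

lemma polytime_levels: assumes "polytime ss" shows "polytime (\<lambda>x. levels (ss x))"
proof -
  have "polytime (\<lambda>x. [0..<Suc (length (0 # map (\<lambda>_. 0::nat) (ss x)))])"
    by (intro polytime_intros assms)
  then show ?thesis by (simp only: levels_def list.size length_map add_Suc_right add_0_right)
qed

lemma polytime_mk_item:
  assumes "polytime us" "polytime g" "polytime ss" "polytime v" shows "polytime (\<lambda>x. mk_item (us x) (g x) (ss x) (v x))"
  unfolding mk_item_def by (intro polytime_intros polytime_cuts polytime_rank assms[THEN polytime_comp])

lemma polytime_items:
  assumes "polytime us" "polytime g" "polytime ss" shows "polytime (\<lambda>x. items (us x) (g x) (ss x))"
  unfolding items_def by (intro polytime_intros polytime_mk_item assms[THEN polytime_comp])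

lemma polytime_best: assumes "polytime xs" "polytime k" "polytime p" shows "polytime (\<lambda>x. best (xs x) (k x) (p x))"
  unfolding best_def contains_def by (intro polytime_intros assms[THEN polytime_comp])

lemma polytime_reach: assumes "polytime xs" "polytime k" "polytime p" shows "polytime (\<lambda>x. reach (xs x) (k x) (p x))"
  unfolding reach_def by (intro polytime_intros polytime_best assms[THEN polytime_comp])

lemma polytime_starts: assumes "polytime xs" "polytime pts" "polytime k" shows "polytime (\<lambda>x. starts (xs x) (pts x) (k x))"
  unfolding starts_def
  by (rule polytime_select) (intro polytime_intros polytime_reach assms[THEN polytime_comp])+

lemma polytime_push:
  assumes "polytime xs" "polytime pts" "polytime k" "polytime p" shows "polytime (\<lambda>x. push (xs x) (pts x) (k x) (p x))"
  unfolding push_def by (intro polytime_intros polytime_reach polytime_starts assms[THEN polytime_comp])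

text \<open>Keeps the accumulator of \<open>pushes\<close> among the original boundary and the right
  ends occurring in the input, which bounds its size.\<close>

lemma push_cases: "push xs pts k p = p \<or> push xs pts k p \<in> ir ` set xs"
proof (cases "find (\<lambda>s. s < p \<and> p < reach xs k s) (starts xs pts k)")
  case (Some s)
  then have "s < reach xs k s" using find_SomeD by fastforce
  then obtain e where e: "best xs k s = Some e" by (auto simp: reach_def split: option.splits)
  then have "e \<in> set xs" using find_SomeD[OF e[unfolded best_def]] by simp
  with Some e show ?thesis by (auto simp: push_def reach_def)
qed (simp add: push_def)

lemma polytime_pushes:
  assumes "polytime xs" "polytime pts" "polytime lv" "polytime i" "polytime j" "polytime p"
  shows "polytime (\<lambda>x. pushes (xs x) (pts x) (lv x) (i x) (j x) (p x))"
  unfolding pushes_def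
proof (rule polytime_fold)
  show "polybounded (\<lambda>x. sz (p x) + sz (xs x))" by (intro polybounded_intros assms)
  fix x ks zs
  let ?F = "fold (\<lambda>k q. if i x < k \<and> k < j x then push (xs x) (pts x) k q else q) ks"
  define R where "R = ir ` set (xs x)"
  have R: "push (xs x) (pts x) k q = q \<or> push (xs x) (pts x) k q \<in> R" for k q
    unfolding R_def by (rule push_cases)
  have cases: "?F q = q \<or> ?F q \<in> R" for q
  proof (induction ks arbitrary: q)
    case (Cons k ks)
    show ?case using Cons[of q] Cons[of "push (xs x) (pts x) k q"] R[of k q] by auto
  qed simp
  have "sz (ir e) \<le> sz (xs x)" if "e \<in> set (xs x)" for e
    using sz_elem_le[OF that] by (cases e) simp
  with cases[of "p x"] show "sz (?F (p x)) \<le> sz (p x) + sz (xs x)"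
    unfolding R_def by (elim disjE imageE) (simp_all add: trans_le_add2)
qed (intro polytime_intros polytime_push assms[THEN polytime_comp])+

lemma polytime_start_of: assumes "polytime xs" "polytime pts" "polytime e" shows "polytime (\<lambda>x. start_of (xs x) (pts x) (e x))"
  unfolding start_of_def by (intro polytime_intros polytime_best polytime_starts assms[THEN polytime_comp])

lemma polytime_region:
  assumes "polytime xs" "polytime pts" "polytime lv" "polytime e" shows "polytime (\<lambda>x. region (xs x) (pts x) (lv x) (e x))"
  unfolding region_def by (intro polytime_intros polytime_start_of polytime_pushes assms[THEN polytime_comp])

lemma polytime_crosses:
  assumes "polytime xs" "polytime pts" "polytime lv" "polytime e" "polytime e'"
  shows "polytime (\<lambda>x. crosses (xs x) (pts x) (lv x) (e x) (e' x))"
  unfolding crosses_def by (intro polytime_intros polytime_start_of polytime_pushes assms[THEN polytime_comp])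

lemma polytime_inside: "polytime p \<Longrightarrow> polytime v \<Longrightarrow> polytime (\<lambda>x. inside (p x) (v x))"
  unfolding inside_def by (intro polytime_intros)

lemma polytime_anc: "polytime u \<Longrightarrow> polytime v \<Longrightarrow> polytime (\<lambda>x. anc (u x) (v x))"
  unfolding anc_def by (intro polytime_intros)

lemma polytime_refined: assumes "polytime ns" "polytime pts" "polytime w" shows "polytime (\<lambda>x. refined (ns x) (pts x) (w x))"
  unfolding refined_def by (intro polytime_intros polytime_inside polytime_anc assms[THEN polytime_comp])

lemma polytime_goods: assumes "polytime ns" "polytime pts" shows "polytime (\<lambda>x. goods (ns x) (pts x))"
  unfolding goods_def by (intro polytime_intros polytime_refined polytime_anc assms[THEN polytime_comp])

lemma polytime_tree_edge:
  assumes "polytime gs" "polytime r" "polytime u" "polytime v" shows "polytime (\<lambda>x. tree_edge (gs x) (r x) (u x) (v x))"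
  unfolding tree_edge_def by (intro polytime_intros polytime_anc assms[THEN polytime_comp])

lemma polytime_in_group:
  assumes "polytime gs" "polytime K" "polytime k" "polytime v" shows "polytime (\<lambda>x. in_group (gs x) (K x) (k x) (v x))"
  unfolding in_group_def by (intro polytime_intros assms[THEN polytime_comp])

lemma polytime_nodes:
  assumes "polytime us" "polytime g" "polytime ss" shows "polytime (\<lambda>x. nodes (us x) (g x) (ss x))"
  unfolding nodes_def
  by (intro polytime_intros polytime_items polytime_points polytime_levels polytime_region assms[THEN polytime_comp])

lemma polytime_good_nodes:
  assumes "polytime us" "polytime g" "polytime ss" shows "polytime (\<lambda>x. good_nodes (us x) (g x) (ss x))"
  unfolding good_nodes_def by (intro polytime_goods polytime_nodes polytime_points assms)

lemma polytime_coverable: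
  assumes "polytime us" "polytime g" "polytime ss" shows "polytime (\<lambda>x. coverable (us x) (g x) (ss x))"
  unfolding coverable_def
  by (intro polytime_intros polytime_nodes polytime_points polytime_inside polytime_rank polytime_cuts assms[THEN polytime_comp])

lemma polytime_tree_of:
  assumes "polytime us" "polytime g" "polytime ss" shows "polytime (\<lambda>x. tree_of (us x) (g x) (ss x))"
  unfolding tree_of_def
  by (intro polytime_intros polytime_good_nodes polytime_tree_edge polytime_in_group assms[THEN polytime_comp])

lemma polytime_translate:
  assumes "polytime us" "polytime g" "polytime ss" "polytime sol" shows "polytime (\<lambda>x. translate (us x) (g x) (ss x) (sol x))"
  unfolding translate_def
  by (intro polytime_intros polytime_good_nodes polytime_items polytime_crosses polytime_points polytime_levels polytime_mk_item assms[THEN polytime_comp])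

subsection \<open>Cuts and ranks\<close>

definition proper :: "iv \<Rightarrow> bool" where
  "proper v \<longleftrightarrow> interval (fst v) (snd v) \<noteq> {}"

abbreviation set_of :: "iv \<Rightarrow> real set" where
  "set_of v \<equiv> interval (fst v) (snd v)"

definition cut_le :: "cut \<Rightarrow> real \<Rightarrow> bool" where
  "cut_le c y \<longleftrightarrow> fst c = 0 \<or> fst c = 1 \<and> (if snd (snd c) = 0 then of_rat (fst (snd c)) \<le> y else of_rat (fst (snd c)) < y)"

lemma above_iff: "above l y \<longleftrightarrow> cut_le (lcut l) y"
  by (cases l) (auto simp: cut_le_def)

lemma below_iff: "below u y \<longleftrightarrow> \<not> cut_le (rcut u) y"
  by (cases u) (auto simp: cut_le_def)

lemma mem_set_of: "y \<in> set_of v \<longleftrightarrow> cut_le (lcut (fst v)) y \<and> \<not> cut_le (rcut (snd v)) y"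
  by (simp add: interval_def above_iff below_iff)

text \<open>Picks one triple for each position on the line, so that distinct cuts are separated by a
  real number.\<close>

definition is_cut :: "cut \<Rightarrow> bool" where
  "is_cut c \<longleftrightarrow> c = (0, 0, 0) \<or> c = (2, 0, 0) \<or> fst c = 1 \<and> snd (snd c) \<le> 1"

lemma is_cut_lcut: "is_cut (lcut e)" and is_cut_rcut: "is_cut (rcut e)"
  by (cases e; simp add: is_cut_def)+

lemma cut_le_mono:
  assumes "c \<le> d" "cut_le d y" "is_cut c" "is_cut d" shows "cut_le c y"
proof -
  obtain k q s l p t where [simp]: "c = (k, q, s)" "d = (l, p, t)" by (cases c; cases d)
  have "k < l \<or> k = l \<and> (q < p \<or> q = p \<and> s \<le> t)"
    using assms(1) by (auto simp: less_eq_prod_def less_prod_def)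
  moreover have "q < p \<Longrightarrow> real_of_rat q < real_of_rat p" by (simp add: of_rat_less)
  ultimately show ?thesis using assms(2-4) by (auto simp: cut_le_def is_cut_def split: if_splits)
qed

lemma cut_separate:
  assumes "c < d" "is_cut c" "is_cut d" obtains y where "cut_le c y" "\<not> cut_le d y"
proof -
  obtain k q s l p t where [simp]: "c = (k, q, s)" "d = (l, p, t)" by (cases c; cases d)
  have less: "k < l \<or> k = l \<and> (q < p \<or> q = p \<and> s < t)"
    using assms(1) by (auto simp: less_eq_prod_def less_prod_def)
  consider "k = 0" "l = 2" | "k = 0" "l = 1" | "k = 1" "l = 2" | "k = 1" "l = 1" "q < p"
    | "k = 1" "l = 1" "q = p" "s = 0" "t = 1"
    using less assms(2,3) by (auto simp: is_cut_def le_Suc_eq)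
  then show ?thesis
  proof cases
    case 1
    then show ?thesis using that[of 0] by (simp add: cut_le_def)
  next
    case 2
    then show ?thesis using that[of "of_rat p - 1"] by (simp add: cut_le_def)
  next
    case 3
    then show ?thesis using that[of "of_rat q + 1"] by (simp add: cut_le_def)
  next
    case 4
    then have "real_of_rat q < real_of_rat p" by (simp add: of_rat_less)
    then obtain y where "real_of_rat q < y" "y < real_of_rat p" using dense by blast
    with 4 show ?thesis using that[of y] by (simp add: cut_le_def)
  next
    case 5
    then show ?thesis using that[of "of_rat q"] by (simp add: cut_le_def)
  qed
qed

lemma cut_eqI:
  assumes "is_cut c" "is_cut d" "\<And>y. cut_le c y \<longleftrightarrow> cut_le d y" shows "c = d"
  using cut_separate[of c d] cut_separate[of d c] assms by (metis linorder_neqE)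

lemma rank_mono: "c \<le> d \<Longrightarrow> rank cs c \<le> rank cs d"
  unfolding rank_def by (induction cs) (auto intro: order.strict_trans2)

lemma rank_less: "c \<in> set cs \<Longrightarrow> c < d \<Longrightarrow> rank cs c < rank cs d"
proof -
  assume c: "c \<in> set cs" "c < d"
  have "filter (\<lambda>x. x < c) cs = filter (\<lambda>x. x < c) (filter (\<lambda>x. x < d) cs)"
    using c(2) by (auto intro!: filter_cong)
  also have "length \<dots> < length (filter (\<lambda>x. x < d) cs)"
    by (rule length_filter_less[of c]) (use c in auto)
  finally show ?thesis by (simp add: rank_def)
qed

lemma rank_le_length: "rank cs c \<le> length cs"
  by (simp add: rank_def)

lemma rank_le_iff: "c \<in> set cs \<Longrightarrow> d \<in> set cs \<Longrightarrow> rank cs c \<le> rank cs d \<longleftrightarrow> c \<le> d"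
  using rank_mono[of c d cs] rank_less[of d cs c] by (meson not_le)

text \<open>The point \<open>x\<close> and the real \<open>y\<close> lie on the same side of every
  cut. This is a relation, not a function: all reals between neighbouring cuts match alike, and so
  do the numbers that ranks skip when cuts are repeated.\<close>

definition matches :: "cut list \<Rightarrow> nat \<Rightarrow> real \<Rightarrow> bool" where
  "matches cs x y \<longleftrightarrow> (\<forall>c\<in>set cs. rank cs c \<le> x \<longleftrightarrow> cut_le c y)"

lemma matching_nat:
  assumes cs: "\<forall>c\<in>set cs. is_cut c" and c: "c \<in> set cs" "cut_le c y"
  obtains x where "matches cs x y"
proof -
  let ?A = "{c \<in> set cs. cut_le c y}"
  have A: "finite ?A" "c \<in> ?A" using c by simp_all
  \<comment> \<open>The last cut at or before \<open>y\<close>; its rank represents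
    \<open>y\<close>.\<close>
  define d where "d = Max ?A"
  have "d \<in> ?A" unfolding d_def using A by (intro Max_in) blast+
  have "rank cs e \<le> rank cs d \<longleftrightarrow> cut_le e y" if e: "e \<in> set cs" for e
  proof -
    have "cut_le e y \<Longrightarrow> e \<le> d" unfolding d_def using A(1) e by (intro Max_ge) auto
    moreover have "e \<le> d \<Longrightarrow> cut_le e y" using cut_le_mono[of e d y] cs e \<open>d \<in> ?A\<close> by blast
    ultimately show ?thesis using rank_le_iff[OF e, of d] \<open>d \<in> ?A\<close> by blast
  qed
  then have "matches cs (rank cs d) y" by (simp add: matches_def)
  then show ?thesis by (rule that)
qed

lemma matching_real:
  assumes cs: "\<forall>c\<in>set cs. is_cut c" and c: "c \<in> set cs" "rank cs c \<le> x" and d: "d \<in> set cs" "x < rank cs d"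
  obtains y where "matches cs x y"
proof -
  let ?A = "{c \<in> set cs. rank cs c \<le> x}" and ?B = "{c \<in> set cs. x < rank cs c}"
  have A: "finite ?A" "c \<in> ?A" and B: "finite ?B" "d \<in> ?B" using c d by simp_all
  \<comment> \<open>The cuts next to the point on either side. They are distinct, so some real
    separates them, and monotonicity settles all other cuts.\<close>
  define a where "a = Max ?A"
  define b where "b = Min ?B"
  have a: "a \<in> ?A" unfolding a_def using A by (intro Max_in) blast+
  have b: "b \<in> ?B" unfolding b_def using B by (intro Min_in) blast+
  have "a < b" using a b rank_le_iff[of b cs a] by auto
  then obtain y where y: "cut_le a y" "\<not> cut_le b y" using cut_separate a b cs by blast
  have "rank cs e \<le> x \<longleftrightarrow> cut_le e y" if e: "e \<in> set cs" for e
  proof (cases "rank cs e \<le> x")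
    case True
    then have "e \<le> a" unfolding a_def using A(1) e by (intro Max_ge) auto
    with True cut_le_mono[of e a y] y(1) cs e a show ?thesis by blast
  next
    case False
    then have "b \<le> e" unfolding b_def using B(1) e by (intro Min_le) auto
    with False cut_le_mono[of b e y] y(2) cs e b show ?thesis by blast
  qed
  then have "matches cs x y" by (simp add: matches_def)
  then show ?thesis by (rule that)
qed

text \<open>Compare with a common element \<open>z\<close>: up to \<open>z\<close> membership
  depends on the left cut alone, from \<open>z\<close> on it depends on the right cut alone. Thus
  the set determines both cuts.\<close>

lemma set_of_inject: assumes "proper v" "proper w" "set_of v = set_of w" shows "v = w"
proof -
  obtain z where z: "z \<in> set_of v" using assms(1) by (auto simp: proper_def)
  have z': "z \<in> set_of w" using z assms(3) by simp
  have lcut_inj: "lcut e = lcut e' \<Longrightarrow> e = e'" for e e' by (cases e; cases e') auto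
  have rcut_inj: "rcut e = rcut e' \<Longrightarrow> e = e'" for e e' by (cases e; cases e') auto
  have above_mono: "y \<le> y' \<Longrightarrow> cut_le c y \<Longrightarrow> cut_le c y'" for c and y y' :: real
    by (auto simp: cut_le_def split: if_splits)
  have "cut_le (lcut (fst v)) y \<longleftrightarrow> cut_le (lcut (fst w)) y" for y
  proof (cases "y \<le> z")
    case True
    have "y \<in> set_of v \<longleftrightarrow> y \<in> set_of w" using assms(3) by simp
    moreover have "\<not> cut_le (rcut (snd v)) y" "\<not> cut_le (rcut (snd w)) y"
      using above_mono[OF True] z z' unfolding mem_set_of by blast+
    ultimately show ?thesis by (auto simp: mem_set_of)
  next
    case False
    then have "z \<le> y" by simp
    from above_mono[OF this] show ?thesis using z z' unfolding mem_set_of by blast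
  qed
  then have "lcut (fst v) = lcut (fst w)" by (intro cut_eqI is_cut_lcut)
  moreover have "cut_le (rcut (snd v)) y \<longleftrightarrow> cut_le (rcut (snd w)) y" for y
  proof (cases "z \<le> y")
    case True
    have "y \<in> set_of v \<longleftrightarrow> y \<in> set_of w" using assms(3) by simp
    moreover have "cut_le (lcut (fst v)) y" "cut_le (lcut (fst w)) y"
      using above_mono[OF True] z z' unfolding mem_set_of by blast+
    ultimately show ?thesis by (auto simp: mem_set_of)
  next
    case False
    then have "y \<le> z" by simp
    from above_mono[OF this] show ?thesis using z z' unfolding mem_set_of by blast
  qed
  then have "rcut (snd v) = rcut (snd w)" by (intro cut_eqI is_cut_rcut)
  ultimately show ?thesis using lcut_inj rcut_inj by (metis prod.expand)
qed

subsection \<open>Correctness\<close>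

lemma length_takeWhile_neq:
  "distinct us \<Longrightarrow> v \<in> set us \<Longrightarrow> length (takeWhile (\<lambda>w. w \<noteq> v) us) < length us \<and>
     us ! length (takeWhile (\<lambda>w. w \<noteq> v) us) = v"
  by (induction us) auto

section \<open>An interval instance with fixed listings, read on integer points\<close>

locale intcov_instance =
  fixes P :: intcov and us :: "iv list" and g :: iv and ss :: "iv list list"
  assumes distinct: "distinct us" and proper: "\<And>v. v \<in> set us \<Longrightarrow> proper v" and proper_target: "proper g"
    and ivs: "intervals P = set_of ` set us" and target: "target P = set_of g"
    and T: "num_groups (intervals P) = length ss"
    and groups: "\<And>i. i \<in> {1..length ss} \<Longrightarrow> int_group P i = set_of ` set (ss ! (i - 1)) \<and>
      int_group P i \<subseteq> intervals P \<and> (\<forall>v\<in>set (ss ! (i - 1)). proper v)"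
    and disjoint: "disjoint_family_on (int_group P) {1..length ss}"
begin

abbreviation "xs \<equiv> items us g ss"
abbreviation "mk \<equiv> mk_item us g ss"
abbreviation "n \<equiv> length us"
abbreviation "cs \<equiv> cuts us g"
abbreviation "m \<equiv> length cs"
abbreviation "K \<equiv> Suc (length ss)"
abbreviation "lo \<equiv> rank cs (lcut (fst g))"
abbreviation "hi \<equiv> rank cs (rcut (snd g))"

lemma set_of_inj: "inj_on set_of (set us)"
  using proper set_of_inject by (meson inj_onI)

lemma card_ivs: "card (intervals P) = n"
  using card_image[OF set_of_inj] distinct by (simp add: ivs distinct_card)

lemma set_xs: "set xs = mk ` set us"
  by (simp add: items_def)

lemma iid_mk: "v \<in> set us \<Longrightarrow> iid (mk v) < n \<and> us ! iid (mk v) = v"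
  using length_takeWhile_neq[OF distinct] by (simp add: mk_item_def)

lemma iid_inj: "inj_on iid (set xs)"
proof (rule inj_onI)
  fix d e assume "d \<in> set xs" "e \<in> set xs" "iid d = iid e"
  then show "d = e" unfolding set_xs using iid_mk by (metis imageE)
qed

lemma mk_inj: "inj_on mk (set us)"
  using iid_mk by (metis inj_onI)

lemma mk_bounds: "il (mk v) \<le> x \<and> x < ir (mk v) \<longleftrightarrow>
    lo \<le> x \<and> x < hi \<and> rank cs (lcut (fst v)) \<le> x \<and> x < rank cs (rcut (snd v))"
  by (auto simp: mk_item_def)

lemma cuts_mem: "lcut (fst g) \<in> set cs" "rcut (snd g) \<in> set cs"
  "v \<in> set us \<Longrightarrow> lcut (fst v) \<in> set cs" "v \<in> set us \<Longrightarrow> rcut (snd v) \<in> set cs"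
  by (auto simp: cuts_def)

lemma is_cut_cuts: "\<forall>c\<in>set cs. is_cut c"
  by (auto simp: cuts_def is_cut_lcut is_cut_rcut)

lemma matches_mem:
  assumes "matches cs x y" "v = g \<or> v \<in> set us"
  shows "y \<in> set_of v \<longleftrightarrow> rank cs (lcut (fst v)) \<le> x \<and> x < rank cs (rcut (snd v))"
proof -
  have "lcut (fst v) \<in> set cs" "rcut (snd v) \<in> set cs" using assms(2) cuts_mem by blast+
  then have "rank cs (lcut (fst v)) \<le> x \<longleftrightarrow> cut_le (lcut (fst v)) y"
    "rank cs (rcut (snd v)) \<le> x \<longleftrightarrow> cut_le (rcut (snd v)) y"
    using assms(1) unfolding matches_def by blast+
  then show ?thesis unfolding mem_set_of by (meson not_le)
qed

text \<open>A real of the target is replaced by a matching point and conversely; matching preserves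
  membership in the target and in every interval.\<close>

lemma cover_iff:
  assumes D: "D \<subseteq> set us"
  shows "set_of g \<subseteq> \<Union>(set_of ` D) \<longleftrightarrow>
    (\<forall>x. lo \<le> x \<longrightarrow> x < hi \<longrightarrow> (\<exists>v\<in>D. il (mk v) \<le> x \<and> x < ir (mk v)))"
proof (intro iffI allI impI subsetI)
  fix x assume cov: "set_of g \<subseteq> \<Union>(set_of ` D)" and x: "lo \<le> x" "x < hi"
  obtain y where y: "matches cs x y"
    using matching_real[OF is_cut_cuts cuts_mem(1) x(1) cuts_mem(2) x(2)] by blast
  then have "y \<in> set_of g" using matches_mem x by blast
  then obtain v where "v \<in> D" "y \<in> set_of v" using cov by blast
  then show "\<exists>v\<in>D. il (mk v) \<le> x \<and> x < ir (mk v)"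
    unfolding mk_bounds using matches_mem[OF y] D x by blast
next
  fix y assume cov: "\<forall>x. lo \<le> x \<longrightarrow> x < hi \<longrightarrow> (\<exists>v\<in>D. il (mk v) \<le> x \<and> x < ir (mk v))"
    and y: "y \<in> set_of g"
  obtain x where x: "matches cs x y"
    using matching_nat[OF is_cut_cuts cuts_mem(1)] y mem_set_of by blast
  then have "lo \<le> x" "x < hi" using matches_mem[OF x, of g] y by auto
  then obtain v where "v \<in> D" "rank cs (lcut (fst v)) \<le> x" "x < rank cs (rcut (snd v))"
    using cov mk_bounds by blast
  then show "y \<in> \<Union>(set_of ` D)" using matches_mem[OF x, of v] D by blast
qed

lemma target_points: "lo < hi"
proof -
  obtain y where y: "y \<in> set_of g" using proper_target by (auto simp: proper_def)
  obtain x where x: "matches cs x y"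
    using matching_nat[OF is_cut_cuts cuts_mem(1)] y mem_set_of by blast
  then show ?thesis using matches_mem[OF x, of g] y by auto
qed

lemma level_bounds: "1 \<le> ilev (mk v) \<and> ilev (mk v) \<le> K"
  using length_takeWhile_le[of "\<lambda>G. v \<notin> set G" ss] by (simp add: mk_item_def)

lemma group_iff:
  assumes v: "v \<in> set us" and i: "i \<in> {1..length ss}"
  shows "set_of v \<in> int_group P i \<longleftrightarrow> ilev (mk v) = i"
proof -
  have mem: "set_of v \<in> int_group P j \<longleftrightarrow> v \<in> set (ss ! (j - 1))" if j: "j \<in> {1..length ss}" for j
    using groups[OF j] proper[OF v] set_of_inject by (metis (no_types, lifting) image_iff)
  define k where "k = length (takeWhile (\<lambda>G. v \<notin> set G) ss)"
  have lev: "ilev (mk v) = Suc k" by (simp add: mk_item_def k_def)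
  show ?thesis
  proof
    assume "set_of v \<in> int_group P i"
    then have "v \<in> set (ss ! (i - 1))" using mem i by blast
    have "k \<le> i - 1"
    proof (rule ccontr)
      assume "\<not> ?thesis"
      then have "i - 1 < length (takeWhile (\<lambda>G. v \<notin> set G) ss)" by (simp add: k_def)
      then have "ss ! (i - 1) \<in> set (takeWhile (\<lambda>G. v \<notin> set G) ss)"
        using takeWhile_nth nth_mem by metis
      with \<open>v \<in> set (ss ! (i - 1))\<close> show False using set_takeWhileD by fast
    qed
    then have k: "k < length ss" "Suc k \<in> {1..length ss}" using i by auto
    then have "v \<in> set (ss ! k)"
      using nth_length_takeWhile[of "\<lambda>G. v \<notin> set G" ss] by (simp add: k_def)
    then have "set_of v \<in> int_group P (Suc k)" using mem[OF k(2)] by simp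
    \<comment> \<open>The level records the first group containing \<open>v\<close>; disjointness
      makes it the only one.\<close>
    moreover have "Suc k = i \<or> int_group P (Suc k) \<inter> int_group P i = {}"
      using disjoint i k(2) unfolding disjoint_family_on_def by blast
    ultimately show "ilev (mk v) = i" using \<open>set_of v \<in> int_group P i\<close> lev by auto
  next
    assume "ilev (mk v) = i"
    then have "i = Suc k" using lev by simp
    with i have "v \<in> set (ss ! k)"
      using nth_length_takeWhile[of "\<lambda>G. v \<notin> set G" ss] by (simp add: k_def)
    then show "set_of v \<in> int_group P i" using mem[OF i] \<open>i = Suc k\<close> by simp
  qed
qed

sublocale grid xs m K
proof
  fix e assume "e \<in> set xs"
  then obtain v where v: "e = mk v" by (auto simp: set_xs)
  show "ir e \<le> m" unfolding v
    using rank_le_length[of cs "rcut (snd g)"] by (simp add: mk_item_def min.coboundedI1)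
  show "1 \<le> ilev e \<and> ilev e \<le> K" unfolding v by (rule level_bounds)
qed

abbreviation "node e \<equiv> (iid e, ilev e, reg e)"

lemma nodes_eq: "nodes us g ss = map node xs"
  by (simp add: nodes_def points_def levels_def)

lemma inside_node: "inside x (node e) \<longleftrightarrow> fst (reg e) \<le> x \<and> x < snd (reg e)"
  by (simp add: inside_def)

text \<open>Pushing never leaves the target, as every point of a region lies in some item and items
  are clipped.\<close>

lemma node_point:
  assumes "e \<in> set xs" "inside x (node e)" shows "lo \<le> x \<and> x < hi"
proof -
  obtain v where "v \<in> set xs" "il v \<le> x" "x < ir v"
    using region_cover assms(2) unfolding inside_node by blast
  then show ?thesis using mk_bounds by (auto simp: set_xs)
qed

abbreviation "ns \<equiv> nodes us g ss"
abbreviation "gns \<equiv> good_nodes us g ss"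
abbreviation "G \<equiv> node_tree gns (n + n) K"

lemma gns_eq: "gns = goods ns [0..<m]"
  by (simp add: good_nodes_def points_def)

lemma set_ns: "set ns = node ` set xs"
  by (simp add: nodes_eq)

lemma finite_xs: "finite (set xs)"
  by simp

lemma num_groups_eq: "length ss = nat \<lceil>log 2 (real n)\<rceil>"
  using T by (simp add: num_groups_def card_ivs)

lemma n_le: "0 < n \<Longrightarrow> real n \<le> 2 ^ length ss"
proof -
  assume "0 < n"
  then have "real n = 2 powr log 2 (real n)" by simp
  also have "\<dots> \<le> 2 powr real (length ss)"
    unfolding num_groups_eq by (intro powr_mono real_nat_ceiling_ge) simp
  finally show ?thesis by (simp add: powr_realpow)
qed

lemma num_groups_tree: assumes "0 < n" shows "num_groups {..<n + n} = K"
proof -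
  have "log 2 (real (n + n)) = log 2 (2 * real n)" by simp
  also have "\<dots> = log 2 (real n) + 1" using assms by (subst log_mult) auto
  finally have "\<lceil>log 2 (real (n + n))\<rceil> = \<lceil>log 2 (real n)\<rceil> + 1" by simp
  moreover have "1 \<le> real n" using assms by linarith
  then have "0 \<le> log 2 (real n)" by (subst zero_le_log_cancel_iff) linarith+
  then have "0 \<le> \<lceil>log 2 (real n)\<rceil>" by linarith
  ultimately show ?thesis
    unfolding num_groups_def num_groups_eq by (simp add: nat_add_distrib)
qed

lemma laminar: assumes "0 < n" shows "laminar ns m K (n + n)"
proof
  fix u v x
  assume u: "u \<in> set ns" and v: "v \<in> set ns"
  obtain d e where d: "d \<in> set xs" "u = node d" and e: "e \<in> set xs" "v = node e"
    using u v unfolding set_ns by blast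
  show "anc u v" if "nlev u < nlev v" "inside x u" "inside x v"
    using region_laminar[of d e x] that unfolding d(2) e(2) by (simp add: inside_def anc_def)
  show "u = v" if "nlev u = nlev v" "inside x u" "inside x v"
    using region_same_level[of d e x] that unfolding d(2) e(2) by (simp add: inside_def)
next
  fix v x assume "v \<in> set ns"
  then obtain e where e: "e \<in> set xs" "v = node e" unfolding set_ns by blast
  show "x < m" if "inside x v"
    using node_point[OF e(1)] rank_le_length[of cs "rcut (snd g)"] that unfolding e(2) by fastforce
  show "1 \<le> nlev v \<and> nlev v \<le> K"
    using level[OF e(1)] unfolding e(2) by simp
  show "nid v < n + n"
    using e iid_mk unfolding set_xs by fastforce
next
  show "inj_on nid (set ns)"
    using iid_inj unfolding set_ns by (auto simp: inj_on_def simp del: split_paired_All)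
  show "0 < n + n" using assms by simp
  show "num_groups {..<n + n} = K" using num_groups_tree[OF assms] .
  show "0 < K" by simp
qed

section \<open>Budgets in both directions\<close>

lemma sum_powers: "(\<Sum>i\<in>{1..j}. c * 2 ^ i) \<le> c * (2 * 2 ^ j)" if "0 \<le> c" for c :: real
proof -
  have "(\<Sum>i\<in>{1..j}. (2::real) ^ i) = 2 * 2 ^ j - 2"
    by (induction j) simp_all
  then have "(\<Sum>i\<in>{1..j}. c * 2 ^ i) = c * (2 * 2 ^ j - 2)"
    by (simp add: sum_distrib_left[symmetric])
  then show ?thesis using that by (simp add: algebra_simps)
qed

lemma card_levels_le:
  assumes "finite A" "0 \<le> c" "\<And>i. i \<in> {1..j} \<Longrightarrow> real (card {e \<in> A. h e = i}) \<le> c * 2 ^ i"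
    and "\<And>e. e \<in> A \<Longrightarrow> 1 \<le> h e \<and> h e \<le> j"
  shows "real (card A) \<le> c * (2 * 2 ^ j)"
proof -
  have "A = (\<Union>i\<in>{1..j}. {e \<in> A. h e = i})" using assms(4) by auto
  then have "card A \<le> (\<Sum>i\<in>{1..j}. card {e \<in> A. h e = i})"
    using card_UN_le[of "{1..j}" "\<lambda>i. {e \<in> A. h e = i}"] by simp
  then have "real (card A) \<le> (\<Sum>i\<in>{1..j}. real (card {e \<in> A. h e = i}))"
    by (metis of_nat_le_iff of_nat_sum)
  also have "\<dots> \<le> (\<Sum>i\<in>{1..j}. c * 2 ^ i)" using assms(3) by (rule sum_mono)
  also have "\<dots> \<le> c * (2 * 2 ^ j)" using assms(2) by (rule sum_powers)
  finally show ?thesis .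
qed

lemma card_group:
  assumes "D \<subseteq> set us" "i \<in> {1..length ss}"
  shows "card (set_of ` D \<inter> int_group P i) = card {v \<in> D. ilev (mk v) = i}"
proof -
  have "set_of ` D \<inter> int_group P i = set_of ` {v \<in> D. ilev (mk v) = i}"
    using group_iff[OF _ assms(2)] assms(1) by blast
  moreover have "inj_on set_of {v \<in> D. ilev (mk v) = i}"
    by (rule inj_on_subset[OF set_of_inj]) (use assms(1) in blast)
  ultimately show ?thesis by (simp add: card_image)
qed

lemma valid_iff:
  assumes "D \<subseteq> set us"
  shows "valid_solution (intervals P) (intcov_feasible P) (int_group P) b (set_of ` D) \<longleftrightarrow>
    (\<forall>x. lo \<le> x \<longrightarrow> x < hi \<longrightarrow> (\<exists>v\<in>D. il (mk v) \<le> x \<and> x < ir (mk v))) \<and>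
    (\<forall>i\<in>{1..length ss}. real (card {v \<in> D. ilev (mk v) = i}) \<le> b * 2 ^ i)"
proof -
  have "set_of ` D \<in> intcov_feasible P \<longleftrightarrow> set_of g \<subseteq> \<Union>(set_of ` D)"
    using assms by (auto simp: intcov_feasible_def ivs target)
  then show ?thesis
    unfolding valid_solution_def T cover_iff[OF assms] using card_group[OF assms] by simp
qed

lemma valid_obtain:
  assumes "valid_solution (intervals P) (intcov_feasible P) (int_group P) b S"
  obtains D where "D \<subseteq> set us" "S = set_of ` D"
proof -
  have "S \<subseteq> set_of ` set us" using assms by (simp add: valid_solution_def intcov_feasible_def ivs)
  then obtain D where "D \<subseteq> set us" "S = set_of ` D" by (rule subset_imageE)
  then show ?thesis by (rule that)
qed

lemma assigned_nodes_cover: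
  assumes D: "D \<subseteq> set us" and cov: "\<And>x. lo \<le> x \<Longrightarrow> x < hi \<Longrightarrow> \<exists>v\<in>D. il (mk v) \<le> x \<and> x < ir (mk v)"
    and x: "lo \<le> x" "x < hi"
  shows "\<exists>w\<in>node ` (\<Union>v\<in>D. assigned (mk v)). inside x w"
proof -
  obtain v where v: "v \<in> D" "il (mk v) \<le> x" "x < ir (mk v)" using cov x by blast
  then have "mk v \<in> set xs" using D by (auto simp: set_xs)
  then obtain e where "e \<in> assigned (mk v)" "inside x (node e)"
    using assigned_cover v(2,3) inside_node by metis
  then show ?thesis using v(1) by blast
qed

lemma assigned_subset: "assigned e \<subseteq> set xs"
  by (auto simp: assigned_def)

lemma valid_coverable:
  assumes "valid_solution (intervals P) (intcov_feasible P) (int_group P) b S"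
  shows "coverable us g ss"
proof -
  obtain D where D: "D \<subseteq> set us" "S = set_of ` D" using valid_obtain[OF assms] .
  have cov: "\<And>x. lo \<le> x \<Longrightarrow> x < hi \<Longrightarrow> \<exists>v\<in>D. il (mk v) \<le> x \<and> x < ir (mk v)"
    using assms unfolding D(2) valid_iff[OF D(1)] by blast
  show ?thesis
    unfolding coverable_def
  proof (intro ballI impI)
    fix x assume x: "lo \<le> x \<and> x < hi"
    then obtain w where "w \<in> node ` (\<Union>v\<in>D. assigned (mk v))" "inside x w"
      using assigned_nodes_cover[OF D(1) cov] by blast
    then show "\<exists>v\<in>set ns. inside x v" using assigned_subset unfolding set_ns by blast
  qed
qed

lemma coverable_nonempty: "coverable us g ss \<Longrightarrow> 0 < n"
  using target_points rank_le_length[of cs "rcut (snd g)"]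
  by (cases us) (auto simp: coverable_def points_def nodes_def items_def intro!: exI[of _ lo])

text \<open>The last group fits its budget whatever is chosen, even with factor 1; this pays for the
  padding and for the intervals without a group.\<close>

lemma tree_card_le: assumes "0 < n" shows "real (card (A \<inter> tree_group G K)) \<le> 2 ^ K"
proof -
  have "card (A \<inter> tree_group G K) \<le> card {..<n + n}"
    by (rule card_mono) (auto simp: node_tree_def)
  then have "real (card (A \<inter> tree_group G K)) \<le> real n + real n"
    by (simp only: of_nat_add[symmetric] of_nat_le_iff card_lessThan)
  also have "\<dots> \<le> 2 ^ K" using n_le[OF assms] by simp
  finally show ?thesis .
qed

lemma forward:
  assumes S: "valid_solution (intervals P) (intcov_feasible P) (int_group P) b S" and b: "1 \<le> b"
  shows "\<exists>A. valid_solution (tree_ground G) (treecov_feasible G) (tree_group G) (8 * b) A"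
proof -
  have n: "0 < n" using coverable_nonempty[OF valid_coverable[OF S]] .
  interpret L: laminar ns m K "n + n" using laminar[OF n] .
  obtain D where D: "D \<subseteq> set us" "S = set_of ` D" using valid_obtain[OF S] .
  have cov: "\<And>x. lo \<le> x \<Longrightarrow> x < hi \<Longrightarrow> \<exists>v\<in>D. il (mk v) \<le> x \<and> x < ir (mk v)"
    and budget: "\<And>i. i \<in> {1..length ss} \<Longrightarrow> real (card {v \<in> D. ilev (mk v) = i}) \<le> b * 2 ^ i"
    using S unfolding D(2) valid_iff[OF D(1)] by blast+
  have finD: "finite D" using D(1) finite_subset by blast
  define I where "I = (\<Union>v\<in>D. assigned (mk v))"
  have I: "I \<subseteq> set xs" unfolding I_def using assigned_subset by blast
  define A where "A = nid ` (node ` I \<inter> set gns) \<union> {p. p < n + n \<and> (\<forall>b\<in>set gns. nid b \<noteq> p)}"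
  have "node ` I \<subseteq> set ns" using I unfolding set_ns by blast
  then have feas: "A \<in> treecov_feasible G"
    unfolding A_def gns_eq
  proof (rule L.covers_feasible)
    fix x v assume "v \<in> set ns" "inside x v"
    then have "lo \<le> x" "x < hi" using node_point unfolding set_ns by blast+
    then show "\<exists>w\<in>node ` I. inside x w" unfolding I_def using assigned_nodes_cover[OF D(1) cov] by blast
  qed
  have card: "real (card (A \<inter> tree_group G j)) \<le> 8 * b * 2 ^ j" if j: "j \<in> {1..K}" for j
  proof (cases "j = K")
    case True
    have "real (card (A \<inter> tree_group G j)) \<le> 2 ^ K" using tree_card_le[OF n] unfolding True .
    also have "\<dots> \<le> 8 * b * 2 ^ j" using b unfolding True by simp
    finally show ?thesis .
  next
    case False
    let ?I = "{e \<in> I. ilev e = j}" and ?D = "{v \<in> D. ilev (mk v) \<le> j}"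
    have finI: "finite ?I" using I finite_subset by fastforce
    \<comment> \<open>Padding leaves occur only in group \<open>K\<close>, so below it only nodes of
      assigned items count.\<close>
    have "A \<inter> tree_group G j \<subseteq> iid ` ?I"
    proof
      fix p assume p: "p \<in> A \<inter> tree_group G j"
      then obtain w where w: "w \<in> set gns" "nid w = p" "nlev w = j"
        using False by (auto simp: node_tree_def in_group_def)
      then obtain e where e: "e \<in> I" "node e \<in> set gns" "iid e = p"
        using p by (auto simp: A_def)
      then have "w = node e" using L.nid_inject[of w "node e"] w unfolding gns_eq by simp
      with e w show "p \<in> iid ` ?I" by auto
    qed
    then have "card (A \<inter> tree_group G j) \<le> card ?I"
      using finI by (rule surj_card_le[rotated])
    also have "?I \<subseteq> (\<Union>v\<in>?D. {e \<in> assigned (mk v). ilev e = j})"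
      unfolding I_def using assigned_level by blast
    then have "card ?I \<le> card (\<Union>v\<in>?D. {e \<in> assigned (mk v). ilev e = j})"
      using finD finite_subset[OF assigned_subset finite_xs] by (intro card_mono) auto
    also have "\<dots> \<le> (\<Sum>v\<in>?D. card {e \<in> assigned (mk v). ilev e = j})"
      using finD by (intro card_UN_le) simp
    also have "\<dots> \<le> (\<Sum>v\<in>?D. 2)"
      using D(1) by (intro sum_mono card_assigned) (auto simp: set_xs)
    finally have "card (A \<inter> tree_group G j) \<le> card ?D * 2" by simp
    then have "real (card (A \<inter> tree_group G j)) \<le> 2 * real (card ?D)" by linarith
    \<comment> \<open>Only intervals of level at most \<open>j\<close> are assigned nodes of level
      \<open>j\<close>, at most two each. With the geometric sum the total is at most
      \<open>4 * b * 2 ^ j\<close>.\<close>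
    also have "real (card ?D) \<le> b * (2 * 2 ^ j)"
    proof (rule card_levels_le[where h = "\<lambda>v. ilev (mk v)"])
      show "real (card {v \<in> ?D. ilev (mk v) = i}) \<le> b * 2 ^ i" if "i \<in> {1..j}" for i
      proof -
        have "{v \<in> ?D. ilev (mk v) = i} = {v \<in> D. ilev (mk v) = i}" using that by auto
        then show ?thesis using budget[of i] that j False by simp
      qed
    qed (use finD b level_bounds in auto)
    finally show ?thesis using b by simp
  qed
  from feas card show ?thesis
    unfolding valid_solution_def L.tree_ground_eq[folded gns_eq] num_groups_tree[OF n] by blast
qed

lemma backward:
  assumes cvb: "coverable us g ss" and b: "0 \<le> b"
    and sol: "valid_solution (tree_ground G) (treecov_feasible G) (tree_group G) b (set sol)"
  shows "valid_solution (intervals P) (intcov_feasible P) (int_group P) (3 * b)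
    (set_of ` set (translate us g ss sol))"
proof -
  have n: "0 < n" using coverable_nonempty[OF cvb] .
  interpret L: laminar ns m K "n + n" using laminar[OF n] .
  have feas: "set sol \<in> treecov_feasible G"
    and budget: "\<And>i. i \<in> {1..K} \<Longrightarrow> real (card (set sol \<inter> tree_group G i)) \<le> b * 2 ^ i"
    using sol unfolding valid_solution_def L.tree_ground_eq[folded gns_eq] num_groups_tree[OF n] by blast+
  \<comment> \<open>The items behind the genuine nodes of the tree solution, without the
    padding.\<close>
  define A where "A = {d \<in> set xs. iid d \<in> set sol \<and> (\<exists>w\<in>set gns. nid w = iid d)}"
  define D where "D = set (translate us g ss sol)"
  have D: "D = {v \<in> set us. \<exists>d\<in>A. mk v = d \<or> cross d (mk v)}"
    unfolding D_def A_def translate_def points_def levels_def set_filter by blast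
  have finA: "finite A" by (simp add: A_def)
  have cardA: "real (card {d \<in> A. ilev d = i}) \<le> b * 2 ^ i" if i: "i \<in> {1..K}" for i
  proof -
    have "iid ` {d \<in> A. ilev d = i} \<subseteq> set sol \<inter> tree_group G i"
    proof
      fix p assume "p \<in> iid ` {d \<in> A. ilev d = i}"
      then obtain d where "d \<in> A" "ilev d = i" "p = iid d" by blast
      then obtain w where d: "d \<in> A" "ilev d = i" "p = iid d" "w \<in> set gns" "nid w = iid d"
        unfolding A_def by blast
      then obtain e where "e \<in> set xs" "w = node e"
        using L.goodD(1) unfolding gns_eq set_ns by blast
      then have "w = node d" using d iid_inj by (auto simp: A_def dest: inj_onD)
      then have "nlev w = i" using d(2) by simp
      then have "in_group gns K i p" unfolding in_group_def using d(3-5) by metis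
      then show "p \<in> set sol \<inter> tree_group G i"
        using d(1,3,5) L.nid_less[folded gns_eq, OF d(4)] by (simp add: A_def node_tree_def)
    qed
    moreover have "inj_on iid {d \<in> A. ilev d = i}"
      using iid_inj by (rule inj_on_subset) (auto simp: A_def)
    ultimately have "card {d \<in> A. ilev d = i} \<le> card (set sol \<inter> tree_group G i)"
      by (intro card_inj_on_le[of iid]) simp_all
    then show ?thesis using budget[OF i] by linarith
  qed
  have cov: "\<exists>v\<in>D. il (mk v) \<le> x \<and> x < ir (mk v)" if x: "lo \<le> x" "x < hi" for x
  proof -
    have "x \<in> set (points us g)" using x rank_le_length[of cs "rcut (snd g)"] by (simp add: points_def)
    then obtain w where "w \<in> set ns" "inside x w" using cvb x unfolding coverable_def by blast
    then obtain d where d: "d \<in> set gns" "nid d \<in> set sol" "inside x d"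
      using L.feasible_covers[folded gns_eq] feas by metis
    then obtain e where e: "e \<in> set xs" "d = node e"
      using L.goodD(1) unfolding gns_eq set_ns by blast
    then have "nid d = iid e" by simp
    then have "iid e \<in> set sol" "\<exists>w\<in>set gns. nid w = iid e" using d(1,2) by (simp, blast)
    then have "e \<in> A" using e(1) by (simp add: A_def)
    obtain u where "u \<in> set xs" "u = e \<or> cross e u" "il u \<le> x" "x < ir u"
      using region_cover d(3) unfolding e(2) inside_node by blast
    then show ?thesis using \<open>e \<in> A\<close> unfolding D set_xs by blast
  qed
  have card: "real (card {v \<in> D. ilev (mk v) = i}) \<le> 3 * b * 2 ^ i" if i: "i \<in> {1..length ss}" for i
  proof -
    let ?A = "{d \<in> A. ilev d \<le> i}"
    \<comment> \<open>A chosen node of level at most \<open>i\<close> contributes at most one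
      interval of level \<open>i\<close>: itself, or the unique crossing one. Where nothing crosses,
      the value of \<open>THE\<close> is arbitrary but harmless, since only the size of the image
      matters.\<close>
    let ?h = "\<lambda>d. if ilev d = i then d else (THE e. cross d e \<and> ilev e = i)"
    have "mk ` {v \<in> D. ilev (mk v) = i} \<subseteq> ?h ` ?A"
    proof
      fix e assume "e \<in> mk ` {v \<in> D. ilev (mk v) = i}"
      then obtain d where d: "d \<in> A" "e = d \<or> cross d e" "ilev e = i" unfolding D by blast
      show "e \<in> ?h ` ?A"
      proof (cases "cross d e")
        case True
        then have "ilev d < i" using cross_level d(3) by blast
        moreover have "(THE e. cross d e \<and> ilev e = i) = e"
          using True d(3) cross_unique[of d] by (intro the_equality) auto
        ultimately show ?thesis using d(1) by (intro image_eqI[of _ _ d]) auto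
      next
        case False
        then show ?thesis using d by (intro image_eqI[of _ _ d]) auto
      qed
    qed
    moreover have "finite ?A" using finA by simp
    ultimately have "card (mk ` {v \<in> D. ilev (mk v) = i}) \<le> card ?A"
      by (rule surj_card_le[rotated])
    moreover have "inj_on mk {v \<in> D. ilev (mk v) = i}"
      using mk_inj by (rule inj_on_subset) (auto simp: D)
    ultimately have "real (card {v \<in> D. ilev (mk v) = i}) \<le> real (card ?A)"
      by (simp add: card_image)
    also have "\<dots> \<le> b * (2 * 2 ^ i)"
    proof (rule card_levels_le[where h = ilev])
      show "real (card {d \<in> ?A. ilev d = k}) \<le> b * 2 ^ k" if "k \<in> {1..i}" for k
      proof -
        have "{d \<in> ?A. ilev d = k} = {d \<in> A. ilev d = k}" using that by auto
        then show ?thesis using cardA[of k] that i by simp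
      qed
      show "1 \<le> ilev e \<and> ilev e \<le> i" if "e \<in> ?A" for e
        using that level[of e] by (simp add: A_def)
    qed (use finA b in auto)
    also have "\<dots> \<le> 3 * b * 2 ^ i" using b by simp
    finally show ?thesis .
  qed
  have "D \<subseteq> set us" unfolding D by blast
  then show ?thesis unfolding D_def[symmetric] valid_iff[OF \<open>D \<subseteq> set us\<close>] using cov card by blast
qed

section \<open>Encodings of instances and answers, and the final program\<close>

lemma encodes_set_enc:
  assumes "distinct l" "\<And>x. R x (enc x)" shows "encodes_set R (set l) (enc l)"
proof -
  have "list_all2 R l (map enc l)" using assms(2) by (simp add: list_all2_map2 list_all2_same)
  then show ?thesis unfolding encodes_set_def encodes_list_def enc_list_def using assms(1) by blast
qed

lemma encodes_set_nat: "distinct l \<Longrightarrow> encodes_set encodes_nat (set l) (enc l)"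
  by (rule encodes_set_enc) (simp_all add: encodes_nat_def enc_nat_def)

lemma encodes_set_edge: "distinct l \<Longrightarrow> encodes_set encodes_edge (set l) (enc l)"
  by (erule encodes_set_enc) (auto simp: encodes_edge_def enc_nat_def)

lemma treecov_input_tree_of:
  assumes n: "0 < n" shows "treecov_input G (enc (tree_of us g ss))"
proof -
  interpret L: laminar ns m K "n + n" using laminar[OF n] .
  note is_tree = L.is_treecov_node_tree[folded gns_eq]
  let ?V = "[0..<Suc (n + n)]"
  let ?E = "filter (\<lambda>e. tree_edge gns (n + n) (fst e) (snd e)) (List.product ?V ?V)"
  let ?S = "map (\<lambda>k. filter (in_group gns K (Suc k)) [0..<n + n]) [0..<K]"
  have tree: "tree_of us g ss = (?V, ?E, n + n, ?S)"
    by (simp add: tree_of_def)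
  have "edges G \<subseteq> verts G \<times> verts G" using is_tree by (simp add: is_treecov_def rooted_tree_def)
  then have E: "edges G = set ?E"
    by (auto simp: node_tree_def)
  have V: "verts G = set ?V" by (auto simp: node_tree_def)
  have S: "tree_group G k = set (filter (in_group gns K k) [0..<n + n])" for k
    by (auto simp: node_tree_def)
  have "encodes_set encodes_nat (verts G) (enc ?V)"
    unfolding V by (rule encodes_set_nat) simp
  moreover have "encodes_set encodes_edge (edges G) (enc ?E)"
    unfolding E by (rule encodes_set_edge) (intro distinct_filter distinct_product distinct_upt)
  moreover have "encodes_groups encodes_nat (tree_ground G) (tree_group G) (enc ?S)"
  proof -
    have "[1..<Suc K] = map Suc [0..<K]" by (simp add: map_Suc_upt)
    moreover have "list_all2 (encodes_set encodes_nat) (map (tree_group G) (map Suc [0..<K])) (map enc ?S)"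
      unfolding list.rel_map list_all2_same S by (intro ballI encodes_set_nat distinct_filter distinct_upt)
    ultimately show ?thesis
      unfolding encodes_groups_def encodes_list_def L.tree_ground_eq[folded gns_eq] num_groups_tree[OF n] enc_list_def
      by metis
  qed
  moreover have "root G = n + n" by (simp add: node_tree_def)
  ultimately show ?thesis
    unfolding treecov_input_def tree using is_tree
    by (auto simp: enc_nat_def simp del: enc_list_simps)
qed

lemma distinct_translate: "distinct (translate us g ss sol)" "set (translate us g ss sol) \<subseteq> set us"
  using distinct by (auto simp: translate_def)

lemma encodes_interval_enc: "proper v \<Longrightarrow> encodes_interval (set_of v) (enc v)"
  by (cases v) (auto simp: encodes_interval_def proper_def enc_endpoint_def)

lemma encodes_translate:
  "encodes_set encodes_interval (set_of ` set (translate us g ss sol)) (enc (translate us g ss sol))"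
proof -
  let ?l = "translate us g ss sol"
  have "distinct (map set_of ?l)"
    using distinct_translate inj_on_subset[OF set_of_inj] by (simp add: distinct_map)
  moreover have "list_all2 encodes_interval (map set_of ?l) (map enc ?l)"
    unfolding list.rel_map list_all2_same using distinct_translate(2) proper encodes_interval_enc by blast
  ultimately show ?thesis
    unfolding encodes_set_def encodes_list_def enc_list_def by (metis set_map)
qed

lemma correct_None:
  assumes "\<And>S. \<not> valid_solution (intervals P) (intcov_feasible P) (int_group P) b S"
  shows "intcov_correct c b P (Atom 0)"
  unfolding intcov_correct_def
  by (rule exI[of _ None]) (use assms in \<open>simp add: correct_answer_def\<close>)

text \<open>The tree answer may list its set in any order, so \<open>y\<close> is decoded to some
  list, which \<open>translate\<close> then processes. The answer \<open>None\<close> is passed on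
  by contraposition of \<open>forward\<close>.\<close>

lemma correct_output:
  assumes b: "1 \<le> b" "8 * b \<le> c" and cvb: "coverable us g ss"
    and y: "treecov_correct c (8 * b) G y"
  obtains sol where "y = enc (sol :: nat list option)"
    "intcov_correct (3 * c) b P (enc (map_option (translate us g ss) sol))"
proof -
  obtain ans where ans: "encodes_option (encodes_set encodes_nat) ans y"
    "correct_answer (tree_ground G) (treecov_feasible G) (tree_group G) c (8 * b) ans"
    using y by (auto simp: treecov_correct_def)
  show ?thesis
  proof (cases ans)
    case None
    then have "\<not> valid_solution (intervals P) (intcov_feasible P) (int_group P) b S" for S
      using ans(2) forward[OF _ b(1), of S] by (auto simp: correct_answer_def)
    then show ?thesis using that[of None] correct_None ans(1) None by simp
  next
    case (Some A)
    then obtain l vs where l: "set l = A" "list_all2 encodes_nat l vs" "y = Cell (Atom 1) (list_code vs)"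
      using ans(1) by (auto simp: encodes_set_def encodes_list_def)
    have "vs = map enc l"
      using l(2) by (induction rule: list_all2_induct) (auto simp: encodes_nat_def enc_nat_def)
    then have y: "y = enc (Some l)" using l(3) by (simp add: enc_list_def)
    have "valid_solution (intervals P) (intcov_feasible P) (int_group P) (3 * c)
        (set_of ` set (translate us g ss l))"
      using backward[OF cvb, of c l] ans(2) b by (simp add: Some l(1) correct_answer_def)
    then have "intcov_correct (3 * c) b P (enc (Some (translate us g ss l)))"
      unfolding intcov_correct_def
      by (intro exI[of _ "Some (set_of ` set (translate us g ss l))"])
        (simp add: correct_answer_def encodes_translate)
    then show ?thesis using that[OF y] by simp
  qed
qed

end

lemma list_all2_encodes_intervalE:
  assumes "list_all2 encodes_interval Is vs"
  obtains l where "Is = map set_of l" "vs = map enc l" "\<forall>v\<in>set l. proper v"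
  using assms
proof (induction arbitrary: thesis rule: list_all2_induct)
  case (Cons I Is v vs)
  obtain l where l: "Is = map set_of l" "vs = map enc l" "\<forall>v\<in>set l. proper v" using Cons.IH .
  obtain a b where ab: "I \<noteq> {}" "I = interval a b" "v = Cell (endpoint_code a) (endpoint_code b)"
    using Cons.hyps(1) by (auto simp: encodes_interval_def)
  show ?case
    by (rule Cons.prems[of "(a, b) # l"]) (use l ab in \<open>auto simp: enc_endpoint_def proper_def\<close>)
qed simp

lemma encodes_set_intervalE:
  assumes "encodes_set encodes_interval A w"
  obtains l where "distinct l" "A = set_of ` set l" "w = enc l" "\<forall>v\<in>set l. proper v"
proof -
  obtain Is vs where "distinct Is" "set Is = A" "list_all2 encodes_interval Is vs" "w = list_code vs"
    using assms by (auto simp: encodes_set_def encodes_list_def)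
  moreover then obtain l where "Is = map set_of l" "vs = map enc l" "\<forall>v\<in>set l. proper v"
    using list_all2_encodes_intervalE by metis
  ultimately show ?thesis using that[of l] by (auto simp: enc_list_def distinct_map)
qed

lemma list_all2_encodes_setE:
  assumes "list_all2 (encodes_set encodes_interval) As ws"
  obtains ls where "length ls = length As" "ws = map enc ls"
    "\<forall>i<length As. As ! i = set_of ` set (ls ! i) \<and> (\<forall>v\<in>set (ls ! i). proper v)"
proof -
  have "\<forall>i<length As. \<exists>l. As ! i = set_of ` set l \<and> ws ! i = enc l \<and> (\<forall>v\<in>set l. proper v)"
    using list_all2_nthD[OF assms] encodes_set_intervalE by metis
  then obtain L where L: "\<forall>i<length As. As ! i = set_of ` set (L i) \<and> ws ! i = enc (L i) \<and> (\<forall>v\<in>set (L i). proper v)"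
    by metis
  show ?thesis
    by (rule that[of "map L [0..<length As]"])
      (use L list_all2_lengthD[OF assms] in \<open>auto intro!: nth_equalityI\<close>)
qed

text \<open>Encodings are relations admitting any listing of a set. Fixing the listings read off
  from \<open>x\<close> turns the input into the code of a tuple of lists, to which the
  polynomial-time functions apply.\<close>

lemma intcov_inputE:
  assumes "intcov_input P x"
  obtains us g ss where "intcov_instance P us g ss" "x = enc (us, g, ss)"
proof -
  let ?T = "num_groups (intervals P)"
  obtain u w s where P: "is_intcov P" and u: "encodes_set encodes_interval (intervals P) u"
    and w: "encodes_interval (target P) w"
    and s: "encodes_groups encodes_interval (intervals P) (int_group P) s" and x: "x = Cell u (Cell w s)"
    using assms by (auto simp: intcov_input_def)
  obtain us where us: "distinct us" "intervals P = set_of ` set us" "u = enc us" "\<forall>v\<in>set us. proper v"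
    using encodes_set_intervalE[OF u] .
  obtain a b where g: "target P = interval a b" "interval a b \<noteq> {}" "w = enc (a, b)"
    using w by (auto simp: encodes_interval_def enc_endpoint_def)
  obtain ws where ws: "list_all2 (encodes_set encodes_interval) (map (int_group P) [1..<Suc ?T]) ws" "s = list_code ws"
    using s by (auto simp: encodes_groups_def encodes_list_def)
  obtain ss where ss: "length ss = ?T" "ws = map enc ss"
    "\<forall>i<?T. map (int_group P) [1..<Suc ?T] ! i = set_of ` set (ss ! i) \<and> (\<forall>v\<in>set (ss ! i). proper v)"
    using list_all2_encodes_setE[OF ws(1)] by (auto)
  have ss': "int_group P i = set_of ` set (ss ! (i - 1)) \<and> (\<forall>v\<in>set (ss ! (i - 1)). proper v)"
    if "i \<in> {1..?T}" for i
  proof -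
    have i: "i - 1 < ?T" using that by auto
    have "map (int_group P) [1..<Suc ?T] ! (i - 1) = int_group P i"
      using that by (subst nth_map) (auto)
    with ss(3)[rule_format, OF i] show ?thesis by simp
  qed
  have "intcov_instance P us (a, b) ss"
    using us g P ss' by unfold_locales (auto simp: proper_def is_intcov_def ss(1))
  then show ?thesis
    by (rule that) (simp add: x us(3) g(3) ws(2) ss(2) enc_list_def)
qed

text \<open>Brings the given polynomial into the form used by \<open>polybounded\<close>;
  \<open>s \<ge> 1\<close> allows all exponents to be raised to a common one.\<close>

lemma poly_bound: "\<exists>C. \<forall>s\<ge>1. poly p s \<le> C * s ^ (C::nat)"
proof (induction p)
  case (pCons a p)
  then obtain C where C: "\<And>s. 1 \<le> s \<Longrightarrow> poly p s \<le> C * s ^ C" by blast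
  have "poly (pCons a p) s \<le> (a + C + 1) * s ^ (a + C + 1)" if s: "1 \<le> s" for s
  proof -
    have "poly (pCons a p) s \<le> a * 1 + s * (C * s ^ C)" using C[OF s] by simp
    also have "\<dots> \<le> a * s ^ (a + C + 1) + C * s ^ (a + C + 1)"
    proof (rule add_mono)
      show "a * 1 \<le> a * s ^ (a + C + 1)" using s by (intro mult_left_mono) auto
      have "s * s ^ C \<le> s ^ (a + C + 1)"
        unfolding power_Suc[symmetric] using s by (intro power_increasing) auto
      then show "s * (C * s ^ C) \<le> C * s ^ (a + C + 1)" by (simp add: mult.left_commute)
    qed
    also have "\<dots> \<le> (a + C + 1) * s ^ (a + C + 1)" by (simp add: algebra_simps)
    finally show ?thesis .
  qed
  then show ?case by blast
qed simp

theorem theorem6p1: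
  fixes c c0 :: real
  assumes "c0 \<ge> 1" and "c \<ge> 8 * c0"
    and "poly_time_LogBgt_TreeCov c (8 * c0)"
  shows "poly_time_LogBgt_IntCov (3 * c) c0"
proof -
  obtain p q where p: "\<And>G x. treecov_input G x \<Longrightarrow>
      \<exists>y t. run p x y t \<and> t \<le> poly q (val_size x) \<and> treecov_correct c (8 * c0) G y"
    using assms(3) unfolding poly_time_LogBgt_TreeCov_def poly_time_solvable_def by blast
  obtain C where C: "\<And>s. 1 \<le> s \<Longrightarrow> poly q s \<le> C * s ^ C" using poly_bound by blast
  let ?cov = "\<lambda>I :: iv list \<times> iv \<times> iv list list. coverable (fst I) (fst (snd I)) (snd (snd I))"
  let ?tree = "\<lambda>I :: iv list \<times> iv \<times> iv list list. tree_of (fst I) (fst (snd I)) (snd (snd I))"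
  let ?back = "\<lambda>z. map_option (translate (fst (fst z)) (fst (snd (fst z))) (snd (snd (fst z)))) (snd z)
    :: iv list option"
  have cov: "polytime ?cov" by (intro polytime_coverable polytime_intros)
  have tree: "polytime ?tree" by (intro polytime_tree_of polytime_intros)
  have trans: "polytime ?back"
  proof -
    have "polytime (\<lambda>z. case snd z of None \<Rightarrow> None
      | Some sol \<Rightarrow> Some (translate (fst (fst z)) (fst (snd (fst z))) (snd (snd (fst z))) sol))"
      by (intro polytime_translate polytime_intros)
    then show ?thesis by (rule polytime_cong) (simp split: option.split)
  qed
  obtain p1 c1 where p1: "\<And>I. run p1 (enc I) (enc (?cov I)) (c1 I)" "polybounded c1" using polytimeE[OF cov] by blast
  obtain p2 c2 where p2: "\<And>I. run p2 (enc I) (enc (?tree I)) (c2 I)" "polybounded c2" using polytimeE[OF tree] by blast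
  obtain p3 D where p3: "\<And>z s. sz z \<le> s \<Longrightarrow> \<exists>t\<le>D * s ^ D. run p3 (enc z) (enc (?back z)) t"
    by (rule polytimeE_mono[OF trans]) (rule that)
  \<comment> \<open>\<open>p\<close> is only known to halt on codes of tree instances, so it defines
    no total polynomial-time function and its run is composed by hand. The copy keeps the interval
    instance for translating the answer back.\<close>
  let ?P = "Cond p1 (Seq (Fork (Prim Copy) (Seq p2 p)) p3) (Prim (Const (Atom 0)))"
  define d where "d I = C * sz (?tree I) ^ C" for I
  \<comment> \<open>Bounds the size of the pair of instance and tree answer: the answer is no larger
    than the cost of \<open>p\<close>, which is at most \<open>d I\<close>.\<close>
  define s where "s I = 1 + sz I + d I" for I
  define e where "e I = D * s I ^ D" for I
  let ?c = "\<lambda>I. 10 + c1 I + c2 I + d I + e I + 10 * sz I + 10 * s I"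
  have "polybounded ?c"
    unfolding e_def s_def d_def by (intro polybounded_intros p1 p2 tree)
  then obtain B where B: "\<And>I. ?c I \<le> B * sz I ^ B" unfolding polybounded_def by blast
  have "\<exists>y t. run ?P x y t \<and> t \<le> poly (monom B B) (val_size x) \<and> intcov_correct (3 * c) c0 P y"
    if inp: "intcov_input P x" for P x
  proof -
    obtain us g ss where inst: "intcov_instance P us g ss" and x: "x = enc (us, g, ss)"
      using intcov_inputE[OF inp] .
    interpret intcov_instance P us g ss by (rule inst)
    define I where "I = (us, g, ss)"
    have "\<exists>y t. run ?P (enc I) y t \<and> t \<le> ?c I \<and> intcov_correct (3 * c) c0 P y"
    proof (cases "coverable us g ss")
      case True
      note input = treecov_input_tree_of[OF coverable_nonempty[OF True]]
      obtain y t where y: "run p (enc (?tree I)) y t" "t \<le> poly q (sz (?tree I))" "treecov_correct c (8 * c0) G y"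
        using p[OF input] by (auto simp: I_def sz_def)
      have t: "t \<le> d I" using y(2) C[of "sz (?tree I)"] sz_pos[of "?tree I"] by (simp add: d_def)
      obtain sol where sol: "y = enc sol" "intcov_correct (3 * c) c0 P (enc (map_option (translate us g ss) sol))"
        using correct_output[OF assms(1,2) True y(3)] by blast
      have "sz sol \<le> t" using run_output_size[OF y(1)] by (simp add: sol(1) sz_def)
      then have size: "sz (I, sol) \<le> s I" using t by (simp add: s_def)
      obtain u where u: "u \<le> e I" "run p3 (enc (I, sol)) (enc (?back (I, sol))) u"
        using p3[OF size] by (auto simp: e_def)
      have "run (Fork (Prim Copy) (Seq p2 p)) (enc I) (enc (I, sol)) (2 * sz I + (1 + c2 I + t) + sz I + sz (I, sol))"
        using run.Fork[OF run.Prim[of Copy "enc I"] run.Seq[OF p2(1) y(1)]] by (simp add: sol(1) sz_def mult_2)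
      from run.Cond_True[OF p1(1) _ run.Seq[OF this u(2)], of "Prim (Const (Atom 0))"] True
      have "run ?P (enc I) (enc (?back (I, sol)))
          (c1 I + (1 + (2 * sz I + (1 + c2 I + t) + sz I + sz (I, sol)) + u) + sz I)"
        by (simp add: truthy_enc_bool I_def sz_def)
      moreover have "c1 I + (1 + (2 * sz I + (1 + c2 I + t) + sz I + sz (I, sol)) + u) + sz I \<le> ?c I"
        using t u(1) size by linarith
      moreover have "intcov_correct (3 * c) c0 P (enc (?back (I, sol)))" using sol(2) by (simp add: I_def)
      ultimately show ?thesis by blast
    next
      case False
      from run.Cond_False[OF p1(1)[of I] _ run.Prim[of "Const (Atom 0)" "enc I"]] False
      have "run ?P (enc I) (Atom 0) (c1 I + (sz I + 1) + sz I)"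
        by (simp add: truthy_enc_bool I_def sz_def val_size_Atom_0 del: val_size.simps)
      moreover have "c1 I + (sz I + 1) + sz I \<le> ?c I" by linarith
      moreover have "intcov_correct (3 * c) c0 P (Atom 0)"
        by (rule correct_None) (use valid_coverable False in blast)
      ultimately show ?thesis by blast
    qed
    moreover have "val_size x = sz I" by (simp add: x I_def sz_def)
    ultimately show ?thesis
      using order_trans[OF _ B[of I]] by (metis I_def poly_monom x)
  qed
  then show ?thesis
    unfolding poly_time_LogBgt_IntCov_def poly_time_solvable_def by blast
qed

end
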